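(* Let the random $N\times N$ quaternionic matrices $X_1,\dots,X_n$ be symplectically invariant. Then for all $\iota:\pm[n]\to[N]$ and $\eta:\pm[n]\to\{1,-1\}$, $$\mathbb{E}\big(X^{(1)}_{\iota_1,\iota_{-1};\eta_1,\eta_{-1}}\cdots X^{(n)}_{\iota_n,\iota_{-n};\eta_n,\eta_{-n}}\big)=\sum_{\substack{\alpha\in\mathrm{PM}(n)\\ \iota=\iota\circ\delta\alpha\\ \mathrm{sgn}\cdot\eta=(\mathrm{sgn}\circ\alpha)\cdot(\eta\circ\delta\alpha)}}(2N)^{\#(\alpha)/2-n}\Big[\prod_{\substack{k\in[n]\\ -k\in\mathrm{FD}(\alpha)}}\eta_k\eta_{-k}\Big]f(\alpha),$$ where $f:\mathrm{PM}(n)\to\mathbb{C}$ is the normalized matrix cumulant $$f(\alpha)=\sum_{\pi\in\mathrm{PM}(n)}(-2N)^{\chi(\alpha,\pi)-\#(\alpha)}\,\mathrm{wg}\big(\mathrm{FD}(\alpha\pi^{-1})\big)\,\mathbb{E}\big[\mathrm{Re}_{\mathrm{FD}(\pi)}\mathrm{tr}_{\mathrm{FD}(\pi)}(X_1,\dots,X_n)\big].$$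
   Context: $\mathrm{Sp}(N)$ is the group of $N\times N$ quaternionic matrices $U$ with $U^*U=I_N$ ($^*$ the conjugate transpose). $X_1,\dots,X_n$ are symplectically invariant if for every $U\in\mathrm{Sp}(N)$ the joint distribution of $U^*X_1U,\dots,U^*X_nU$ is the same as that of $X_1,\dots,X_n$. All expectations written are assumed to exist. The quaternion $a+bi+cj+dk$ is represented by the $2\times2$ complex matrix $\begin{pmatrix}a+bi&c+di\\-c+di&a-bi\end{pmatrix}$, rows and columns indexed by $1,-1$ in this order; $A_{\iota_1,\iota_2;\eta_1,\eta_2}$ is the $(\eta_1,\eta_2)$ entry of the matrix representing the quaternion $A_{\iota_1\iota_2}$. Write $A^{(k)}$ for $A_k$ and $A^{(-k)}$ for $A_k^*$ when indices are attached. $[n]=\{1,\dots,n\}$, $\pm[n]=[n]\cup(-[n])$, $\delta:k\mapsto-k$, $\mathrm{sgn}(k)$ is the sign of the integer $k$, $\cdot$ is pointwise multiplication of functions, $\#$ is the number of orbits of a permutation or blocks of a set partition, and permutations act right to left. $\mathrm{PM}(n)$ is the set of permutations $\pi$ of $\pm[n]$ with $\delta\pi\delta=\pi^{-1}$ and no $k,-k$ in the same cycle. Its cycles come in pairs (order and signs reversed); $\mathrm{FD}(\pi)$ is the product of those cycles, one from each pair, in which the element of smallest absolute value is positive, and also denotes the set of elements of those cycles; so $\#(\mathrm{FD}(\pi))=\#(\pi)/2$. For $\alpha,\pi\in\mathrm{PM}(n)$, the Euler characteristic is $\chi(\alpha,\pi)=\#(\alpha)/2+\#(\pi)/2+\#(\alpha^{-1}\pi^{-1})/2-n$.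 For $\pi\in\mathrm{PM}(n)$ and $N\times N$ quaternionic matrices $A_1,\dots,A_n$, $$\mathrm{Re}_{\mathrm{FD}(\pi)}\mathrm{tr}_{\mathrm{FD}(\pi)}(A_1,\dots,A_n)=2^{-\#(\mathrm{FD}(\pi))}N^{-\#(\mathrm{FD}(\pi))}\sum_{\substack{i:\mathrm{FD}(\pi)\to[N]\\ h:\mathrm{FD}(\pi)\to\{1,-1\}}}\ \prod_{k\in\mathrm{FD}(\pi)}A^{(k)}_{i_k,i_{\pi(k)};h_k,h_{\pi(k)}}.$$ Weingarten function. For a finite set $J$ with $|J|=2m$, let $\mathcal{P}_2(J)$ be the set of pairings of $J$ (partitions into two-element blocks, equivalently fixed-point-free involutions). Let $\mathrm{Gr}$ be the matrix indexed by $\mathcal{P}_2(J)$ with entries $\mathrm{Gr}(\pi_+,\pi_-)=(-1)^m(-2N)^{\#(\pi_+\vee\pi_-)}$ ($\vee$ the join of set partitions), let $\mathrm{Wg}$ be its inverse (or pseudoinverse), and let the normalized Weingarten function be $\mathrm{wg}(\pi_+,\pi_-)=(-2N)^{2m-\#(\pi_+\vee\pi_-)}\,\mathrm{Wg}(\pi_+,\pi_-)$. It depends only on the integer partition whose parts are half the block sizes of $\pi_+\vee\pi_-$. For $\alpha,\pi\in\mathrm{PM}(n)$, $\delta\alpha$ and $\delta\pi$ are pairings of $J=\pm[n]$ (so $m=n$), and $\mathrm{wg}(\mathrm{FD}(\alpha\pi^{-1}))$ denotes $\mathrm{wg}(\delta\alpha,\delta\pi)$, i.e. the value of $\mathrm{wg}$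 on the integer partition whose parts are the lengths of the cycles of $\alpha\pi^{-1}$, one taken from each of the pairs into which these cycles fall (two cycles of equal length for each block of $\delta\alpha\vee\delta\pi$).
   Formalization: As written the formula fails (n=1, X=I gives 1=-1; also false for n=3 even up to sign). In the definition of f(α), a factor (-1)^n is inserted and wg(FD(απ^{-1})) is replaced by wg(FD(απ)), i.e. wg(δα,δπ^{-1}). *)

theory Defs
  imports "HOL-Probability.Probability" "HOL-Combinatorics.Orbits"
begin

section \<open>Quaternions\<close>

datatype quat = Quat (quat_a: real) (quat_b: real) (quat_c: real) (quat_d: real)

lemma quat_eqI:
  "quat_a p = quat_a q \<Longrightarrow> quat_b p = quat_b q \<Longrightarrow> quat_c p = quat_c q \<Longrightarrow> quat_d p = quat_d q \<Longrightarrow> p = q"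
  by (rule quat.expand) auto

lemma quat_eq_iff:
  "p = q \<longleftrightarrow> quat_a p = quat_a q \<and> quat_b p = quat_b q \<and> quat_c p = quat_c q \<and> quat_d p = quat_d q"
  by (auto intro: quat_eqI)

instantiation quat :: ring_1
begin

definition "0 = Quat 0 0 0 0"
definition "1 = Quat 1 0 0 0"
definition "p + q =
  Quat (quat_a p + quat_a q) (quat_b p + quat_b q) (quat_c p + quat_c q) (quat_d p + quat_d q)"
definition "- p = Quat (- quat_a p) (- quat_b p) (- quat_c p) (- quat_d p)"
definition "p - q =
  Quat (quat_a p - quat_a q) (quat_b p - quat_b q) (quat_c p - quat_c q) (quat_d p - quat_d q)"
definition "p * q = Quat
  (quat_a p * quat_a q - quat_b p * quat_b q - quat_c p * quat_c q - quat_d p * quat_d q)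
  (quat_a p * quat_b q + quat_b p * quat_a q + quat_c p * quat_d q - quat_d p * quat_c q)
  (quat_a p * quat_c q - quat_b p * quat_d q + quat_c p * quat_a q + quat_d p * quat_b q)
  (quat_a p * quat_d q + quat_b p * quat_c q - quat_c p * quat_b q + quat_d p * quat_a q)"

instance
  by standard
     (simp_all add: quat_eq_iff zero_quat_def one_quat_def plus_quat_def uminus_quat_def
        minus_quat_def times_quat_def algebra_simps)

end

text \<open>The Euclidean structure of \<open>\<real>\<^sup>4\<close>; it supplies the topology, hence the Borel sets, on
  quaternionic matrices.\<close>

instantiation quat :: real_inner
begin

definition "scaleR r q = Quat (r * quat_a q) (r * quat_b q) (r * quat_c q) (r * quat_d q)"
definition "inner p q =
  quat_a p * quat_a q + quat_b p * quat_b q + quat_c p * quat_c q + quat_d p * quat_d q"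
definition norm_quat :: "quat \<Rightarrow> real" where "norm_quat q = sqrt (inner q q)"
definition sgn_quat :: "quat \<Rightarrow> quat" where "sgn_quat q = scaleR (inverse (norm q)) q"
definition dist_quat :: "quat \<Rightarrow> quat \<Rightarrow> real" where "dist_quat p q = norm (p - q)"
definition uniformity_quat :: "(quat \<times> quat) filter"
  where "uniformity_quat = (INF e\<in>{0 <..}. principal {(x, y). dist x y < e})"
definition open_quat :: "quat set \<Rightarrow> bool"
  where "open_quat S \<longleftrightarrow> (\<forall>x\<in>S. \<forall>\<^sub>F (x', y) in uniformity. x' = x \<longrightarrow> y \<in> S)"

instance
proof
  fix p q r :: quat and a b :: real
  show "a *\<^sub>R (p + q) = a *\<^sub>R p + a *\<^sub>R q" "(a + b) *\<^sub>R p = a *\<^sub>R p + b *\<^sub>R p"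
    "a *\<^sub>R b *\<^sub>R p = (a * b) *\<^sub>R p" "1 *\<^sub>R p = p"
    by (simp_all add: scaleR_quat_def plus_quat_def distrib_left distrib_right)
  show "inner p q = inner q p" "inner (p + q) r = inner p r + inner q r"
    "inner (a *\<^sub>R p) q = a * inner p q" "0 \<le> inner p p"
    by (simp_all add: inner_quat_def scaleR_quat_def plus_quat_def distrib_left distrib_right
        mult.commute mult.left_commute)
  have "inner p p = 0 \<longleftrightarrow> (quat_a p)\<^sup>2 + (quat_b p)\<^sup>2 + ((quat_c p)\<^sup>2 + (quat_d p)\<^sup>2) = 0"
    by (simp add: inner_quat_def power2_eq_square add.assoc)
  also have "\<dots> \<longleftrightarrow> p = 0"
    by (simp add: add_nonneg_eq_0_iff quat_eq_iff zero_quat_def)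
  finally show "inner p p = 0 \<longleftrightarrow> p = 0" .
qed (fact norm_quat_def sgn_quat_def dist_quat_def uniformity_quat_def open_quat_def)+

end

instantiation quat :: euclidean_space
begin

definition "Basis = {Quat 1 0 0 0, Quat 0 1 0 0, Quat 0 0 1 0, Quat 0 0 0 1}"

instance
proof
  show "(Basis :: quat set) \<noteq> {}" "finite (Basis :: quat set)"
    by (simp_all add: Basis_quat_def)
  show "inner u v = (if u = v then 1 else 0)" if "u \<in> Basis" "v \<in> Basis" for u v :: quat
    using that unfolding Basis_quat_def inner_quat_def by (elim insertE emptyE) simp_all
  show "(\<forall>u\<in>Basis. inner x u = 0) \<longleftrightarrow> x = 0" for x :: quat
    unfolding Basis_quat_def inner_quat_def quat_eq_iff zero_quat_def by simp
qed

end

definition quat_cnj :: "quat \<Rightarrow> quat" where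
  "quat_cnj q = Quat (quat_a q) (- quat_b q) (- quat_c q) (- quat_d q)"

text \<open>Entries of the \<open>2 \<times> 2\<close> complex matrix representing a quaternion. Rows and columns are
  indexed by \<open>1, -1\<close>; every index other than \<open>1\<close> is read as \<open>-1\<close>.\<close>

definition quat_entry :: "quat \<Rightarrow> int \<Rightarrow> int \<Rightarrow> complex" where
  "quat_entry q s t =
     (if s = 1 then (if t = 1 then Complex (quat_a q) (quat_b q) else Complex (quat_c q) (quat_d q))
      else (if t = 1 then Complex (- quat_c q) (quat_d q) else Complex (quat_a q) (- quat_b q)))"

section \<open>Quaternionic matrices and symplectic invariance\<close>

definition adj :: "quat ^ 'm ^ 'k \<Rightarrow> quat ^ 'k ^ 'm" where
  "adj A = (\<chi> i j. quat_cnj (A $ j $ i))"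

definition Sp :: "(quat ^ 'N ^ 'N) set" where
  "Sp = {U. adj U ** U = mat 1}"

definition symplectically_invariant ::
    "'w measure \<Rightarrow> nat \<Rightarrow> (nat \<Rightarrow> 'w \<Rightarrow> quat ^ 'N ^ 'N) \<Rightarrow> bool" where
  "symplectically_invariant M n X \<longleftrightarrow>
     (\<forall>U\<in>Sp. distr M (\<Pi>\<^sub>M k\<in>{1..n}. borel) (\<lambda>\<omega>. \<lambda>k\<in>{1..n}. adj U ** X k \<omega> ** U)
           = distr M (\<Pi>\<^sub>M k\<in>{1..n}. borel) (\<lambda>\<omega>. \<lambda>k\<in>{1..n}. X k \<omega>))"

text \<open>\<open>A\<^sup>(\<^sup>k\<^sup>)\<close> for a nonzero integer \<open>k\<close>.\<close>

definition signed :: "(nat \<Rightarrow> quat ^ 'N ^ 'N) \<Rightarrow> int \<Rightarrow> quat ^ 'N ^ 'N" where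
  "signed A k = (if k > 0 then A (nat k) else adj (A (nat (- k))))"

section \<open>Premaps\<close>

definition pm :: "nat \<Rightarrow> int set" where
  "pm n = {k. k \<noteq> 0 \<and> \<bar>k\<bar> \<le> int n}"

text \<open>\<open>\<delta>\<close> is extended by the identity outside \<open>\<plusminus>[n]\<close>, so that \<open>\<delta>\<close> and \<open>\<delta>\<pi>\<close> permute \<open>\<plusminus>[n]\<close> in the
  sense of the library.\<close>

definition delta :: "nat \<Rightarrow> int \<Rightarrow> int" where
  "delta n k = (if k \<in> pm n then - k else k)"

definition PM :: "nat \<Rightarrow> (int \<Rightarrow> int) set" where
  "PM n = {\<pi>. \<pi> permutes pm n \<and> delta n \<circ> \<pi> \<circ> delta n = inv \<pi> \<and> (\<forall>k\<in>pm n. - k \<notin> orbit \<pi> k)}"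

definition num_orbits :: "'a set \<Rightarrow> ('a \<Rightarrow> 'a) \<Rightarrow> nat" where
  "num_orbits S \<pi> = card (orbit \<pi> ` S)"

text \<open>The underlying set of \<open>FD(\<pi>)\<close>. It is a union of cycles of \<open>\<pi>\<close>, and as a permutation
  \<open>FD(\<pi>)\<close> is the restriction of \<open>\<pi>\<close> to it.\<close>

definition FD :: "nat \<Rightarrow> (int \<Rightarrow> int) \<Rightarrow> int set" where
  "FD n \<pi> = {k \<in> pm n. \<exists>m\<in>orbit \<pi> k. m > 0 \<and> (\<forall>j\<in>orbit \<pi> k. \<bar>m\<bar> \<le> \<bar>j\<bar>)}"

text \<open>For \<open>\<alpha>, \<pi> \<in> PM n\<close> the three orbit counts are even, so the divisions are exact.\<close>

definition euler_char :: "nat \<Rightarrow> (int \<Rightarrow> int) \<Rightarrow> (int \<Rightarrow> int) \<Rightarrow> int" where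
  "euler_char n \<alpha> \<pi> =
     int (num_orbits (pm n) \<alpha> div 2) + int (num_orbits (pm n) \<pi> div 2)
     + int (num_orbits (pm n) (inv \<alpha> \<circ> inv \<pi>) div 2) - int n"

definition Re_tr :: "nat \<Rightarrow> (int \<Rightarrow> int) \<Rightarrow> (nat \<Rightarrow> quat ^ 'N ^ 'N) \<Rightarrow> complex" where
  "Re_tr n \<pi> A =
     2 powi (- int (num_orbits (FD n \<pi>) \<pi>)) * of_nat CARD('N) powi (- int (num_orbits (FD n \<pi>) \<pi>)) *
     (\<Sum>i \<in> FD n \<pi> \<rightarrow>\<^sub>E (UNIV :: 'N set). \<Sum>h \<in> FD n \<pi> \<rightarrow>\<^sub>E {1, -1}.
        \<Prod>k\<in>FD n \<pi>. quat_entry (signed A k $ i k $ i (\<pi> k)) (h k) (h (\<pi> k)))"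

section \<open>The symplectic Weingarten function\<close>

text \<open>Pairings are fixed-point-free involutions.\<close>

definition pairings :: "'a set \<Rightarrow> ('a \<Rightarrow> 'a) set" where
  "pairings J = {p. p permutes J \<and> p \<circ> p = id \<and> (\<forall>x\<in>J. p x \<noteq> x)}"

text \<open>Number of blocks of the join, i.e. of classes of the equivalence relation generated by the two
  pairings. The relation is symmetric already, as \<open>p\<close> and \<open>q\<close> are involutions.\<close>

definition join_blocks :: "'a set \<Rightarrow> ('a \<Rightarrow> 'a) \<Rightarrow> ('a \<Rightarrow> 'a) \<Rightarrow> nat" where
  "join_blocks J p q = card (J // (\<Union>x\<in>J. {(x, p x), (x, q x)})\<^sup>*)"

definition Gr :: "nat \<Rightarrow> 'a set \<Rightarrow> ('a \<Rightarrow> 'a) \<Rightarrow> ('a \<Rightarrow> 'a) \<Rightarrow> real" where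
  "Gr N J p q = (-1) ^ (card J div 2) * (- 2 * real N) ^ join_blocks J p q"

text \<open>\<open>W\<close> is the Moore--Penrose pseudoinverse of the real matrix \<open>G\<close> indexed by the finite set
  \<open>P\<close>; it is the inverse whenever \<open>G\<close> is invertible. The last conjunct only fixes the irrelevant
  values outside \<open>P \<times> P\<close>.\<close>

definition is_pseudoinverse :: "'b set \<Rightarrow> ('b \<Rightarrow> 'b \<Rightarrow> real) \<Rightarrow> ('b \<Rightarrow> 'b \<Rightarrow> real) \<Rightarrow> bool" where
  "is_pseudoinverse P G W \<longleftrightarrow>
     (\<forall>a\<in>P. \<forall>b\<in>P. (\<Sum>c\<in>P. \<Sum>d\<in>P. G a c * W c d * G d b) = G a b) \<and>
     (\<forall>a\<in>P. \<forall>b\<in>P. (\<Sum>c\<in>P. \<Sum>d\<in>P. W a c * G c d * W d b) = W a b) \<and>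
     (\<forall>a\<in>P. \<forall>b\<in>P. (\<Sum>c\<in>P. G a c * W c b) = (\<Sum>c\<in>P. G b c * W c a)) \<and>
     (\<forall>a\<in>P. \<forall>b\<in>P. (\<Sum>c\<in>P. W a c * G c b) = (\<Sum>c\<in>P. W b c * G c a)) \<and>
     (\<forall>a b. \<not> (a \<in> P \<and> b \<in> P) \<longrightarrow> W a b = 0)"

definition Wg :: "nat \<Rightarrow> 'a set \<Rightarrow> ('a \<Rightarrow> 'a) \<Rightarrow> ('a \<Rightarrow> 'a) \<Rightarrow> real" where
  "Wg N J = (THE W. is_pseudoinverse (pairings J) (Gr N J) W)"

definition wg :: "nat \<Rightarrow> 'a set \<Rightarrow> ('a \<Rightarrow> 'a) \<Rightarrow> ('a \<Rightarrow> 'a) \<Rightarrow> real" where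
  "wg N J p q =
     (- 2 * real N) powi (2 * int (card J div 2) - int (join_blocks J p q)) * Wg N J p q"

section \<open>Normalized matrix cumulants\<close>

text \<open>The formula in the source reads
  \<open>\<Sum>\<^sub>\<pi> (-2N)\<^bsup>\<chi>(\<alpha>,\<pi>) - #(\<alpha>)\<^esup> wg(\<delta>\<alpha>, \<delta>\<pi>) E[Re tr\<^sub>\<pi>]\<close>. With the conventions above, two corrections are needed.
  The first is the sign \<open>(-1)\<^sup>n\<close>, because \<open>wg(p, p)\<close> tends to \<open>(-1)\<^sup>n\<close> and not to \<open>1\<close> as \<open>N\<close> grows:
  for \<open>n = 1\<close> one has \<open>wg = -1\<close>, and the source formula would give \<open>E X = - E X\<close> for \<open>X = I\<close>.
  The second is \<open>\<delta>\<pi>\<^sup>-\<^sup>1\<close> in place of \<open>\<delta>\<pi>\<close>: the trace along \<open>\<pi>\<close> contracts the indices along the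
  pairing \<open>\<delta>\<pi>\<^sup>-\<^sup>1\<close>, and the blocks of \<open>\<delta>\<alpha> \<squnion> \<delta>\<pi>\<^sup>-\<^sup>1\<close> correspond to the pairs of cycles of
  \<open>\<alpha>\<^sup>-\<^sup>1\<pi>\<^sup>-\<^sup>1\<close>, the permutation occurring in \<open>\<chi>(\<alpha>,\<pi>)\<close>.\<close>

definition matrix_cumulant ::
    "'w measure \<Rightarrow> nat \<Rightarrow> (nat \<Rightarrow> 'w \<Rightarrow> quat ^ 'N ^ 'N) \<Rightarrow> (int \<Rightarrow> int) \<Rightarrow> complex" where
  "matrix_cumulant M n X \<alpha> =
     (\<Sum>\<pi>\<in>PM n. (-1) ^ n *
        (- 2 * of_nat CARD('N)) powi (euler_char n \<alpha> \<pi> - int (num_orbits (pm n) \<alpha>)) *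
        of_real (wg CARD('N) (pm n) (delta n \<circ> \<alpha>) (delta n \<circ> inv \<pi>)) *
        (\<integral>\<omega>. Re_tr n \<pi> (\<lambda>k. X k \<omega>) \<partial>M))"

end

theory Submission
  imports Defs
begin

text \<open>
The moments of \<open>X\<^sub>1, \<dots>, X\<^sub>n\<close> form a tensor with one index in \<open>\<complex>\<^sup>2\<^sup>N\<close> for each element of \<open>\<plusminus>[n]\<close>: row indices
are attached to \<open>k\<close> and column indices to \<open>- k\<close>. After a twist of the column indices by the symplectic
form (\<open>tentry\<close>), symplectic invariance says that this tensor is fixed by \<open>Sp(N)\<close> acting on all \<open>2n\<close>
places in the same way. The formula expresses that such a tensor equals its orthogonal projection onto
the span of the tensors attached to pairings of \<open>\<plusminus>[n]\<close>.

That the invariant tensors are spanned by the pairings is the first fundamental theorem for the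
symplectic group. No Haar measure is used: differentiating the invariance under one-parameter
subgroups shows that the moment tensor is annihilated by the Lie algebra
(\<open>group_invariant_imp_lie_invariant\<close>). The Casimir element of the Lie algebra turns this into an equation
\<open>(2N + 1) T + \<Sum>\<^sub>j (i j) T = \<dots>\<close> whose right-hand side consists of contractions of \<open>T\<close> (\<open>casimir_identity\<close>). If
\<open>T\<close> is orthogonal to all pairing tensors, the contractions vanish by induction on the number of places,
and \<open>T\<close> vanishes because the eigenvalues of the Jucys--Murphy element \<open>\<Sum>\<^sub>j (i j)\<close> on words with \<open>2N\<close> letters
are greater than \<open>- 2N\<close> (\<open>transposition_sum_injective\<close>, \<open>invariant_orthogonal_imp_zero\<close>).

The symplectic form is antisymmetric, so a pairing determines a tensor only up to sign. The sign is
fixed as for a Pfaffian, by the sign of a permutation that enumerates the pairs (\<open>frame\<close>). With this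
choice the scalar product of the tensors of \<open>p\<close> and \<open>q\<close> is \<open>(-1)\<^sup>n (-2N)\<^sup>#\<close> with the number of blocks of the
join in the exponent: each block leaves one letter free, and the signs are governed by the number of
orbits of \<open>q \<circ> p\<close> (\<open>pairing_tensor_gram\<close>). This is the Gram matrix in the definition of the Weingarten
function, whose pseudoinverse therefore gives the orthogonal projection (\<open>invariant_tensor_expansion\<close>).

It remains to translate. Premaps \<open>\<alpha>\<close> correspond to pairings \<open>\<delta>\<alpha>\<close>. The set \<open>FD(\<alpha>)\<close> contains exactly one
element of each pair of \<open>\<delta>\<alpha>\<close> and of each pair \<open>{k, - k}\<close>, and from it the sign of the pairing tensor is
computed explicitly. This produces the index conditions and the product of signs in the expansion
(\<open>pairing_tensor_indicator\<close>). The contraction of the moments along \<open>\<delta>\<pi>\<^sup>-\<^sup>1\<close> is the expected trace along \<open>\<pi>\<close> up to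
the factor \<open>(-2N)\<close> to the power \<open>#(\<pi>)/2\<close> (\<open>trace_contraction\<close>), and the powers of \<open>N\<close> combine as required
(\<open>powi_bookkeeping\<close>).
\<close>

section \<open>Jucys--Murphy elements acting on words\<close>

text \<open>The sum of the transpositions moving one fixed place is a Jucys--Murphy element. Its eigenvalues on
words over \<open>d\<close> letters are contents of Young diagrams with at most \<open>d\<close> rows, hence at least
\<open>1 - d\<close>, so adding \<open>c \<ge> d\<close> gives an injective operator. The bound is obtained from a highest weight
vector: the kernel is stable under the operators of \<open>gl\<^sub>d\<close> that replace a letter at one place by
another letter, so a nonzero element \<open>S\<close> of the kernel whose support has the least possible maximal
weight is annihilated by those that lower the weight. On words whose letter at \<open>i0\<close> is the largest
one occurring there, each smaller letter then contributes \<open>- S\<close> to the sum, the letter itself a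
nonnegative multiple of \<open>S\<close>, and the larger letters nothing.\<close>

lemma transposition_sum_injective:
  fixes T :: "('a \<Rightarrow> 'i::finite) \<Rightarrow> real" and c :: real
  assumes J: "finite J" and i0: "i0 \<in> J" and c: "real CARD('i) \<le> c"
    and eq: "\<And>x. c * T x + (\<Sum>j\<in>J - {i0}. T (x \<circ> Transposition.transpose i0 j)) = 0"
  shows "T x = 0"
proof (rule ccontr)
  assume T0: "T x \<noteq> 0"
  obtain rk :: "'i \<Rightarrow> nat" where rk: "bij_betw rk UNIV {..<CARD('i)}"
    using ex_bij_betw_finite_nat[of "UNIV :: 'i set"] by (auto simp: atLeast0LessThan)
  have inj: "inj rk" using rk by (simp add: bij_betw_def)
  have rk_less: "rk a < CARD('i)" for a using rk by (auto simp: bij_betw_def)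
  define wt :: "('a \<Rightarrow> 'i) \<Rightarrow> nat" where "wt x = (\<Sum>j\<in>J. rk (x j))" for x
  define sol :: "(('a \<Rightarrow> 'i) \<Rightarrow> real) \<Rightarrow> nat \<Rightarrow> bool" where
    "sol S m \<longleftrightarrow> (\<exists>x. S x \<noteq> 0) \<and> (\<forall>x. c * S x + (\<Sum>j\<in>J - {i0}. S (x \<circ> Transposition.transpose i0 j)) = 0)
       \<and> (\<forall>x. S x \<noteq> 0 \<longrightarrow> wt x \<le> m)" for S m
  have "wt x \<le> (\<Sum>j\<in>J. CARD('i))" for x
    unfolding wt_def by (rule sum_mono) (simp add: rk_less less_imp_le)
  then have ex: "\<exists>m S. sol S m"
    using T0 eq unfolding sol_def by blast
  define m where "m = (LEAST m. \<exists>S. sol S m)"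
  obtain S where S: "sol S m" unfolding m_def using LeastI_ex[OF ex] by blast
  have minimal: "m \<le> m'" if "sol S' m'" for S' m'
    unfolding m_def using that by (auto intro: Least_le)
  have Seq: "c * S x + (\<Sum>j\<in>J - {i0}. S (x \<circ> Transposition.transpose i0 j)) = 0" for x
    using S by (simp add: sol_def)
  have Swt: "wt x \<le> m" if "S x \<noteq> 0" for x using S that by (simp add: sol_def)
  \<comment> \<open>the image \<open>E\<close> of \<open>S\<close> lies in the kernel as well, and its support has smaller weight\<close>
  have raise: "(\<Sum>j\<in>J. if x j = a then S (x(j := b)) else 0) = 0" if ab: "rk a < rk b" for a b x
  proof (rule ccontr)
    define E where "E y = (\<Sum>j\<in>J. if y j = a then S (y(j := b)) else 0)" for y
    assume "(\<Sum>j\<in>J. if x j = a then S (x(j := b)) else 0) \<noteq> 0"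
    then have E0: "E x \<noteq> 0" by (simp add: E_def)
    have Etau: "E (y \<circ> Transposition.transpose i0 j) = (\<Sum>i\<in>J. if y i = a then S (y(i := b) \<circ> Transposition.transpose i0 j) else 0)"
      if "j \<in> J - {i0}" for y j
    proof -
      let ?t = "Transposition.transpose i0 j"
      have upd: "(y \<circ> ?t)(i := b) = y(?t i := b) \<circ> ?t" for i
        by (auto simp: fun_eq_iff Transposition.transpose_def)
      have "bij_betw ?t J J" using that i0 by (intro bij_betw_byWitness[of _ ?t]) (auto simp: Transposition.transpose_def)
      then show ?thesis unfolding E_def upd
        by (subst sum.reindex_bij_betw[symmetric, of ?t J J]) (simp_all add: comp_def)
    qed
    have "c * E y + (\<Sum>j\<in>J - {i0}. E (y \<circ> Transposition.transpose i0 j)) = 0" for y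
    proof -
      have "c * E y + (\<Sum>j\<in>J - {i0}. E (y \<circ> Transposition.transpose i0 j))
          = (\<Sum>i\<in>J. if y i = a then c * S (y(i := b)) + (\<Sum>j\<in>J - {i0}. S (y(i := b) \<circ> Transposition.transpose i0 j)) else 0)"
        apply (simp add: Etau)
        apply (subst sum.swap)
        apply (simp add: E_def sum_distrib_left sum.distrib[symmetric])
        apply (rule sum.cong) apply (simp_all)
        done
      also have "\<dots> = 0" by (simp only: Seq if_cancel sum.neutral_const)
      finally show ?thesis .
    qed
    moreover have wtE: "wt y < m" if "E y \<noteq> 0" for y
    proof -
      obtain j where j: "j \<in> J" "y j = a" "S (y(j := b)) \<noteq> 0"
        using \<open>E y \<noteq> 0\<close> unfolding E_def
        by (rule sum.not_neutral_contains_not_neutral) (simp split: if_splits)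
      have "wt y < wt (y(j := b))" unfolding wt_def
        by (rule sum_strict_mono_ex1[OF J]) (use j ab in \<open>auto intro!: bexI[of _ j]\<close>)
      with Swt[OF j(3)] show ?thesis by simp
    qed
    moreover have "wt y \<le> m - 1" if "E y \<noteq> 0" for y using wtE[OF that] by simp
    ultimately have "sol E (m - 1)" using E0 unfolding sol_def by blast
    then show False using minimal[of E "m - 1"] wtE[OF E0] by simp
  qed
  \<comment> \<open>the largest letter that occurs at the place \<open>i0\<close> in the support of \<open>S\<close>\<close>
  define p where "p = Max {rk (x i0) | x. S x \<noteq> 0}"
  have fin: "finite {rk (x i0) | x. S x \<noteq> 0}"
    by (rule finite_subset[of _ "{..<CARD('i)}"]) (auto simp: rk_less)
  have "p \<in> {rk (x i0) | x. S x \<noteq> 0}"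
    unfolding p_def using S fin by (intro Max_in) (auto simp: sol_def)
  then obtain x where x: "S x \<noteq> 0" "rk (x i0) = p" by auto
  have top: "S y = 0" if "p < rk (y i0)" for y
    using Max_ge[OF fin, of "rk (y i0)"] that unfolding p_def by fastforce
  define g where "g b = (\<Sum>j\<in>{j\<in>J - {i0}. x j = b}. S (x \<circ> Transposition.transpose i0 j))" for b
  define cnt where "cnt = card {j\<in>J - {i0}. x j = x i0}"
  have g_less: "g b = - S x" if "rk b < p" for b
  proof -
    have ne: "b \<noteq> x i0" using that x by auto
    have "0 = (\<Sum>j\<in>J. if (x(i0 := b)) j = b then S ((x(i0 := b))(j := x i0)) else 0)"
      by (rule raise[symmetric]) (use that x in simp)
    also have "\<dots> = S x + (\<Sum>j\<in>J - {i0}. if x j = b then S (x \<circ> Transposition.transpose i0 j) else 0)"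
      apply (subst sum.remove[OF J i0])
      apply (simp)
      apply (rule sum.cong)
      apply (auto intro!: arg_cong[where f=S] simp: fun_eq_iff Transposition.transpose_def)
      done
    also have "\<dots> = S x + g b" using J by (simp only: g_def sum.inter_filter[of "J - {i0}"] finite_Diff)
    finally show ?thesis by simp
  qed
  have g_eq: "g b = real cnt * S x" if "rk b = p" for b
  proof -
    have b: "b = x i0" by (rule injD[OF inj]) (simp add: that x)
    have "x \<circ> Transposition.transpose i0 j = x" if "x j = x i0" for j
      using that by (auto simp: fun_eq_iff Transposition.transpose_def)
    then show ?thesis by (simp add: g_def b cnt_def)
  qed
  have g_gr: "g b = 0" if "rk b > p" for b
    unfolding g_def using that by (intro sum.neutral) (auto intro: top)
  have "(\<Sum>j\<in>J - {i0}. S (x \<circ> Transposition.transpose i0 j)) = (\<Sum>b\<in>UNIV. g b)"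
    unfolding g_def using J by (subst sum.group) auto
  also have "\<dots> = (\<Sum>b\<in>{b. rk b < p} \<union> {x i0}. g b)"
    using g_gr x injD[OF inj] by (intro sum.mono_neutral_right) (auto, metis linorder_neqE_nat)
  also have "\<dots> = (\<Sum>b\<in>{b. rk b < p}. g b) + g (x i0)"
    using x by (subst sum.union_disjoint) auto
  also have "\<dots> = real cnt * S x - real (card {b. rk b < p}) * S x"
    by (simp add: g_less g_eq x)
  finally have "(c + real cnt - real (card {b. rk b < p})) * S x = 0"
    using Seq[of x] by (simp add: algebra_simps)
  moreover have "card {b. rk b < p} < CARD('i)"
    using x by (intro psubset_card_mono) auto
  ultimately show False using c x by (auto simp: )
qed

section \<open>Invariant tensors of the symplectic Lie algebra\<close>

text \<open>A letter \<open>(i, b)\<close> stands for a basis vector of \<open>\<complex>\<^sup>2\<^sup>N\<close>: \<open>i\<close> is the index of a quaternionic row and \<open>b\<close>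
tells \<open>1\<close> from \<open>-1\<close> in the two complex rows that represent it. In this basis \<open>omega\<close> is the
symplectic form preserved by \<open>Sp(N)\<close>.\<close>

definition spin :: "'c \<times> bool \<Rightarrow> real" where "spin u = (if snd u then 1 else - 1)"
definition flip :: "'c \<times> bool \<Rightarrow> 'c \<times> bool" where "flip u = (fst u, \<not> snd u)"
definition omega :: "'c \<times> bool \<Rightarrow> 'c \<times> bool \<Rightarrow> real" where
  "omega u v = (if v = flip u then spin u else 0)"

lemma flip_flip [simp]: "flip (flip u) = u" by (simp add: flip_def)
lemma flip_eq_iff: "flip u = v \<longleftrightarrow> u = flip v" by (auto simp: flip_def prod_eq_iff)
lemma flip_inject [simp]: "flip u = flip v \<longleftrightarrow> u = v" by (auto simp: flip_def prod_eq_iff)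
lemma spin_flip [simp]: "spin (flip u) = - spin u" by (simp add: flip_def spin_def)
lemma spin_sq [simp]: "spin u * spin u = 1" "spin u * (spin u * r) = r" by (simp_all add: spin_def)
lemma omega_swap: "omega v u = - omega u v"
  by (auto simp: omega_def flip_eq_iff)

abbreviation words :: "'a set \<Rightarrow> ('a \<Rightarrow> 'i) set" where "words J \<equiv> PiE J (\<lambda>_. UNIV)"

lemma sum_words_insert:
  fixes f :: "('a \<Rightarrow> 'i::finite) \<Rightarrow> 'b::comm_monoid_add"
  assumes "finite J" "a \<notin> J"
  shows "(\<Sum>x\<in>words (insert a J). f x) = (\<Sum>x\<in>words J. \<Sum>u\<in>UNIV. f (x(a := u)))"
proof -
  have eq: "words (insert a J) = (\<lambda>(u, x). x(a := u)) ` (UNIV \<times> words J)"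
    by (rule PiE_insert_eq)
  have "inj_on (\<lambda>(u, x). x(a := u)) ((UNIV :: 'i set) \<times> words J)"
  proof (rule inj_onI, clarify)
    fix u v :: 'i and x y :: "'a \<Rightarrow> 'i"
    assume xy: "x \<in> words J" "y \<in> words J" and eq: "x(a := u) = y(a := v)"
    have "x k = y k" for k
      using fun_cong[OF eq, of k] xy assms(2) by (cases "k = a") (auto simp: PiE_def extensional_def)
    then show "u = v \<and> x = y" using fun_cong[OF eq, of a] by auto
  qed
  then have "(\<Sum>x\<in>words (insert a J). f x) = (\<Sum>(u, x)\<in>UNIV \<times> words J. f (x(a := u)))"
    unfolding eq by (subst sum.reindex) (simp_all add: case_prod_unfold comp_def)
  also have "\<dots> = (\<Sum>u\<in>UNIV. \<Sum>x\<in>words J. f (x(a := u)))"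
    by (rule sum.cartesian_product[symmetric])
  finally show ?thesis by (simp only: sum.swap[of _ UNIV])
qed

text \<open>The complexified Lie algebra of \<open>Sp(N)\<close> is spanned by the matrices
\<open>E\<^sub>u\<^sub>v - spin u * spin v * E\<^sub>v\<^sub>'\<^sub>u\<^sub>'\<close> with \<open>u' = flip u\<close>, \<open>v' = flip v\<close>. The condition says that all of them,
acting at the places in \<open>J\<close> and summed over these places, annihilate the tensor \<open>T\<close>.\<close>

definition lie_invariant :: "'a set \<Rightarrow> (('a \<Rightarrow> 'c \<times> bool) \<Rightarrow> real) \<Rightarrow> bool" where
  "lie_invariant J T \<longleftrightarrow> (\<forall>x u v. (\<Sum>j\<in>J. (if x j = u then T (x(j := v)) else 0)
      - (if x j = flip v then spin u * spin v * T (x(j := flip u)) else 0)) = 0)"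

text \<open>Words are total functions, so that letters can be changed freely; a tensor with set of places \<open>J\<close>
must ignore the other letters.\<close>

definition depends_on :: "'a set \<Rightarrow> (('a \<Rightarrow> 'i) \<Rightarrow> 'b) \<Rightarrow> bool" where
  "depends_on J T \<longleftrightarrow> (\<forall>x y. (\<forall>j\<in>J. x j = y j) \<longrightarrow> T x = T y)"

definition contract :: "'a \<Rightarrow> 'a \<Rightarrow> (('a \<Rightarrow> 'c::finite \<times> bool) \<Rightarrow> real) \<Rightarrow> ('a \<Rightarrow> 'c \<times> bool) \<Rightarrow> real" where
  "contract i j T x = (\<Sum>u\<in>UNIV. spin u * T (x(i := u, j := flip u)))"

lemma depends_on_contract:
  assumes "depends_on J T" shows "depends_on (J - {i, j}) (contract i j T)"
proof -
  have "T (x(i := u, j := v)) = T (y(i := u, j := v))" if "\<forall>k\<in>J - {i, j}. x k = y k" for x y u v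
    using that assms unfolding depends_on_def by auto
  then show ?thesis unfolding depends_on_def contract_def
    by (intro allI impI sum.cong arg_cong2[where f="(*)"]) auto
qed

text \<open>The actions at the two contracted places cancel because the symplectic form is itself invariant.\<close>

lemma lie_invariant_contract:
  assumes J: "finite J" "i \<in> J" "j \<in> J" "i \<noteq> j" and inv: "lie_invariant J T"
  shows "lie_invariant (J - {i, j}) (contract i j T)"
  unfolding lie_invariant_def
proof (intro allI)
  fix x :: "'a \<Rightarrow> 'b \<times> bool" and u v
  define J' where "J' = J - {i, j}"
  have Jeq: "J = insert i (insert j J')" "i \<notin> insert j J'" "j \<notin> J'" "finite J'"
    using J by (auto simp: J'_def)
  define D where "D y k = (if y k = u then T (y(k := v)) else 0)
      - (if y k = flip v then spin u * spin v * T (y(k := flip u)) else 0)" for y k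
  have D0: "(\<Sum>k\<in>J. D y k) = 0" for y using inv unfolding lie_invariant_def D_def by blast
  let ?y = "\<lambda>w. x(i := w, j := flip w)"
  have tw: "x(i := w, j := b, i := c) = x(i := c, j := b)" for w b c
    using J(4) by (auto simp: fun_eq_iff)
  have "(\<Sum>w\<in>UNIV. spin w * D (?y w) i) =
      (\<Sum>w\<in>UNIV. (if w = u then spin w * T (x(i := v, j := flip w)) else 0))
     - (\<Sum>w\<in>UNIV. (if w = flip v then spin w * spin u * spin v * T (x(i := flip u, j := flip w)) else 0))"
    unfolding sum_subtractf[symmetric] using J(4)
    by (intro sum.cong) (auto simp: D_def tw)
  also have "\<dots> = spin u * T (x(i := v, j := flip u)) + spin u * T (x(i := flip u, j := v))"
    by simp
  finally have Di: "(\<Sum>w\<in>UNIV. spin w * D (?y w) i) = spin u * T (x(i := v, j := flip u)) + spin u * T (x(i := flip u, j := v))" .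
  have "(\<Sum>w\<in>UNIV. spin w * D (?y w) j) =
      (\<Sum>w\<in>UNIV. (if w = flip u then spin w * T (x(i := w, j := v)) else 0))
     - (\<Sum>w\<in>UNIV. (if w = v then spin w * spin u * spin v * T (x(i := w, j := flip u)) else 0))"
    unfolding sum_subtractf[symmetric]
    by (intro sum.cong) (auto simp: D_def)
  also have "\<dots> = - spin u * T (x(i := flip u, j := v)) - spin u * T (x(i := v, j := flip u))"
    by simp
  finally have Dj: "(\<Sum>w\<in>UNIV. spin w * D (?y w) j) = - spin u * T (x(i := flip u, j := v)) - spin u * T (x(i := v, j := flip u))" .
  have "0 = (\<Sum>w\<in>UNIV. spin w * (\<Sum>k\<in>J. D (?y w) k))" by (simp add: D0)
  also have "\<dots> = (\<Sum>w\<in>UNIV. spin w * D (?y w) i) + (\<Sum>w\<in>UNIV. spin w * D (?y w) j)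
      + (\<Sum>w\<in>UNIV. spin w * (\<Sum>k\<in>J'. D (?y w) k))"
    using Jeq by (simp add: distrib_left sum.distrib)
  also have "\<dots> = (\<Sum>w\<in>UNIV. spin w * (\<Sum>k\<in>J'. D (?y w) k))" by (simp add: Di Dj)
  also have "\<dots> = (\<Sum>k\<in>J'. \<Sum>w\<in>UNIV. spin w * D (?y w) k)"
    by (simp add: sum_distrib_left sum.swap[of _ UNIV])
  also have "\<dots> = (\<Sum>k\<in>J'. (if x k = u then contract i j T (x(k := v)) else 0)
      - (if x k = flip v then spin u * spin v * contract i j T (x(k := flip u)) else 0))"
  proof (rule sum.cong[OF refl])
    fix k assume "k \<in> J'"
    then have k: "k \<noteq> i" "k \<noteq> j" by (auto simp: J'_def)
    have upd: "(?y w)(k := a) = (x(k := a))(i := w, j := flip w)" for a w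
      using k by (auto simp: fun_eq_iff)
    show "(\<Sum>w\<in>UNIV. spin w * D (?y w) k) = (if x k = u then contract i j T (x(k := v)) else 0)
      - (if x k = flip v then spin u * spin v * contract i j T (x(k := flip u)) else 0)"
      unfolding D_def upd contract_def using k
      by (auto simp: sum_subtractf sum_distrib_left algebra_simps)
  qed
  finally show "(\<Sum>k\<in>J - {i, j}. (if x k = u then contract i j T (x(k := v)) else 0)
      - (if x k = flip v then spin u * spin v * contract i j T (x(k := flip u)) else 0)) = 0"
    by (simp add: J'_def)
qed

text \<open>This is the Casimir element, applied with one leg at the place \<open>i\<close> and the other leg at all places.
The invariance relation for the letters \<open>u\<close> and \<open>x i\<close> is taken at the word \<open>x(i := u)\<close> and summed over
\<open>u\<close>. The place \<open>i\<close> contributes the Casimir eigenvalue \<open>2N + 1\<close> of \<open>\<complex>\<^sup>2\<^sup>N\<close>; any other place contributes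
the exchange of two letters minus a contraction.\<close>

lemma casimir_identity:
  fixes T :: "('a \<Rightarrow> 'c::finite \<times> bool) \<Rightarrow> real"
  assumes J: "finite J" "i \<in> J" and inv: "lie_invariant J T"
  shows "(2 * real CARD('c) + 1) * T x + (\<Sum>j\<in>J - {i}. T (x \<circ> Transposition.transpose i j))
    = (\<Sum>j\<in>J - {i}. if x j = flip (x i) then spin (x i) * contract i j T x else 0)"
proof -
  let ?v = "x i"
  define D where "D u k = (let y = x(i := u) in (if y k = u then T (y(k := ?v)) else 0)
      - (if y k = flip ?v then spin u * spin ?v * T (y(k := flip u)) else 0))" for u k
  have D0: "(\<Sum>k\<in>J. D u k) = 0" for u using inv unfolding lie_invariant_def D_def Let_def by blast
  have "(\<Sum>u\<in>UNIV. D u i) = (\<Sum>u\<in>UNIV. T x + (if u = flip ?v then T x else 0))"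
    by (intro sum.cong) (auto simp: D_def Let_def)
  also have "\<dots> = (2 * real CARD('c) + 1) * T x" by (simp add: sum.distrib algebra_simps)
  finally have Di: "(\<Sum>u\<in>UNIV. D u i) = (2 * real CARD('c) + 1) * T x" .
  have Dj: "(\<Sum>u\<in>UNIV. D u j) = T (x \<circ> Transposition.transpose i j)
      - (if x j = flip (x i) then spin (x i) * contract i j T x else 0)" if "j \<in> J - {i}" for j
  proof -
    have upd: "x(i := x j, j := ?v) = x \<circ> Transposition.transpose i j"
      using that by (auto simp: fun_eq_iff Transposition.transpose_def)
    have "(\<Sum>u\<in>UNIV. D u j) = (\<Sum>u\<in>UNIV. (if u = x j then T (x(i := u, j := ?v)) else 0)
        - (if x j = flip ?v then spin ?v * (spin u * T (x(i := u, j := flip u))) else 0))"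
      using that by (intro sum.cong) (auto simp: D_def Let_def)
    also have "\<dots> = T (x(i := x j, j := ?v))
      - (if x j = flip (x i) then spin (x i) * contract i j T x else 0)"
      by (auto simp: sum_subtractf contract_def sum_distrib_left)
    finally show ?thesis by (simp only: upd)
  qed
  have "0 = (\<Sum>u\<in>UNIV. \<Sum>k\<in>J. D u k)" by (simp add: D0)
  also have "\<dots> = (\<Sum>u\<in>UNIV. D u i) + (\<Sum>j\<in>J - {i}. \<Sum>u\<in>UNIV. D u j)"
    using J by (subst sum.swap) (simp add: sum.remove)
  finally show ?thesis by (simp add: Di Dj sum_subtractf)
qed

text \<open>Since \<open>omega\<close> is antisymmetric, the tensor of a pairing depends on an orientation of the pairs. It is
given by the set \<open>K\<close> of their first elements.\<close>

definition matching_of :: "'a set \<Rightarrow> ('a \<Rightarrow> 'a) \<Rightarrow> 'a set \<Rightarrow> bool" where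
  "matching_of J p K \<longleftrightarrow> p permutes J \<and> p \<circ> p = id \<and> K \<subseteq> J \<and> p ` K = J - K"

definition pair_tensor :: "('a \<Rightarrow> 'a) \<Rightarrow> 'a set \<Rightarrow> ('a \<Rightarrow> 'c \<times> bool) \<Rightarrow> real" where
  "pair_tensor p K x = (\<Prod>k\<in>K. omega (x k) (x (p k)))"

text \<open>The first fundamental theorem of invariant theory for the symplectic group, in a dual form. The
contractions of \<open>T\<close> are invariant and orthogonal to the pairing tensors on two places fewer, so they
vanish by induction. Then the right-hand side of the Casimir identity is zero, and as \<open>2N + 1\<close> exceeds
the number \<open>2N\<close> of letters, the operator on its left-hand side is injective. For the special
orthogonal group this argument would fail, as it must in view of the determinant: the constant is then \<open>N - 1\<close>, with
\<open>N\<close> letters.\<close>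

lemma invariant_orthogonal_imp_zero:
  fixes T :: "('a \<Rightarrow> 'c::finite \<times> bool) \<Rightarrow> real"
  assumes "finite J" "lie_invariant J T" "depends_on J T"
    and "\<And>p K. matching_of J p K \<Longrightarrow> (\<Sum>x\<in>words J. pair_tensor p K x * T x) = 0"
  shows "T x = 0"
  using assms
proof (induction "card J" arbitrary: J T x rule: less_induct)
  case less
  note J = less.prems(1) and inv = less.prems(2) and dep = less.prems(3) and orth = less.prems(4)
  show ?case
  proof (cases "J = {}")
    case True
    then have "matching_of J id {}" by (simp add: matching_of_def)
    from orth[OF this] have "T (\<lambda>_. undefined) = 0" by (simp add: pair_tensor_def True)
    moreover have "T x = T (\<lambda>_. undefined)" using dep True by (simp add: depends_on_def)
    ultimately show ?thesis by simp
  next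
    case False
    then obtain i where i: "i \<in> J" by auto
    have contr: "contract i j T y = 0" if "j \<in> J - {i}" for j y
    proof (rule less.hyps)
      let ?J = "J - {i, j}"
      show "card ?J < card J" "finite ?J" using J i by (auto intro: psubset_card_mono)
      show "lie_invariant ?J (contract i j T)"
        using lie_invariant_contract[of J i j T] J i that inv by auto
      show "depends_on ?J (contract i j T)" by (rule depends_on_contract[OF dep])
      fix p K assume pK: "matching_of ?J p K"
      \<comment> \<open>the pairing of the smaller set, extended by the pair of \<open>i\<close> and \<open>j\<close>\<close>
      let ?t = "Transposition.transpose i j"
      let ?K = "insert i K"
      have p: "p permutes ?J" "p \<circ> p = id" "K \<subseteq> ?J" "p ` K = ?J - K"
        using pK by (auto simp: matching_of_def)
      have pfix: "p i = i" "p j = j" using p(1) by (auto simp: permutes_def)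
      have pij: "p k \<noteq> i" "p k \<noteq> j" if "k \<noteq> i" "k \<noteq> j" for k
        using that pfix p(1) by (metis permutes_def)+
      have tp: "(?t \<circ> p) k = (if k = i then j else if k = j then i else p k)" for k
        using pfix pij[of k] by (auto simp: Transposition.transpose_def)
      have "?t permutes J" using i that by (intro permutes_swap_id) auto
      moreover have "p permutes J" using p(1) by (rule permutes_subset) auto
      ultimately have perm: "(?t \<circ> p) permutes J" by (intro permutes_compose)
      have invol: "(?t \<circ> p) \<circ> (?t \<circ> p) = id"
      proof
        fix k
        have "p (p k) = k" using p(2) by (metis comp_apply id_apply)
        then show "((?t \<circ> p) \<circ> (?t \<circ> p)) k = id k"
          using that pij[of k] by (simp only: comp_apply[of "?t \<circ> p" "?t \<circ> p"] tp id_apply) auto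
      qed
      have img: "(?t \<circ> p) ` ?K = J - ?K"
      proof -
        have "k \<noteq> i \<and> k \<noteq> j" if "k \<in> K" for k using p(3) that by auto
        then have "(?t \<circ> p) ` K = p ` K" by (intro image_cong refl) (simp only: tp if_False)
        then have "(?t \<circ> p) ` ?K = insert j (p ` K)" by (simp only: image_insert tp if_True refl)
        also have "\<dots> = J - ?K" using p(3,4) that by auto
        finally show ?thesis .
      qed
      have "matching_of J (?t \<circ> p) ?K"
        unfolding matching_of_def using perm invol img i p(3) by auto
      note matching = this
      have fin1: "finite ?J" and fin2: "finite (insert j ?J)" and ij1: "j \<notin> ?J" and ij2: "i \<notin> insert j ?J"
        using J that by auto
      from orth[OF matching] have "0 = (\<Sum>x\<in>words J. pair_tensor (?t \<circ> p) ?K x * T x)" by simp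
      also have "J = insert i (insert j ?J)" using i that by auto
      also have "(\<Sum>x\<in>words (insert i (insert j ?J)). pair_tensor (?t \<circ> p) ?K x * T x)
        = (\<Sum>x\<in>words ?J. \<Sum>w\<in>UNIV. \<Sum>u\<in>UNIV.
              pair_tensor (?t \<circ> p) ?K (x(j := w, i := u)) * T (x(j := w, i := u)))"
        by (simp only: sum_words_insert[OF fin2 ij2] sum_words_insert[OF fin1 ij1])
      also have "\<dots> = (\<Sum>x\<in>words ?J. pair_tensor p K x * contract i j T x)"
      proof (rule sum.cong[OF refl])
        fix x :: "'a \<Rightarrow> 'c \<times> bool"
        have fK: "finite K" "i \<notin> K" "j \<notin> K" using p(3) J finite_subset by auto
        have "pair_tensor (?t \<circ> p) ?K (x(j := w, i := u)) = omega u w * pair_tensor p K x" for u w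
        proof -
          have "(\<Prod>k\<in>K. omega ((x(j := w, i := u)) k) ((x(j := w, i := u)) ((?t \<circ> p) k))) = pair_tensor p K x"
            unfolding pair_tensor_def
          proof (rule prod.cong[OF refl])
            fix k assume "k \<in> K"
            then have "k \<noteq> i" "k \<noteq> j" using fK by auto
            then show "omega ((x(j := w, i := u)) k) ((x(j := w, i := u)) ((?t \<circ> p) k)) = omega (x k) (x (p k))"
              using pij[of k] by (simp only: tp) simp
          qed
          then show ?thesis unfolding pair_tensor_def[of "?t \<circ> p"]
            using fK that by (simp only: prod.insert tp if_True refl) auto
        qed
        then have "(\<Sum>w\<in>UNIV. \<Sum>u\<in>UNIV. pair_tensor (?t \<circ> p) ?K (x(j := w, i := u)) * T (x(j := w, i := u)))
          = pair_tensor p K x * (\<Sum>w\<in>UNIV. \<Sum>u\<in>UNIV. omega u w * T (x(j := w, i := u)))"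
          by (simp add: sum_distrib_left mult_ac)
        also have "(\<Sum>w\<in>UNIV. \<Sum>u\<in>UNIV. omega u w * T (x(j := w, i := u))) =
            (\<Sum>u\<in>UNIV. \<Sum>w\<in>UNIV. if w = flip u then spin u * T (x(i := u, j := w)) else 0)"
          using that by (subst sum.swap) (auto intro!: sum.cong simp: omega_def fun_upd_twist)
        also have "\<dots> = contract i j T x" by (simp add: contract_def)
        finally show "(\<Sum>w\<in>UNIV. \<Sum>u\<in>UNIV. pair_tensor (?t \<circ> p) ?K (x(j := w, i := u)) * T (x(j := w, i := u)))
          = pair_tensor p K x * contract i j T x" .
      qed
      finally show "(\<Sum>x\<in>words ?J. pair_tensor p K x * contract i j T x) = 0" by simp
    qed
    show ?thesis
    proof (rule transposition_sum_injective[OF J i])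
      show "real CARD('c \<times> bool) \<le> 2 * real CARD('c) + 1" by simp
      show "(2 * real CARD('c) + 1) * T y + (\<Sum>j\<in>J - {i}. T (y \<circ> Transposition.transpose i j)) = 0" for y
        unfolding casimir_identity[OF J i inv, of y] by (rule sum.neutral) (simp add: contr)
    qed
  qed
qed

text \<open>The action on a pair tensor decomposes over the pairs, and the two ends of each pair contribute
opposite amounts.\<close>

lemma lie_invariant_pair_tensor:
  fixes p :: "'a \<Rightarrow> 'a"
  assumes "finite J" and pK: "matching_of J p K"
  shows "lie_invariant J (pair_tensor p K :: ('a \<Rightarrow> 'c::finite \<times> bool) \<Rightarrow> real)"
  unfolding lie_invariant_def
proof (intro allI)
  fix x :: "'a \<Rightarrow> 'c \<times> bool" and u v
  let ?C = "pair_tensor p K :: ('a \<Rightarrow> 'c \<times> bool) \<Rightarrow> real"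
  define D where "D k = (if x k = u then ?C (x(k := v)) else 0)
      - (if x k = flip v then spin u * spin v * ?C (x(k := flip u)) else 0)" for k
  have p: "p permutes J" "p (p k) = k" "K \<subseteq> J" "p ` K = J - K" for k
    using pK by (auto simp: matching_of_def fun_eq_iff)
  have fK: "finite K" using p(3) assms(1) finite_subset by blast
  have DD: "D k + D (p k) = 0" if k: "k \<in> K" for k
  proof -
    have pk: "p k \<notin> K" "k \<noteq> p k" using k p(4) by auto
    define R where "R = (\<Prod>l\<in>K - {k}. omega (x l) (x (p l)))"
    have C: "?C (x(k := a)) = omega a (x (p k)) * R" "?C (x(p k := a)) = omega (x k) a * R" for a
    proof -
      have other: "l \<noteq> k" "l \<noteq> p k" "p l \<noteq> k" "p l \<noteq> p k" if "l \<in> K - {k}" for l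
        using that pk p(2) by (auto, metis)+
      show "?C (x(k := a)) = omega a (x (p k)) * R" "?C (x(p k := a)) = omega (x k) a * R"
        unfolding pair_tensor_def R_def prod.remove[OF fK k] using pk other
        by (auto intro!: arg_cong2[where f="(*)"] prod.cong)
    qed
    show ?thesis unfolding D_def C using p(2)
      by (auto simp: omega_def flip_eq_iff)
  qed
  have "(\<Sum>k\<in>J. D k) = (\<Sum>k\<in>K. D k) + (\<Sum>k\<in>p ` K. D k)"
    using p assms(1) by (subst sum.union_disjoint[symmetric]) (auto simp: fK intro!: sum.cong)
  also have "(\<Sum>k\<in>p ` K. D k) = (\<Sum>k\<in>K. D (p k))"
    by (rule sum.reindex_cong[where l=p]) (auto intro!: inj_onI dest: arg_cong[where f=p] simp: p(2))
  finally show "(\<Sum>k\<in>J. (if x k = u then ?C (x(k := v)) else 0)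
      - (if x k = flip v then spin u * spin v * ?C (x(k := flip u)) else 0)) = 0"
    using DD by (simp add: D_def[symmetric] sum.distrib[symmetric])
qed

section \<open>Orbits and signs of permutations\<close>

text \<open>Composing with this transposition takes the point \<open>a\<close> out of its cycle and turns it into a fixed point.\<close>

lemma orbit_remove_point:
  assumes inj: "inj w" and "x \<noteq> a"
  shows "orbit (Transposition.transpose a (w a) \<circ> w) x = orbit w x - {a}"
proof -
  define w' where "w' = Transposition.transpose a (w a) \<circ> w"
  have w': "w' y = (if w y = a then w a else if y = a then a else w y)" for y
    using injD[OF inj, of y a] by (auto simp: w'_def Transposition.transpose_def)
  have wa: "w a \<noteq> a" if "w y = a" "y \<noteq> a" for y using injD[OF inj, of y a] that by auto
  have 1: "y \<in> orbit w x \<and> y \<noteq> a" if "y \<in> orbit w' x" for y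
    using that
  proof induct
    case base
    show ?case unfolding w' using assms(2) wa[of x] by (auto intro: orbit.intros)
  next
    case (step y)
    then show ?case unfolding w' using wa[of y] by (auto intro: orbit.intros)
  qed
  have 2: "(if y = a then w a \<noteq> a \<and> w a \<in> orbit w' x else y \<in> orbit w' x)" if "y \<in> orbit w x" for y
    using that
  proof induct
    case base
    show ?case using orbit.base[of w' x] assms(2) wa[of x] unfolding w'[of x] by auto
  next
    case (step y)
    show ?case
    proof (cases "y = a")
      case False
      with step orbit.step[of y w' x] show ?thesis using wa[of y] unfolding w'[of y] by auto
    qed (use step in auto)
  qed
  have "y \<in> orbit w' x \<longleftrightarrow> y \<in> orbit w x - {a}" for y
    using 1[of y] 2[of y] by (cases "y = a") auto
  then show ?thesis unfolding w'_def[symmetric] by blast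
qed

lemma orbit_eq_of_mem:
  assumes "permutation w" "y \<in> orbit w x" shows "orbit w y = orbit w x"
  using cyclic_on_orbit'[OF assms(1)] assms(2) by (rule orbit_cyclic_eq3)

text \<open>Points are removed from their cycles one by one. A fixed point accounts for one orbit and no sign;
removing any other point costs a transposition and keeps the number of orbits.\<close>

lemma sign_eq_num_orbits:
  assumes "finite S" "w permutes S"
  shows "sign w = (- 1) ^ (card S + card (orbit w ` S))"
  using assms
proof (induction arbitrary: w rule: finite_induct)
  case empty
  then show ?case by simp
next
  case (insert a S)
  let ?w' = "Transposition.transpose a (w a) \<circ> w"
  note w = insert.prems
  have perm: "permutation w" using w insert.hyps by (auto simp: permutation_permutes)
  have inj: "inj w" using w by (rule permutes_inj)
  have w'S: "?w' permutes S" 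
  proof (rule permutes_superset[of _ "insert a S"])
    show "?w' permutes insert a S"
      using w permutes_in_image[OF w, of a] by (intro permutes_compose permutes_swap_id) simp_all
    have "?w' a = a" by simp
    then show "?w' x = x" if "x \<in> insert a S - S" for x using that by blast
  qed
  have orb: "orbit ?w' ` S = (\<lambda>o'. o' - {a}) ` (orbit w ` S)"
    unfolding image_image using insert.hyps by (intro image_cong refl orbit_remove_point inj) auto
  have "inj_on (\<lambda>o'. o' - {a}) (orbit w ` S)"
  proof (rule inj_onI, clarify)
    fix x y assume xy: "x \<in> S" "y \<in> S" "orbit w x - {a} = orbit w y - {a}"
    have "x \<in> orbit w x - {a}" using xy insert.hyps permutation_self_in_orbit[OF perm] by auto
    then have "x \<in> orbit w y" using xy by auto
    then show "orbit w x = orbit w y" by (rule orbit_eq_of_mem[OF perm])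
  qed
  then have card': "card (orbit ?w' ` S) = card (orbit w ` S)" unfolding orb by (rule card_image)
  have sw: "sign w = (if w a = a then 1 else - 1) * sign ?w'"
  proof -
    have "permutation ?w'" using w'S insert.hyps by (auto simp: permutation_permutes)
    have "w = Transposition.transpose a (w a) \<circ> ?w'" by (simp add: fun_eq_iff)
    then have "sign w = sign (Transposition.transpose a (w a) \<circ> ?w')" by simp
    also have "\<dots> = sign (Transposition.transpose a (w a)) * sign ?w'"
      by (rule sign_compose) (auto simp: permutation_swap_id \<open>permutation ?w'\<close>)
    finally show ?thesis by (auto simp: sign_swap_id)
  qed
  have IH: "sign ?w' = (- 1) ^ (card S + card (orbit w ` S))"
    using insert.IH[OF w'S] by (simp only: card')
  show ?case
  proof (cases "w a = a")
    case True
    have "orbit w a = {a}" using True by (simp add: orbit_eq_singleton_iff)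
    moreover have "{a} \<notin> orbit w ` S"
    proof
      assume "{a} \<in> orbit w ` S"
      then obtain x where x: "x \<in> S" "orbit w x = {a}" by auto
      then show False using permutation_self_in_orbit[OF perm, of x] insert.hyps(2) by simp
    qed
    ultimately show ?thesis using True sw IH insert.hyps by simp
  next
    case False
    then have "w a \<in> S" using w permutes_in_image[OF w, of a] by auto
    then have "orbit w a \<in> orbit w ` S"
      unfolding permutation_orbit_step[OF perm, of a, symmetric] by (rule imageI)
    then show ?thesis using False sw IH insert.hyps by (simp add: insert_absorb)
  qed
qed

section \<open>Two pairings on the same set\<close>

lemma pairingsD:
  assumes "p \<in> pairings J"
  shows "p permutes J" "p (p x) = x" "p \<circ> p = id" "x \<in> J \<Longrightarrow> p x \<noteq> x" "p x \<in> J \<longleftrightarrow> x \<in> J" "inj p" "inv p = p"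
proof -
  show p: "p permutes J" "p \<circ> p = id" "x \<in> J \<Longrightarrow> p x \<noteq> x" using assms by (auto simp: pairings_def)
  then show "p (p x) = x" by (metis comp_apply id_apply)
  show "p x \<in> J \<longleftrightarrow> x \<in> J" "inj p" using p(1) by (auto simp: permutes_in_image permutes_inj)
  show "inv p = p" using p(2) by (rule inv_unique_comp) (rule p(2))
qed

text \<open>In the graph whose edges are the pairs of \<open>p\<close> and \<open>q\<close>, every component is a cycle in which the two
kinds of edges alternate. The map \<open>q \<circ> p\<close> goes two steps along it, so it never reaches the neighbour
\<open>p x\<close> of \<open>x\<close>.\<close>

lemma partner_notin_orbit:
  assumes p: "p \<in> pairings J" and q: "q \<in> pairings J" and x: "x \<in> J"
  shows "p x \<notin> orbit (q \<circ> p) x"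
proof -
  note P = pairingsD[OF p] and Q = pairingsD[OF q]
  have ne: "((q \<circ> p) ^^ m) x \<noteq> p x" if "x \<in> J" for m x
    using that
  proof (induction m arbitrary: x rule: less_induct)
    case (less m)
    consider "m = 0" | "m = 1" | l where "m = Suc (Suc l)" by (cases m; cases "m - 1") auto
    then show ?case
    proof cases
      case 1 then show ?thesis using P(4)[OF less.prems] by auto
    next
      case 2 then show ?thesis using Q(4)[of "p x"] P(5) less.prems by auto
    next
      case (3 l)
      let ?y = "(q \<circ> p) x"
      have ff: "(f ^^ Suc (Suc l)) z = f ((f ^^ l) (f z))" for f :: "'a \<Rightarrow> 'a" and l z
        by (simp add: funpow_swap1)
      show ?thesis
      proof
        assume "((q \<circ> p) ^^ m) x = p x"
        then have "q (p (((q \<circ> p) ^^ l) ?y)) = p x"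
          using 3 ff[where f="q \<circ> p" and l=l and z=x] by (simp only: comp_apply)
        then have "((q \<circ> p) ^^ l) ?y = p ?y" by (metis P(2) Q(2) comp_apply)
        moreover have "?y \<in> J" using P(5) Q(5) less.prems by simp
        moreover have "l < m" using 3 by simp
        ultimately show False using less.IH[of l ?y] by blast
      qed
    qed
  qed
  show ?thesis
  proof
    assume "p x \<in> orbit (q \<circ> p) x"
    then have "\<exists>m. p x = ((q \<circ> p) ^^ m) x" unfolding orbit_altdef by blast
    then obtain m where m: "p x = ((q \<circ> p) ^^ m) x" ..
    show False by (rule notE[OF ne[OF x, of m] m[symmetric]])
  qed
qed

lemma orbit_partner:
  assumes J: "finite J" and p: "p \<in> pairings J" and q: "q \<in> pairings J"
  shows "orbit (q \<circ> p) (p x) = p ` orbit (q \<circ> p) x"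
proof -
  note P = pairingsD[OF p] and Q = pairingsD[OF q]
  have perm: "permutation (q \<circ> p)"
    using J P(1) Q(1) by (auto simp: permutation_permutes intro: permutes_compose)
  have "inv (q \<circ> p) = p \<circ> q"
    by (rule inv_unique_comp) (auto simp: fun_eq_iff P(2) Q(2))
  then have "orbit (q \<circ> p) (p x) = orbit (p \<circ> q) (p x)" using orbit_inv_eq[OF perm] by simp
  also have "\<dots> = p ` orbit (q \<circ> p) x"
    by (rule orbit_inverse[OF permutation_self_in_orbit[OF perm], symmetric]) simp
  finally show ?thesis .
qed

lemma involution_swaps_iff:
  assumes "p ` A = J - A" "\<And>y. p (p y) = y" "x \<in> J"
  shows "p x \<in> A \<longleftrightarrow> x \<notin> A"
proof
  assume "p x \<in> A"
  then have "p (p x) \<in> J - A" unfolding assms(1)[symmetric] by (rule imageI)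
  then show "x \<notin> A" by (simp add: assms(2))
next
  assume "x \<notin> A"
  then have "x \<in> p ` A" using assms(1,3) by simp
  then show "p x \<in> A" by (auto simp: assms(2))
qed

text \<open>One of the two colour classes in a proper 2-colouring of the graph formed by the pairs of \<open>p\<close> and \<open>q\<close>.
It contains one element of each pair, of \<open>p\<close> as well as of \<open>q\<close>, and it meets each block of the join
in exactly one orbit of \<open>q \<circ> p\<close>.\<close>

definition half :: "'a set \<Rightarrow> ('a \<Rightarrow> 'a) \<Rightarrow> ('a \<Rightarrow> 'a) \<Rightarrow> 'a set \<Rightarrow> bool" where
  "half J p q A \<longleftrightarrow> A \<subseteq> J \<and> (q \<circ> p) ` A \<subseteq> A \<and> p ` A = J - A"

context
  fixes J :: "'a set" and p q :: "'a \<Rightarrow> 'a"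
  assumes J: "finite J" and p: "p \<in> pairings J" and q: "q \<in> pairings J"
begin

text \<open>Each component consists of an orbit of \<open>q \<circ> p\<close> and its image under \<open>p\<close>. A representative of the
component, chosen by \<open>r\<close>, decides which of the two is taken.\<close>

lemma half_exists: obtains A where "half J p q A"
proof -
  note P = pairingsD[OF p] and Q = pairingsD[OF q]
  let ?w = "q \<circ> p"
  have perm: "permutation ?w" and w: "?w permutes J"
    using J P(1) Q(1) by (auto simp: permutation_permutes intro: permutes_compose)
  note par = orbit_partner[OF J p q]
  define r where "r x = (SOME y. y \<in> orbit ?w x \<union> orbit ?w (p x))" for x
  define A where "A = {x \<in> J. r x \<in> orbit ?w x}"
  have r: "r x \<in> orbit ?w x \<union> orbit ?w (p x)" for x
    unfolding r_def by (rule someI[of _ x]) (simp add: permutation_self_in_orbit[OF perm])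
  have rp: "r (p x) = r x" for x unfolding r_def by (simp add: P(2) Un_commute)
  have rw: "r (?w x) = r x" for x
    unfolding r_def by (simp only: par permutation_orbit_step[OF perm])
  have disj: "orbit ?w x \<inter> orbit ?w (p x) = {}" if "x \<in> J" for x
  proof (rule ccontr)
    assume "orbit ?w x \<inter> orbit ?w (p x) \<noteq> {}"
    then obtain y where y: "y \<in> orbit ?w x" "y \<in> orbit ?w (p x)" by auto
    then have "orbit ?w x = orbit ?w (p x)" by (metis orbit_eq_of_mem[OF perm])
    then have "p x \<in> orbit ?w x" by (simp add: permutation_self_in_orbit[OF perm])
    then show False using partner_notin_orbit[OF p q that] by simp
  qed
  have iff: "x \<in> A \<longleftrightarrow> p x \<notin> A" if "x \<in> J" for x
    using r[of x] disj[OF that] that by (auto simp: A_def rp P(5))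
  have "p ` A = J - A"
  proof (intro equalityI subsetI)
    fix y assume "y \<in> p ` A"
    then obtain a where a: "a \<in> A" "y = p a" by auto
    moreover have "a \<in> J" using a(1) unfolding A_def by simp
    ultimately show "y \<in> J - A" using iff[of a] P(5)[of a] by simp
  next
    fix y assume "y \<in> J - A"
    then have "p y \<in> A" using iff[of "p y"] P(2)[of y] P(5)[of y] by simp
    then show "y \<in> p ` A" using P(2)[of y] by (metis imageI)
  qed
  moreover have "?w ` A \<subseteq> A"
    using P(5) Q(5) unfolding A_def image_subset_iff mem_Collect_eq rw permutation_orbit_step[OF perm] by auto
  ultimately have "half J p q A" unfolding half_def by (auto simp: A_def)
  then show ?thesis by (rule that)
qed

context
  fixes A assumes A: "half J p q A"
begin

lemma half_basic:
  shows half_sub: "A \<subseteq> J" and half_fin: "finite A"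
    and half_orbit: "x \<in> A \<Longrightarrow> orbit (q \<circ> p) x \<subseteq> A"
    and half_p: "p ` A = J - A" and half_q: "q ` A = J - A"
    and half_pre: "x \<in> J \<Longrightarrow> (q \<circ> p) x \<in> A \<longleftrightarrow> x \<in> A"
    and half_p_iff: "x \<in> J \<Longrightarrow> p x \<in> A \<longleftrightarrow> x \<notin> A"
    and half_q_iff: "x \<in> J \<Longrightarrow> q x \<in> A \<longleftrightarrow> x \<notin> A"
proof -
  note P = pairingsD[OF p] and Q = pairingsD[OF q]
  show sub: "A \<subseteq> J" and pA: "p ` A = J - A" using A by (auto simp: half_def)
  then show fin: "finite A" using J finite_subset by auto
  have wA: "(q \<circ> p) ` A \<subseteq> A" using A by (auto simp: half_def)
  show "orbit (q \<circ> p) x \<subseteq> A" if "x \<in> A"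
  proof
    fix y assume "y \<in> orbit (q \<circ> p) x"
    then show "y \<in> A" by induct (use wA that in auto)
  qed
  have "inj (q \<circ> p)" using P(6) Q(6) by (rule inj_compose[rotated])
  then have wAeq: "(q \<circ> p) ` A = A"
    using endo_inj_surj[OF fin wA] by (auto intro: inj_on_subset)
  have "q ` A = q ` (q \<circ> p) ` A" by (simp only: wAeq)
  also have "\<dots> = p ` A" by (auto simp: image_image Q(2))
  finally show qA: "q ` A = J - A" using pA by simp
  show piff: "p x \<in> A \<longleftrightarrow> x \<notin> A" if "x \<in> J" for x
    by (rule involution_swaps_iff[OF pA P(2) that])
  show qiff: "q x \<in> A \<longleftrightarrow> x \<notin> A" if "x \<in> J" for x
    by (rule involution_swaps_iff[OF qA Q(2) that])
  show "(q \<circ> p) x \<in> A \<longleftrightarrow> x \<in> A" if "x \<in> J"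
    using piff[OF that] qiff[of "p x"] P(5)[of x] that by simp
qed

lemma num_orbits_half: "num_orbits J (q \<circ> p) = 2 * num_orbits A (q \<circ> p)"
  "num_orbits (J - A) (q \<circ> p) = num_orbits A (q \<circ> p)"
proof -
  let ?w = "q \<circ> p"
  note P = pairingsD[OF p] and Q = pairingsD[OF q]
  have perm: "permutation ?w" and w: "?w permutes J"
    using J P(1) Q(1) by (auto simp: permutation_permutes intro: permutes_compose)
  have co: "orbit ?w ` (J - A) = (`) p ` orbit ?w ` A"
    unfolding half_p[symmetric] image_image by (intro image_cong refl orbit_partner[OF J p q])
  have "inj_on ((`) p) (orbit ?w ` A)" using P(6) by (intro inj_onI) (simp add: inj_image_eq_iff)
  then show c: "num_orbits (J - A) ?w = num_orbits A ?w"
    unfolding num_orbits_def co by (rule card_image)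
  have "orbit ?w ` J = orbit ?w ` A \<union> orbit ?w ` (J - A)" using half_sub by auto
  moreover have "orbit ?w ` A \<inter> orbit ?w ` (J - A) = {}"
  proof (rule ccontr)
    assume "orbit ?w ` A \<inter> orbit ?w ` (J - A) \<noteq> {}"
    then obtain x y where "x \<in> A" "y \<in> J - A" "orbit ?w x = orbit ?w y" by auto
    then show False using half_orbit[of x] permutation_self_in_orbit[OF perm, of y] by auto
  qed
  ultimately have "num_orbits J ?w = num_orbits A ?w + num_orbits (J - A) ?w"
    unfolding num_orbits_def using half_fin J by (simp add: card_Un_disjoint)
  then show "num_orbits J ?w = 2 * num_orbits A ?w" by (simp add: c)
qed

lemma join_blocks_half: "join_blocks J p q = num_orbits A (q \<circ> p)"
proof -
  define w where "w = q \<circ> p"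
  have w_app: "w y = q (p y)" for y by (simp add: w_def)
  note P = pairingsD[OF p] and Q = pairingsD[OF q]
  have perm: "permutation w" and w: "w permutes J"
    unfolding w_def using J P(1) Q(1) by (auto simp: permutation_permutes intro: permutes_compose)
  let ?R = "(\<Union>x\<in>J. {(x, p x), (x, q x)})"
  have cls: "?R\<^sup>* `` {x} = orbit w x \<union> p ` orbit w x" if x: "x \<in> J" for x
  proof
    have w_closed: "z \<in> orbit w x" if "w z \<in> orbit w x" for z
      using orbit_eq_of_mem[OF perm that] permutation_orbit_step[OF perm, of z]
        permutation_self_in_orbit[OF perm, of z] by simp
    have sub: "y \<in> orbit w x \<union> p ` orbit w x" if "(x, y) \<in> ?R\<^sup>*" for y
      using that
    proof induct
      case base
      show ?case by (rule UnI1) (rule permutation_self_in_orbit[OF perm])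
    next
      case (step y z)
      have z: "z = p y \<or> z = q y" using step(2) by auto
      have "z \<in> orbit w x \<union> p ` orbit w x" if y: "y \<in> orbit w x"
      proof -
        have "p (q y) \<in> orbit w x" by (rule w_closed) (simp add: w_app P(2) Q(2) y)
        then have "p (p (q y)) \<in> p ` orbit w x" by (rule imageI)
        then have "q y \<in> p ` orbit w x" by (simp only: P(2))
        moreover have "p y \<in> p ` orbit w x" using y by (rule imageI)
        ultimately show ?thesis using z by (elim disjE) simp_all
      qed
      moreover have "z \<in> orbit w x \<union> p ` orbit w x" if y: "y = p u" "u \<in> orbit w x" for u
      proof -
        have "q y \<in> orbit w x" using orbit.step[OF y(2)] by (simp only: w_app y(1))
        moreover have "p y \<in> orbit w x" using y(2) by (simp only: y(1) P(2))
        ultimately show ?thesis using z by (elim disjE) simp_all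
      qed
      ultimately show ?case using step(3) by (elim UnE imageE)
    qed
    show "?R\<^sup>* `` {x} \<subseteq> orbit w x \<union> p ` orbit w x" 
      by (intro subsetI sub) (simp only: Image_singleton_iff)
    have 1: "(x, y) \<in> ?R\<^sup>* \<and> y \<in> J \<and> (x, p y) \<in> ?R\<^sup>*" if "y \<in> orbit w x" for y
    proof -
      have step: "(x, w y) \<in> ?R\<^sup>* \<and> w y \<in> J" if "(x, y) \<in> ?R\<^sup>*" "y \<in> J" for y
      proof -
        have "(y, p y) \<in> ?R" "(p y, q (p y)) \<in> ?R" using that P(5)[of y] by auto
        then have "(x, q (p y)) \<in> ?R\<^sup>*" using that(1) by (meson rtrancl_into_rtrancl)
        then show ?thesis unfolding w_app using that P(5)[of y] Q(5)[of "p y"] by simp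
      qed
      from that have "(x, y) \<in> ?R\<^sup>* \<and> y \<in> J"
        by induct (use step x in auto)
      moreover from this have "(y, p y) \<in> ?R" by auto
      ultimately show ?thesis by (meson rtrancl_into_rtrancl)
    qed
    show "orbit w x \<union> p ` orbit w x \<subseteq> ?R\<^sup>* `` {x}"
    proof (intro Un_least subsetI)
      fix y assume "y \<in> orbit w x"
      then show "y \<in> ?R\<^sup>* `` {x}" unfolding Image_singleton_iff using 1[of y] by simp
    next
      fix y assume "y \<in> p ` orbit w x"
      then obtain z where "z \<in> orbit w x" "y = p z" by auto
      then show "y \<in> ?R\<^sup>* `` {x}" unfolding Image_singleton_iff using 1[of z] by simp
    qed
  qed
  have "J // ?R\<^sup>* = (\<lambda>x. ?R\<^sup>* `` {x}) ` J" by (auto simp: quotient_def)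
  also have "\<dots> = (\<lambda>x. orbit w x \<union> p ` orbit w x) ` J" by (intro image_cong refl cls)
  also have "\<dots> = (\<lambda>x. orbit w x \<union> p ` orbit w x) ` A"
  proof -
    have "orbit w (p x) \<union> p ` orbit w (p x) = orbit w x \<union> p ` orbit w x" for x
      by (simp only: orbit_partner[OF J p q, folded w_def] image_image P(2)) auto
    moreover have "J = A \<union> p ` A" using half_p half_sub by auto
    ultimately show ?thesis by (simp only: image_Un image_image Un_absorb)
  qed
  also have "\<dots> = (\<lambda>o'. o' \<union> p ` o') ` orbit w ` A" by (simp add: image_image)
  finally have eq: "J // ?R\<^sup>* = (\<lambda>o'. o' \<union> p ` o') ` orbit w ` A" .
  have "inj_on (\<lambda>o'. o' \<union> p ` o') (orbit w ` A)"
  proof (rule inj_on_inverseI[where g="\<lambda>B. B \<inter> A"], clarify)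
    fix x assume "x \<in> A"
    then have "orbit w x \<subseteq> A" unfolding w_def by (rule half_orbit)
    moreover from this have "p ` orbit w x \<inter> A = {}" using half_p by auto
    ultimately show "(orbit w x \<union> p ` orbit w x) \<inter> A = orbit w x" by auto
  qed
  then show ?thesis unfolding join_blocks_def eq num_orbits_def w_def by (rule card_image)
qed

end
end

section \<open>The pseudoinverse of a symmetric matrix\<close>

text \<open>Gaussian elimination: an equation in which some unknown has a nonzero coefficient is used to eliminate
this unknown from the other equations.\<close>

lemma homogeneous_system_nontrivial:
  fixes a :: "'i \<Rightarrow> 'e \<Rightarrow> real"
  assumes "finite E" "finite I" "card E < card I"
  shows "\<exists>c. (\<exists>i\<in>I. c i \<noteq> 0) \<and> (\<forall>e\<in>E. (\<Sum>i\<in>I. c i * a i e) = 0)"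
  using assms
proof (induction E arbitrary: I a rule: finite_induct)
  case empty
  then obtain i where "i \<in> I" by (metis all_not_in_conv card.empty less_irrefl)
  then show ?case by (intro exI[of _ "\<lambda>_. 1"]) auto
next
  case (insert e E)
  show ?case
  proof (cases "\<forall>i\<in>I. a i e = 0")
    case True
    obtain c where "\<exists>i\<in>I. c i \<noteq> 0" "\<forall>e\<in>E. (\<Sum>i\<in>I. c i * a i e) = 0"
      using insert.IH[of I a] insert.prems insert.hyps by auto
    then show ?thesis using True by (intro exI[of _ c]) simp
  next
    case False
    then obtain i0 where i0: "i0 \<in> I" "a i0 e \<noteq> 0" by auto
    define a' where "a' i f = a i f - a i e / a i0 e * a i0 f" for i f
    have "card E < card (I - {i0})" using insert.prems insert.hyps i0 by simp
    then obtain c where c: "\<exists>i\<in>I - {i0}. c i \<noteq> 0" "\<And>f. f \<in> E \<Longrightarrow> (\<Sum>i\<in>I - {i0}. c i * a' i f) = 0"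
      using insert.IH[of "I - {i0}" a'] insert.prems by auto
    \<comment> \<open>the value of the eliminated unknown is forced by the equation \<open>e\<close>\<close>
    define d where "d = c(i0 := - (\<Sum>i\<in>I - {i0}. c i * (a i e / a i0 e)))"
    have sum_d: "(\<Sum>i\<in>I. d i * a i f) = (\<Sum>i\<in>I - {i0}. c i * a' i f)" for f
    proof -
      have "(\<Sum>i\<in>I. d i * a i f) = d i0 * a i0 f + (\<Sum>i\<in>I - {i0}. d i * a i f)"
        by (rule sum.remove[OF insert.prems(1) i0(1)])
      also have "(\<Sum>i\<in>I - {i0}. d i * a i f) = (\<Sum>i\<in>I - {i0}. c i * a i f)"
        by (rule sum.cong) (auto simp: d_def)
      also have "d i0 * a i0 f = - (\<Sum>i\<in>I - {i0}. c i * (a i e / a i0 e * a i0 f))"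
        by (simp add: d_def sum_distrib_right mult.assoc)
      finally show ?thesis by (simp add: a'_def right_diff_distrib sum_subtractf)
    qed
    have "a' i e = 0" for i using i0 by (simp add: a'_def)
    then have "(\<Sum>i\<in>I. d i * a i f) = 0" if "f \<in> insert e E" for f
      using that c(2)[of f] unfolding sum_d by auto
    moreover have "\<exists>i\<in>I. d i \<noteq> 0" using c(1) by (auto simp: d_def)
    ultimately show ?thesis by blast
  qed
qed

definition vdot :: "'b set \<Rightarrow> ('b \<Rightarrow> real) \<Rightarrow> ('b \<Rightarrow> real) \<Rightarrow> real" where
  "vdot P v w = (\<Sum>a\<in>P. v a * w a)"
definition mv :: "'b set \<Rightarrow> ('b \<Rightarrow> 'b \<Rightarrow> real) \<Rightarrow> ('b \<Rightarrow> real) \<Rightarrow> 'b \<Rightarrow> real" where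
  "mv P G v a = (if a \<in> P then \<Sum>c\<in>P. G a c * v c else 0)"

lemma vdot_mv_sym:
  assumes "\<And>a b. a \<in> P \<Longrightarrow> b \<in> P \<Longrightarrow> G a b = G b a"
  shows "vdot P (mv P G v) w = vdot P v (mv P G w)"
proof -
  have "vdot P (mv P G v) w = (\<Sum>a\<in>P. \<Sum>c\<in>P. G a c * v c * w a)"
    by (simp add: vdot_def mv_def sum_distrib_right)
  also have "\<dots> = (\<Sum>c\<in>P. \<Sum>a\<in>P. G a c * v c * w a)" by (rule sum.swap)
  also have "\<dots> = (\<Sum>c\<in>P. \<Sum>a\<in>P. v c * (G c a * w a))"
    by (intro sum.cong refl) (simp add: assms)
  finally show ?thesis by (simp add: vdot_def mv_def sum_distrib_left)
qed

lemma vdot_self_eq_0: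
  assumes "finite P" shows "vdot P v v = 0 \<longleftrightarrow> (\<forall>a\<in>P. v a = 0)"
  unfolding vdot_def using assms by (subst sum_nonneg_eq_0_iff) auto

lemma mv_cong: "(\<And>a. a \<in> P \<Longrightarrow> v a = w a) \<Longrightarrow> mv P G v = mv P G w"
  by (auto simp: mv_def fun_eq_iff intro!: sum.cong)

lemma mv_linear: "mv P G (\<lambda>a. r * v a + w a) = (\<lambda>a. r * mv P G v a + mv P G w a)"
  by (auto simp: mv_def fun_eq_iff algebra_simps sum.distrib sum_distrib_left)

text \<open>If \<open>G (G u) = 0\<close>, then \<open>G u\<close> is orthogonal to itself, because \<open>G\<close> is symmetric. This lowers the exponent
step by step.\<close>

lemma symmetric_kernel:
  assumes "finite P" and sym: "\<And>a b. a \<in> P \<Longrightarrow> b \<in> P \<Longrightarrow> G a b = G b a"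
    and zero: "(mv P G ^^ Suc k) v = (\<lambda>_. 0)"
  shows "mv P G v = (\<lambda>_. 0)"
  using zero
proof (induction k)
  case (Suc k)
  let ?u = "(mv P G ^^ k) v"
  have "vdot P (mv P G ?u) (mv P G ?u) = vdot P ?u (mv P G (mv P G ?u))" by (rule vdot_mv_sym[OF sym])
  also have "mv P G (mv P G ?u) = (\<lambda>_. 0)" using Suc.prems by simp
  finally have "\<forall>a\<in>P. mv P G ?u a = 0"
    using vdot_self_eq_0[OF assms(1)] by (simp add: vdot_def)
  then have "mv P G ?u = (\<lambda>_. 0)" by (auto simp: mv_def)
  then show ?case using Suc.IH by simp
qed simp

text \<open>The vectors \<open>v\<close>, \<open>G v\<close>, \<open>G\<^sup>2 v\<close>, ... are linearly dependent. The lowest term of a dependence relation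
gives \<open>G\<^sup>k (c v + G u) = 0\<close> with \<open>c \<noteq> 0\<close>, and \<open>G\<^sup>k\<close> may be replaced by \<open>G\<close>.\<close>

lemma symmetric_range_square:
  assumes P: "finite P" and sym: "\<And>a b. a \<in> P \<Longrightarrow> b \<in> P \<Longrightarrow> G a b = G b a"
  shows "\<exists>y. mv P G (mv P G y) = mv P G v"
proof -
  let ?f = "mv P G"
  obtain c where c: "\<exists>i\<in>{..card P}. c i \<noteq> 0" "\<And>a. a \<in> P \<Longrightarrow> (\<Sum>i\<in>{..card P}. c i * (?f ^^ i) v a) = 0"
    using homogeneous_system_nontrivial[OF P, of "{..card P}" "\<lambda>i. (?f ^^ i) v"] by auto
  define k where "k = (LEAST i. i \<le> card P \<and> c i \<noteq> 0)"
  have k: "k \<le> card P" "c k \<noteq> 0"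
    using LeastI_ex[of "\<lambda>i. i \<le> card P \<and> c i \<noteq> 0"] c(1) by (auto simp: k_def)
  have least: "c i = 0" if "i < k" for i
    using not_less_Least[of i "\<lambda>i. i \<le> card P \<and> c i \<noteq> 0"] that k(1) by (auto simp: k_def)
  define u where "u a = (\<Sum>i\<in>{k<..card P}. c i * (?f ^^ (i - k - 1)) v a)" for a
  have lin: "(?f ^^ j) (\<lambda>a. r * w a + w' a) = (\<lambda>a. r * (?f ^^ j) w a + (?f ^^ j) w' a)" for j r w w'
    by (induction j) (simp_all add: mv_linear)
  have zero: "(?f ^^ j) (\<lambda>_. 0) = (\<lambda>_. 0)" for j
    by (induction j) (auto simp: mv_def)
  have sum_f: "(?f ^^ j) (\<lambda>a. \<Sum>i\<in>I. c i * w i a) = (\<lambda>a. \<Sum>i\<in>I. c i * (?f ^^ j) (w i) a)" if "finite I" for j w and I :: "nat set"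
    using that by (induction I rule: finite_induct) (simp_all add: zero lin)
  have "(?f ^^ k) (\<lambda>a. c k * v a + ?f u a) a = 0" if "a \<in> P" for a
  proof -
    have fu: "?f u = (?f ^^ 1) u" by simp
    have "(?f ^^ k) (\<lambda>a. c k * v a + ?f u a) = (\<lambda>a. c k * (?f ^^ k) v a + (?f ^^ Suc k) u a)"
      by (simp add: lin funpow_swap1)
    moreover have "(?f ^^ Suc k) u = (\<lambda>a. \<Sum>i\<in>{k<..card P}. c i * (?f ^^ Suc k) ((?f ^^ (i - k - 1)) v) a)"
      unfolding u_def by (rule sum_f) simp
    moreover have "(?f ^^ Suc k) ((?f ^^ (i - k - 1)) v) = (?f ^^ i) v" if "i \<in> {k<..card P}" for i
      using that by (simp add: comp_def funpow_add[symmetric, THEN fun_cong, simplified comp_apply] del: funpow.simps)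
    moreover have "{..card P} = {..<k} \<union> ({k} \<union> {k<..card P})" using k(1) by auto
    then have "(\<Sum>i\<in>{..card P}. c i * (?f ^^ i) v a) = c k * (?f ^^ k) v a + (\<Sum>i\<in>{k<..card P}. c i * (?f ^^ i) v a)"
      by (simp only:) (subst sum.union_disjoint, auto simp: least)
    ultimately show ?thesis using c(2)[OF that] by (simp del: funpow.simps)
  qed
  then have "(?f ^^ Suc k) (\<lambda>a. c k * v a + ?f u a) = ?f (\<lambda>_. 0)"
    by (simp only: funpow.simps comp_apply) (rule mv_cong)
  also have "\<dots> = (\<lambda>_. 0)" by (auto simp: mv_def)
  finally have "(?f ^^ Suc k) (\<lambda>a. c k * v a + ?f u a) = (\<lambda>_. 0)" .
  then have "?f (\<lambda>a. c k * v a + ?f u a) = (\<lambda>_. 0)" by (rule symmetric_kernel[OF P sym, rotated 2])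
  then have eq: "c k * ?f v a + ?f (?f u) a = 0" for a by (simp add: mv_linear fun_eq_iff)
  have "?f (?f (\<lambda>a. (- 1 / c k) * u a + 0)) = (\<lambda>a. (- 1 / c k) * ?f (?f u) a)"
    unfolding mv_linear by (simp add: mv_linear[where w="\<lambda>_. 0", simplified] zero[of 1, simplified])
  also have "\<dots> = ?f v"
    using k(2) eq by (auto simp: fun_eq_iff field_simps) (metis add.commute add_eq_0_iff minus_mult_commute)
  finally show ?thesis by blast
qed

text \<open>Matrices indexed by \<open>P\<close> are functions that vanish outside \<open>P \<times> P\<close>, so that an equation between
matrices is an equation between functions and can be used for rewriting.\<close>

definition mm :: "'b set \<Rightarrow> ('b \<Rightarrow> 'b \<Rightarrow> real) \<Rightarrow> ('b \<Rightarrow> 'b \<Rightarrow> real) \<Rightarrow> 'b \<Rightarrow> 'b \<Rightarrow> real" where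
  "mm P A B a b = (if a \<in> P \<and> b \<in> P then \<Sum>c\<in>P. A a c * B c b else 0)"
definition mtr :: "('b \<Rightarrow> 'b \<Rightarrow> real) \<Rightarrow> 'b \<Rightarrow> 'b \<Rightarrow> real" where "mtr A a b = A b a"
definition mres :: "'b set \<Rightarrow> ('b \<Rightarrow> 'b \<Rightarrow> real) \<Rightarrow> 'b \<Rightarrow> 'b \<Rightarrow> real" where
  "mres P A a b = (if a \<in> P \<and> b \<in> P then A a b else 0)"

lemma mm_assoc: "mm P (mm P A B) C = mm P A (mm P B C)"
proof (intro ext)
  fix a b
  show "mm P (mm P A B) C a b = mm P A (mm P B C) a b"
  proof (cases "a \<in> P \<and> b \<in> P")
    case True
    have "(\<Sum>c\<in>P. (\<Sum>d\<in>P. A a d * B d c) * C c b) = (\<Sum>c\<in>P. \<Sum>d\<in>P. A a d * B d c * C c b)"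
      by (simp add: sum_distrib_right)
    also have "\<dots> = (\<Sum>d\<in>P. \<Sum>c\<in>P. A a d * B d c * C c b)" by (rule sum.swap)
    also have "\<dots> = (\<Sum>d\<in>P. A a d * (\<Sum>c\<in>P. B d c * C c b))"
      by (simp add: sum_distrib_left mult.assoc)
    finally show ?thesis using True by (simp add: mm_def cong: sum.cong)
  qed (auto simp: mm_def)
qed

lemma mtr_mm: "mtr (mm P A B) = mm P (mtr B) (mtr A)"
  by (auto simp: mtr_def mm_def fun_eq_iff mult.commute)
lemma mtr_mtr [simp]: "mtr (mtr A) = A" by (simp add: mtr_def fun_eq_iff)

lemma is_pseudoinverse_alt:
  assumes G: "mres P G = G"
  shows "is_pseudoinverse P G W \<longleftrightarrow> mm P (mm P G W) G = G \<and> mm P (mm P W G) W = W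
     \<and> mtr (mm P G W) = mm P G W \<and> mtr (mm P W G) = mm P W G \<and> mres P W = W"
proof -
  have sum3: "(\<Sum>c\<in>P. \<Sum>d\<in>P. A a c * B c d * C d b) = mm P (mm P A B) C a b" if "a \<in> P" "b \<in> P" for A B C a b
    using that unfolding mm_assoc by (simp add: mm_def sum_distrib_left mult.assoc cong: sum.cong)
  have sum2: "(\<Sum>c\<in>P. A a c * B c b) = mm P A B a b" if "a \<in> P" "b \<in> P" for A B a b
    using that by (simp add: mm_def)
  have ext2: "A = B \<longleftrightarrow> (\<forall>a\<in>P. \<forall>b\<in>P. A a b = B a b)"
    if "\<And>a b. \<not> (a \<in> P \<and> b \<in> P) \<Longrightarrow> A a b = 0" "\<And>a b. \<not> (a \<in> P \<and> b \<in> P) \<Longrightarrow> B a b = 0" for A B :: "'a \<Rightarrow> 'a \<Rightarrow> real"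
    using that by (metis ext)
  have G0: "G a b = 0" if "\<not> (a \<in> P \<and> b \<in> P)" for a b
    using fun_cong[OF fun_cong[OF G], of a b] that by (auto simp: mres_def split: if_splits)
  have mm0: "mm P A B a b = 0" if "\<not> (a \<in> P \<and> b \<in> P)" for A B a b
    using that by (auto simp: mm_def)
  have e1: "mres P W = W \<longleftrightarrow> (\<forall>a b. \<not> (a \<in> P \<and> b \<in> P) \<longrightarrow> W a b = 0)"
    by (auto simp: mres_def fun_eq_iff)
  have e2: "mm P (mm P G W) G = G \<longleftrightarrow> (\<forall>a\<in>P. \<forall>b\<in>P. (\<Sum>c\<in>P. \<Sum>d\<in>P. G a c * W c d * G d b) = G a b)"
    by (subst ext2) (simp_all add: mm0 G0 sum3)
  have e3: "mm P (mm P W G) W = W \<longleftrightarrow> (\<forall>a\<in>P. \<forall>b\<in>P. (\<Sum>c\<in>P. \<Sum>d\<in>P. W a c * G c d * W d b) = W a b)"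
    if "\<forall>a b. \<not> (a \<in> P \<and> b \<in> P) \<longrightarrow> W a b = 0"
    using that by (subst ext2) (simp_all add: mm0 sum3)
  have e4: "mtr (mm P A B) = mm P A B \<longleftrightarrow> (\<forall>a\<in>P. \<forall>b\<in>P. (\<Sum>c\<in>P. A a c * B c b) = (\<Sum>c\<in>P. A b c * B c a))" for A B
    by (subst ext2) (auto simp: mm0 mtr_def sum2)
  show ?thesis unfolding is_pseudoinverse_def using e1 e2 e3 e4[of G W] e4[of W G] by argo
qed

lemma pseudoinverse_unique:
  assumes G: "mres P G = G" and "is_pseudoinverse P G W" "is_pseudoinverse P G W'"
  shows "W = W'"
proof -
  have W: "mm P (mm P G W) G = G" "mm P (mm P W G) W = W" "mtr (mm P G W) = mm P G W" "mtr (mm P W G) = mm P W G"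
    and W': "mm P (mm P G W') G = G" "mm P (mm P W' G) W' = W'" "mtr (mm P G W') = mm P G W'" "mtr (mm P W' G) = mm P W' G"
    using assms(2,3)[unfolded is_pseudoinverse_alt[OF G]] by simp_all
  have left: "mm P G W = mm P G W'"
  proof -
    have "mm P G W = mm P (mm P (mm P G W') G) W" by (simp only: W')
    also have "\<dots> = mm P (mtr (mm P G W')) (mtr (mm P G W))" by (simp only: W(3) W'(3) mm_assoc)
    also have "\<dots> = mtr (mm P (mm P (mm P G W) G) W')" by (simp only: mtr_mm[symmetric] mm_assoc)
    also have "\<dots> = mm P G W'" by (simp only: W W')
    finally show ?thesis .
  qed
  have right: "mm P W G = mm P W' G"
  proof -
    have "mm P W G = mm P W (mm P (mm P G W') G)" by (simp only: W')
    also have "\<dots> = mm P (mtr (mm P W G)) (mtr (mm P W' G))" by (simp only: W(4) W'(4) mm_assoc)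
    also have "\<dots> = mtr (mm P W' (mm P (mm P G W) G))" by (simp only: mtr_mm[symmetric] mm_assoc)
    also have "\<dots> = mm P W' G" by (simp only: W W')
    finally show ?thesis .
  qed
  have "W = mm P (mm P W G) W" by (simp only: W)
  also have "\<dots> = mm P W (mm P G W')" by (simp only: mm_assoc left)
  also have "\<dots> = mm P (mm P W' G) W'" by (simp only: mm_assoc[symmetric] right)
  also have "\<dots> = W'" by (simp only: W')
  finally show ?thesis .
qed

text \<open>Let \<open>Y\<close> solve \<open>G\<^sup>2 Y = G\<close> and put \<open>Q = G Y\<close>. Then \<open>Q\<^sup>T G = G\<close>, hence \<open>Q\<^sup>T Q = Q\<close>: this is the orthogonal
projection onto the range of \<open>G\<close>, and \<open>W = Q Y\<close> satisfies \<open>G W = W G = Q\<close>.\<close>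

lemma pseudoinverse_exists:
  assumes P: "finite P" and G: "mres P G = G" and sym: "mtr G = G"
  shows "\<exists>W. is_pseudoinverse P G W"
proof -
  have symG: "G a b = G b a" for a b using fun_cong[OF fun_cong[OF sym], of a b] by (simp add: mtr_def)
  have "\<exists>y. mv P G (mv P G y) = mv P G (\<lambda>a. if a = b then 1 else 0)" for b
    by (rule symmetric_range_square[OF P symG])
  then obtain y where y: "\<And>b. mv P G (mv P G (y b)) = mv P G (\<lambda>a. if a = b then 1 else 0)" by metis
  define Y where "Y a b = y b a" for a b
  have "mm P G (mm P G Y) = G"
  proof (intro ext)
    fix a b
    show "mm P G (mm P G Y) a b = G a b"
    proof (cases "a \<in> P \<and> b \<in> P")
      case True
      have "mm P G (mm P G Y) a b = mv P G (mv P G (y b)) a"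
        using True by (simp add: mm_def mv_def Y_def cong: sum.cong)
      also have "\<dots> = G a b" using True P by (simp add: y mv_def if_distrib cong: if_cong)
      finally show ?thesis .
    next
      case False
      then show ?thesis using fun_cong[OF fun_cong[OF G], of a b] by (auto simp: mm_def mres_def split: if_splits)
    qed
  qed
  note GGY = this
  define Q where "Q = mm P G Y"
  have GQ: "mm P G Q = G" using GGY by (simp add: Q_def)
  have QtG: "mm P (mtr Q) G = G" using arg_cong[OF GQ, of mtr] by (simp add: mtr_mm sym)
  have "mm P (mtr Q) Q = mm P (mm P (mtr Q) G) Y" by (simp add: Q_def mm_assoc)
  then have QtQ: "mm P (mtr Q) Q = Q" by (simp only: QtG Q_def[symmetric])
  have "mtr Q = mtr (mm P (mtr Q) Q)" by (simp only: QtQ)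
  also have "\<dots> = Q" unfolding mtr_mm mtr_mtr by (rule QtQ)
  finally have Qsym: "mtr Q = Q" .
  have QQ: "mm P Q Q = Q" and QG: "mm P Q G = G" using QtQ QtG by (simp_all add: Qsym)
  have YtG: "mm P (mtr Y) G = Q" using arg_cong[OF Q_def, of mtr] by (simp add: mtr_mm sym Qsym)
  define W where "W = mm P Q Y"
  have GW: "mm P G W = Q" by (simp add: W_def mm_assoc[symmetric] GQ) (simp add: Q_def)
  have "W = mm P (mm P (mtr Y) G) Y" by (simp only: W_def YtG)
  also have "\<dots> = mm P (mtr Y) Q" by (simp only: mm_assoc Q_def)
  finally have W2: "W = mm P (mtr Y) Q" .
  have WG: "mm P W G = Q" by (simp add: W2 mm_assoc QG YtG)
  have "mm P Q W = W" by (simp add: W_def mm_assoc[symmetric] QQ)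
  moreover have "mres P W = W" by (auto simp: W_def mres_def mm_def fun_eq_iff)
  ultimately have "is_pseudoinverse P G W"
    unfolding is_pseudoinverse_alt[OF G] by (simp add: GW WG QG Qsym)
  then show ?thesis by blast
qed

lemma is_pseudoinverse_mres: "is_pseudoinverse P (mres P G) W \<longleftrightarrow> is_pseudoinverse P G W"
  unfolding is_pseudoinverse_def by (simp add: mres_def cong: sum.cong)

lemma is_pseudoinverse_The:
  assumes P: "finite P" and sym: "\<And>a b. a \<in> P \<Longrightarrow> b \<in> P \<Longrightarrow> G a b = G b a"
  shows "is_pseudoinverse P G (THE W. is_pseudoinverse P G W)"
proof -
  have G: "mres P (mres P G) = mres P G" by (simp add: mres_def fun_eq_iff)
  have "mtr (mres P G) = mres P G" using sym by (auto simp: mtr_def mres_def fun_eq_iff)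
  from pseudoinverse_exists[OF P G this] obtain W where W: "is_pseudoinverse P G W"
    by (auto simp: is_pseudoinverse_mres)
  show ?thesis
    by (rule theI[where P="is_pseudoinverse P G", OF W]) (rule pseudoinverse_unique[OF G], simp_all add: is_pseudoinverse_mres W)
qed

text \<open>The product of \<open>G\<close> and its pseudoinverse is the orthogonal projection onto the range of \<open>G\<close>, which is
the orthogonal complement of its kernel.\<close>

lemma pseudoinverse_projects:
  assumes P: "finite P" and sym: "\<And>a b. a \<in> P \<Longrightarrow> b \<in> P \<Longrightarrow> G a b = G b a"
    and W: "is_pseudoinverse P G W"
    and orth: "\<And>y. (\<And>a. a \<in> P \<Longrightarrow> (\<Sum>c\<in>P. G a c * y c) = 0) \<Longrightarrow> (\<Sum>a\<in>P. y a * t a) = 0"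
    and a: "a \<in> P"
  shows "(\<Sum>c\<in>P. G a c * (\<Sum>b\<in>P. W c b * t b)) = t a"
proof -
  define H where "H = mres P G"
  have HH: "mres P H = H" by (simp add: H_def mres_def fun_eq_iff)
  have Hsym: "mtr H = H" using sym by (auto simp: H_def mtr_def mres_def fun_eq_iff)
  have HG: "H a b = G a b" if "a \<in> P" "b \<in> P" for a b using that by (simp add: H_def mres_def)
  have W': "is_pseudoinverse P H W" using W by (simp add: H_def is_pseudoinverse_mres)
  note Wf = W'[unfolded is_pseudoinverse_alt[OF HH]]
  define Q where "Q = mm P H W"
  have QH: "mm P Q H = H" and Qsym: "mtr Q = Q" using Wf by (simp_all add: Q_def)
  have HQ: "mm P H Q = H" using arg_cong[OF QH, of mtr] by (simp add: mtr_mm Qsym Hsym)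
  have QQ: "mm P Q Q = Q" using Wf unfolding Q_def by (simp only: mm_assoc[symmetric])
  have mv_mm: "mv P A (mv P B v) = mv P (mm P A B) v" for A B v
  proof
    fix a
    have "(\<Sum>c\<in>P. A a c * (\<Sum>d\<in>P. B c d * v d)) = (\<Sum>c\<in>P. \<Sum>d\<in>P. A a c * B c d * v d)"
      by (simp add: sum_distrib_left mult.assoc)
    also have "\<dots> = (\<Sum>d\<in>P. \<Sum>c\<in>P. A a c * B c d * v d)" by (rule sum.swap)
    also have "\<dots> = (\<Sum>d\<in>P. (\<Sum>c\<in>P. A a c * B c d) * v d)" by (simp add: sum_distrib_right)
    finally show "mv P A (mv P B v) a = mv P (mm P A B) v a" by (simp add: mv_def mm_def cong: sum.cong)
  qed
  have qsym: "Q a b = Q b a" for a b using fun_cong[OF fun_cong[OF Qsym], of a b] by (simp add: mtr_def)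
  define y where "y a = (- 1) * mv P Q t a + t a" for a
  have "mv P H y = (\<lambda>_. 0)"
    unfolding y_def mv_linear mv_mm HQ by simp
  note Hy = this
  have "(\<Sum>c\<in>P. G a c * y c) = 0" if "a \<in> P" for a
    using that fun_cong[OF Hy, of a] by (simp add: mv_def HG cong: sum.cong)
  then have yt: "vdot P y t = 0" unfolding vdot_def by (rule orth)
  have Qy: "mv P Q y = (\<lambda>_. 0)"
    unfolding y_def mv_linear mv_mm QQ by simp
  have "vdot P y y = vdot P y t - vdot P y (mv P Q t)"
    unfolding vdot_def sum_subtractf[symmetric] by (rule sum.cong) (simp_all add: y_def algebra_simps)
  also have "vdot P y (mv P Q t) = vdot P (mv P Q y) t" by (rule vdot_mv_sym[symmetric, OF qsym])
  also have "\<dots> = 0" by (simp add: Qy vdot_def)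
  finally have "\<forall>a\<in>P. y a = 0" using yt vdot_self_eq_0[OF P, of y] by simp
  then have "mv P Q t a = t a" using a by (simp add: y_def)
  then show ?thesis unfolding Q_def mv_mm[symmetric] using a
    by (simp add: mv_def HG cong: sum.cong)
qed

section \<open>Pairing tensors and their Gram matrix\<close>

lemma delta_pm: "k \<in> pm n \<Longrightarrow> delta n k = - k" by (simp add: delta_def)
lemma uminus_pm [simp]: "- k \<in> pm n \<longleftrightarrow> k \<in> pm n" by (auto simp: pm_def)
lemma delta_delta [simp]: "delta n (delta n k) = k" by (simp add: delta_def)
lemma pm_split: "pm n = {1..int n} \<union> uminus ` {1..int n}" "{1..int n} \<inter> uminus ` {1..int n} = {}"
  by (auto simp: pm_def image_iff)
lemma finite_pm [simp]: "finite (pm n)" unfolding pm_split by simp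
lemmas permutation_pm = permutes_imp_permutation[OF finite_pm]
lemma card_pm: "card (pm n) = 2 * n"
proof -
  have "card (pm n) = card {1..int n} + card (uminus ` {1..int n})"
    unfolding pm_split(1) by (rule card_Un_disjoint) (simp_all add: pm_split(2))
  also have "card (uminus ` {1..int n}) = card {1..int n}" by (rule card_image) simp
  finally show ?thesis by simp
qed

lemma delta_pairing: "delta n \<in> pairings (pm n)"
proof -
  have "delta n permutes pm n"
    by (rule bij_imp_permutes) (auto intro!: bij_betw_byWitness[where f'="delta n"] simp: delta_def)
  then show ?thesis by (auto simp: pairings_def fun_eq_iff delta_def pm_def)
qed

text \<open>A frame for a pairing \<open>p\<close> of \<open>\<plusminus>[n]\<close> transports the pairing \<open>\<delta>\<close> to \<open>p\<close>: it enumerates and orients the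
pairs of \<open>p\<close>, the \<open>k\<close>-th one being \<open>(g k, g (- k))\<close>. In a frame tensor the sign of \<open>g\<close> makes up for
the arbitrary choices, so that each pairing acquires a tensor without any sign ambiguity, exactly as
in the definition of a Pfaffian.\<close>

definition frame :: "nat \<Rightarrow> (int \<Rightarrow> int) \<Rightarrow> (int \<Rightarrow> int) \<Rightarrow> bool" where
  "frame n p g \<longleftrightarrow> g permutes pm n \<and> (\<forall>k\<in>pm n. g (- k) = p (g k))"

lemma frameD: "frame n p g \<Longrightarrow> k \<in> pm n \<Longrightarrow> g (- k) = p (g k)"
  by (simp add: frame_def)

definition frame_tensor :: "nat \<Rightarrow> (int \<Rightarrow> int) \<Rightarrow> (int \<Rightarrow> 'c \<times> bool) \<Rightarrow> real" where
  "frame_tensor n g x = of_int (sign g) * (\<Prod>k\<in>{1..int n}. omega (x (g k)) (x (g (- k))))"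

definition pairing_tensor :: "nat \<Rightarrow> (int \<Rightarrow> int) \<Rightarrow> (int \<Rightarrow> 'c \<times> bool) \<Rightarrow> real" where
  "pairing_tensor n p = frame_tensor n (SOME g. frame n p g)"

lemma sign_flips:
  assumes "finite S" "S \<subseteq> {1..}"
  shows "sign (\<lambda>k::int. if \<bar>k\<bar> \<in> S then - k else k) = (- 1) ^ card S \<and>
    permutation (\<lambda>k::int. if \<bar>k\<bar> \<in> S then - k else k)"
  using assms
proof (induction rule: finite_induct)
  case empty
  have "(\<lambda>k::int. if \<bar>k\<bar> \<in> {} then - k else k) = id" by (simp add: fun_eq_iff)
  then show ?case by (simp only: sign_id permutation_id card.empty power_0 simp_thms)
next
  case (insert a S)
  let ?f = "\<lambda>k::int. if \<bar>k\<bar> \<in> S then - k else k"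
  let ?f' = "\<lambda>k::int. if \<bar>k\<bar> \<in> insert a S then - k else k"
  have IH: "sign ?f = (- 1) ^ card S" "permutation ?f" using insert by auto
  have a: "a \<ge> 1" "a \<noteq> - a" using insert.prems by auto
  have eq: "?f' = Transposition.transpose a (- a) \<circ> ?f"
    using insert.hyps a by (auto simp: fun_eq_iff Transposition.transpose_def)
  have "sign ?f' = sign (Transposition.transpose a (- a)) * sign ?f"
    unfolding eq by (rule sign_compose) (auto simp: permutation_swap_id IH)
  moreover have "permutation ?f'"
    unfolding eq by (rule permutation_compose) (auto simp: permutation_swap_id IH)
  ultimately show ?case using insert.hyps a IH by (simp add: sign_swap_id)
qed

text \<open>A signed permutation of \<open>\<plusminus>[n]\<close> is a product of sign changes, each of which is a transposition, and of a
permutation that acts on \<open>[n]\<close> and \<open>-[n]\<close> in the same way and is therefore even.\<close>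

lemma sign_hyperoctahedral:
  assumes z: "z permutes pm n" and odd: "\<And>k. k \<in> pm n \<Longrightarrow> z (- k) = - z k"
  shows "sign z = (\<Prod>k\<in>{1..int n}. sgn (z k))"
proof -
  define S where "S = {k\<in>{1..int n}. z k < 0}"
  \<comment> \<open>\<open>f\<close> undoes the sign changes of \<open>z\<close>, and \<open>h\<close> is the common action of \<open>z \<circ> f\<close> on both halves\<close>
  define f where "f = (\<lambda>k::int. if \<bar>k\<bar> \<in> S then - k else k)"
  define w where "w = z \<circ> f"
  have S: "finite S" "S \<subseteq> {1..}" unfolding S_def by (rule finite_subset[of _ "{1..int n}"]) auto
  have f: "sign f = (- 1) ^ card S" "permutation f" unfolding f_def using sign_flips[OF S] by auto
  have pz: "permutation z" using z by (rule permutation_pm)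
  have zin: "z k \<in> pm n \<longleftrightarrow> k \<in> pm n" for k by (rule permutes_in_image[OF z])
  have finv: "f (f k) = k" for k by (simp add: f_def)
  have fin: "f k \<in> pm n \<longleftrightarrow> k \<in> pm n" for k by (simp add: f_def)
  have fodd: "f (- k) = - f k" for k by (simp add: f_def)
  have wodd: "w (- k) = - w k" if "k \<in> pm n" for k
    using that by (simp add: w_def fodd odd fin)
  have wpos: "w k > 0" if "k \<in> {1..int n}" for k
  proof -
    have k: "k \<in> pm n" "\<bar>k\<bar> = k" using that by (auto simp: pm_def)
    have "z k \<noteq> 0" using zin[of k] k by (auto simp: pm_def)
    then show ?thesis using that k odd[OF k(1)] by (auto simp: w_def f_def S_def)
  qed
  have w: "w permutes pm n"
  proof -
    have "f permutes pm n"
    proof (rule bij_imp_permutes)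
      show "bij_betw f (pm n) (pm n)"
        by (rule bij_betw_byWitness[where f'=f]) (simp_all add: finv fin image_subset_iff)
      show "f k = k" if "k \<notin> pm n" for k
        using that by (auto simp: f_def S_def pm_def)
    qed
    then show ?thesis unfolding w_def by (rule permutes_compose[OF _ z])
  qed
  define h where "h k = (if k > 0 then w k else k)" for k
  have h: "h permutes pm n"
  proof (rule bij_imp_permutes)
    show "h k = k" if "k \<notin> pm n" for k using that w by (auto simp: h_def permutes_def)
    have "inj_on h (pm n)"
    proof (rule inj_onI)
      fix a b assume ab: "a \<in> pm n" "b \<in> pm n" "h a = h b"
      have hpos: "h c > 0 \<longleftrightarrow> c > 0" if "c \<in> pm n" for c
        using wpos[of c] that by (auto simp: h_def pm_def)
      have "a > 0 \<longleftrightarrow> b > 0" using hpos[OF ab(1)] hpos[OF ab(2)] ab(3) by simp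
      then show "a = b" using ab(3) injD[OF permutes_inj[OF w], of a b] by (cases "a > 0") (simp_all add: h_def)
    qed
    moreover have "h ` pm n \<subseteq> pm n" using permutes_in_image[OF w] by (auto simp: h_def)
    ultimately show "bij_betw h (pm n) (pm n)"
      by (simp add: bij_betw_def endo_inj_surj)
  qed
  have d: "delta n permutes pm n" using delta_pairing by (rule pairingsD)
  have "w k = (h \<circ> (delta n \<circ> (h \<circ> delta n))) k" for k
  proof (cases "k \<in> pm n")
    case True
    have "w k > 0 \<longleftrightarrow> k > 0"
    proof (cases "k > 0")
      case True
      with \<open>k \<in> pm n\<close> show ?thesis using wpos[of k] by (auto simp: pm_def)
    next
      case False
      with \<open>k \<in> pm n\<close> have "w (- k) > 0" by (intro wpos) (auto simp: pm_def)
      then show ?thesis using False wodd[OF True] by simp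
    qed
    moreover have "w (- k) \<in> pm n" using True permutes_in_image[OF w, of "- k"] by simp
    moreover have "k \<noteq> 0" using True by (simp add: pm_def)
    ultimately show ?thesis using True wodd[OF True] by (auto simp: h_def delta_def)
  next
    case False
    then have "w k = k" using w by (simp add: permutes_def)
    then show ?thesis using False by (simp add: h_def delta_def)
  qed
  then have weq: "w = h \<circ> (delta n \<circ> (h \<circ> delta n))" by (rule ext)
  have ph: "permutation h" and pd: "permutation (delta n)"
    using h d by (auto intro: permutation_pm)
  have "sign w = sign h * (sign (delta n) * (sign h * sign (delta n)))"
    unfolding weq by (simp add: sign_compose permutation_compose ph pd)
  also have "\<dots> = 1" by (simp add: mult.left_commute)
  finally have "sign z * sign f = 1" unfolding w_def by (simp add: sign_compose pz f)
  moreover have "sign z = (sign z * sign f) * sign f" by (simp add: mult.assoc)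
  ultimately have "sign z = (- 1) ^ card S" using f by simp
  also have "\<dots> = (\<Prod>k\<in>S. sgn (z k)) * (\<Prod>k\<in>{1..int n} - S. sgn (z k))"
  proof -
    have "(\<Prod>k\<in>S. sgn (z k)) = (\<Prod>k\<in>S. - 1)" by (rule prod.cong) (auto simp: S_def)
    moreover have "(\<Prod>k\<in>{1..int n} - S. sgn (z k)) = 1"
    proof (rule prod.neutral, clarify)
      fix k assume k: "k \<in> {1..int n}" "k \<notin> S"
      then have "z k \<noteq> 0" using zin[of k] by (auto simp: pm_def)
      then show "sgn (z k) = 1" using k by (simp add: S_def)
    qed
    ultimately show ?thesis by simp
  qed
  also have "\<dots> = (\<Prod>k\<in>{1..int n}. sgn (z k))"
    by (subst prod.subset_diff[of S "{1..int n}"]) (auto simp: S_def mult.commute)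
  finally show ?thesis .
qed

text \<open>Two frames for \<open>p\<close> differ by a signed permutation \<open>z\<close>. Exchanging the ends of a pair changes both the
sign of the frame and that of a factor \<open>omega\<close>; permuting the pairs changes neither.\<close>

lemma frame_tensor_cong:
  assumes g: "frame n p g" and g': "frame n p g'"
  shows "frame_tensor n g x = frame_tensor n g' x"
proof -
  have gp: "g permutes pm n" "g' permutes pm n" using g g' by (auto simp: frame_def)
  define z where "z = inv g \<circ> g'"
  have z: "z permutes pm n" unfolding z_def using gp by (intro permutes_compose permutes_inv)
  have gz: "g (z k) = g' k" for k by (simp add: z_def permutes_inverses(1)[OF gp(1)])
  have zin: "z k \<in> pm n \<longleftrightarrow> k \<in> pm n" for k by (rule permutes_in_image[OF z])
  have odd: "z (- k) = - z k" if "k \<in> pm n" for k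
  proof -
    have "g (z (- k)) = p (g (z k))" using g' that by (simp add: gz frame_def)
    also have "\<dots> = g (- z k)" using g that zin[of k] by (simp add: frame_def)
    finally show ?thesis using permutes_inj[OF gp(1)] by (simp add: inj_eq)
  qed
  have "g' = g \<circ> z" using gz by (simp add: fun_eq_iff)
  then have sg: "sign g' = sign g * sign z"
    using gp z by (simp add: sign_compose permutation_pm)
  define t where "t k = omega (x (g k)) (x (g (- k)))" for k
  have t_neg: "t (- k) = - t k" for k by (simp add: t_def omega_swap[of "x (g k)"])
  have "(\<Prod>k\<in>{1..int n}. omega (x (g' k)) (x (g' (- k)))) = (\<Prod>k\<in>{1..int n}. t (z k))"
    unfolding t_def gz[symmetric] by (rule prod.cong) (auto simp: odd pm_def)
  also have "\<dots> = (\<Prod>k\<in>{1..int n}. of_int (sgn (z k)) * t \<bar>z k\<bar>)"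
  proof (rule prod.cong[OF refl])
    fix k assume "k \<in> {1..int n}"
    then have "z k \<noteq> 0" using zin[of k] by (auto simp: pm_def)
    then show "t (z k) = of_int (sgn (z k)) * t \<bar>z k\<bar>"
      using t_neg[of "z k"] by (cases "z k > 0") (auto simp: abs_if)
  qed
  also have "\<dots> = of_int (sign z) * (\<Prod>k\<in>{1..int n}. t \<bar>z k\<bar>)"
    by (simp add: prod.distrib sign_hyperoctahedral[OF z odd])
  also have "(\<Prod>k\<in>{1..int n}. t \<bar>z k\<bar>) = (\<Prod>k\<in>{1..int n}. t k)"
  proof (rule prod.reindex_bij_betw)
    have "inj_on (\<lambda>k. \<bar>z k\<bar>) {1..int n}"
    proof (rule inj_onI)
      fix a b assume ab: "a \<in> {1..int n}" "b \<in> {1..int n}" "\<bar>z a\<bar> = \<bar>z b\<bar>"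
      then have "z a = z b \<or> z a = z (- b)" using odd[of b] by (auto simp: abs_eq_iff pm_def)
      then have "a = b \<or> a = - b" using permutes_inj[OF z] by (auto dest: injD)
      then show "a = b" using ab by auto
    qed
    moreover have "(\<lambda>k. \<bar>z k\<bar>) ` {1..int n} \<subseteq> {1..int n}"
    proof clarify
      fix k assume "k \<in> {1..int n}"
      then have "z k \<in> pm n" using zin[of k] by (auto simp: pm_def)
      then show "\<bar>z k\<bar> \<in> {1..int n}" by (auto simp: pm_def)
    qed
    ultimately show "bij_betw (\<lambda>k. \<bar>z k\<bar>) {1..int n} {1..int n}"
      by (simp add: bij_betw_def endo_inj_surj)
  qed
  finally show ?thesis unfolding frame_tensor_def sg t_def
    by (simp flip: of_int_mult)
qed

lemma frame_exists:
  assumes p: "p \<in> pairings (pm n)" and K: "K \<subseteq> pm n" "p ` K = pm n - K" and b: "bij_betw b {1..int n} K"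
  obtains g where "frame n p g" "\<And>k. k \<in> {1..int n} \<Longrightarrow> g k = b k"
proof -
  note P = pairingsD[OF p]
  define g where "g k = (if k \<in> {1..int n} then b k else if - k \<in> {1..int n} then p (b (- k)) else k)" for k
  have "bij_betw g ({1..int n} \<union> uminus ` {1..int n}) (K \<union> p ` K)"
  proof (rule bij_betw_combine)
    show "bij_betw g {1..int n} K" using b by (rule bij_betw_cong[THEN iffD1, rotated]) (simp add: g_def)
    have "bij_betw (p \<circ> (b \<circ> uminus)) (uminus ` {1..int n}) (p ` K)"
    proof (intro bij_betw_trans)
      show "bij_betw uminus (uminus ` {1..int n}) {1..int n}"
        by (rule bij_betw_byWitness[where f'=uminus]) auto
      show "bij_betw p K (p ` K)" using inj_on_subset[OF P(6)] by (simp add: bij_betw_def)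
    qed (rule b)
    then show "bij_betw g (uminus ` {1..int n}) (p ` K)"
      by (rule bij_betw_cong[THEN iffD1, rotated]) (auto simp: g_def)
    show "K \<inter> p ` K = {}" unfolding K by auto
  qed
  then have "bij_betw g (pm n) (pm n)" using K by (simp only: pm_split(1)[symmetric]) (simp add: Un_absorb1)
  then have "g permutes pm n"
    by (rule bij_imp_permutes) (auto simp: g_def pm_def)
  moreover have "g (- k) = p (g k)" if "k \<in> pm n" for k
    using that by (auto simp: g_def pm_def P(2))
  ultimately have "frame n p g" by (simp add: frame_def)
  then show ?thesis by (rule that) (simp add: g_def)
qed

lemma transversal_card:
  assumes p: "p \<in> pairings (pm n)" and K: "K \<subseteq> pm n" "p ` K = pm n - K"
  shows "card K = n"
proof -
  have "card (p ` K) = card K" by (rule card_image) (rule inj_on_subset[OF pairingsD(6)[OF p] subset_UNIV])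
  moreover have "card (pm n - K) = card (pm n) - card K" by (rule card_Diff_subset[OF finite_subset[OF K(1) finite_pm] K(1)])
  moreover have "card K \<le> card (pm n)" by (rule card_mono[OF finite_pm K(1)])
  ultimately show ?thesis using K(2) by (simp add: card_pm)
qed

lemma transversal_enum:
  assumes p: "p \<in> pairings (pm n)" and K: "K \<subseteq> pm n" "p ` K = pm n - K"
  obtains b where "bij_betw b {1..int n} K"
  using finite_same_card_bij[of "{1..int n}" K] transversal_card[OF assms] K(1) finite_subset[OF K(1)] by auto

lemma pairing_tensor_frame:
  assumes "frame n p g" shows "pairing_tensor n p x = frame_tensor n g x"
  unfolding pairing_tensor_def by (rule frame_tensor_cong[OF someI[of "frame n p" g] assms]) (rule assms)

lemma pairing_tensor_transversal:
  assumes g: "frame n p g" and gK: "g ` {1..int n} = K"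
  shows "pairing_tensor n p x = of_int (sign g) * pair_tensor p K x"
proof -
  have "inj_on g {1..int n}" using g by (auto simp: frame_def dest: permutes_inj_on)
  then have "pair_tensor p K x = (\<Prod>k\<in>{1..int n}. omega (x (g k)) (x (p (g k))))"
    unfolding pair_tensor_def gK[symmetric] by (simp add: prod.reindex)
  also have "\<dots> = (\<Prod>k\<in>{1..int n}. omega (x (g k)) (x (g (- k))))"
    using g by (intro prod.cong) (auto simp: frame_def pm_def)
  finally show ?thesis by (simp add: pairing_tensor_frame[OF g] frame_tensor_def)
qed

text \<open>If frames for \<open>p\<close> and \<open>q\<close> start from the same enumeration of the first elements, they differ by the
restriction of \<open>q \<circ> p\<close> to the complement of \<open>A\<close>, a set of \<open>n\<close> elements in which each block of the join
contributes one orbit.\<close>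

lemma sign_restricted_frames:
  assumes p: "p \<in> pairings (pm n)" and q: "q \<in> pairings (pm n)" and A: "half (pm n) p q A"
    and g: "frame n p g" "g ` {1..int n} = A" and g': "frame n q g'" "\<And>k. k \<in> {1..int n} \<Longrightarrow> g' k = g k"
  shows "sign g' = (- 1) ^ (n + join_blocks (pm n) p q) * sign g"
proof -
  note P = pairingsD[OF p] and Q = pairingsD[OF q]
  let ?J = "pm n"
  note hb = half_basic[OF finite_pm p q A]
  define w where "w = q \<circ> p"
  define h where "h k = (if k \<in> ?J - A then w k else k)" for k
  have wJ: "w permutes ?J" unfolding w_def using P(1) Q(1) by (intro permutes_compose)
  have pre: "w k \<in> A \<longleftrightarrow> k \<in> A" if "k \<in> ?J" for k using hb(6)[OF that] by (simp add: w_def)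
  have wB: "w k \<in> ?J - A" if "k \<in> ?J - A" for k
    using that pre[of k] permutes_in_image[OF wJ, of k] by auto
  have h: "h permutes (?J - A)"
  proof (rule bij_imp_permutes)
    have "inj_on h (?J - A)"
      by (rule inj_onI) (rule injD[OF permutes_inj[OF wJ]], simp add: h_def)
    moreover have "h ` (?J - A) \<subseteq> ?J - A" using wB by (auto simp: h_def)
    ultimately show "bij_betw h (?J - A) (?J - A)" by (simp add: bij_betw_def endo_inj_surj)
  qed (auto simp: h_def)
  have orb: "orbit h x = orbit w x" if x: "x \<in> ?J - A" for x
    by (rule orbit_cong0[OF x]) (use wB in \<open>auto simp: h_def\<close>)
  have "orbit h ` (?J - A) = orbit w ` (?J - A)" by (rule image_cong[OF refl orb])
  then have "sign h = (- 1) ^ (card (?J - A) + num_orbits (?J - A) w)"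
    using sign_eq_num_orbits[OF _ h] by (simp add: num_orbits_def)
  also have "num_orbits (?J - A) w = join_blocks ?J p q"
    unfolding w_def num_orbits_half(2)[OF finite_pm p q A] join_blocks_half[OF finite_pm p q A] ..
  also have "card (?J - A) = n"
    using transversal_card[OF p hb(1,4)] card_Diff_subset[OF hb(2,1)] by (simp add: card_pm)
  finally have sh: "sign h = (- 1) ^ (n + join_blocks ?J p q)" .
  have gp: "g permutes ?J" "g' permutes ?J" using g g' by (auto simp: frame_def)
  have "g' k = h (g k)" for k
  proof -
    have "k \<in> {1..int n} \<or> (- k \<in> {1..int n} \<and> k \<in> ?J) \<or> k \<notin> ?J" by (auto simp: pm_def)
    then consider "k \<in> {1..int n}" | "- k \<in> {1..int n}" "k \<in> ?J" | "k \<notin> ?J" by blast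
    then show ?thesis
    proof cases
      case 1
      then have "g k \<in> A" unfolding g(2)[symmetric] by (rule imageI)
      then show ?thesis using g'(2)[OF 1] by (simp add: h_def)
    next
      case 2
      have gk: "g k = p (g (- k))" "g' k = q (g (- k))"
        using frameD[OF g(1), of "- k"] frameD[OF g'(1), of "- k"] g'(2)[OF 2(1)] 2(2) by simp_all
      have "g (- k) \<in> A" unfolding g(2)[symmetric] using 2(1) by (rule imageI)
      then have "g k \<in> ?J - A" unfolding gk hb(4)[symmetric] by (rule imageI)
      then show ?thesis by (simp add: h_def w_def gk P(2))
    next
      case 3
      then have "g k = k" "g' k = k" using gp by (auto simp: permutes_def)
      then show ?thesis using 3 by (simp add: h_def)
    qed
  qed
  then have "g' = h \<circ> g" by (simp add: fun_eq_iff)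
  moreover have "permutation h" using h by (rule permutes_imp_permutation[rotated]) simp
  moreover have "permutation g" using gp(1) by (rule permutation_pm)
  ultimately show ?thesis by (simp add: sign_compose sh)
qed

text \<open>Such a word is constant along each orbit of \<open>q \<circ> p\<close> in \<open>A\<close> and flipped on the complement of \<open>A\<close>. It
amounts to a free choice of one letter for each block of the join.\<close>

lemma card_alternating_words:
  assumes J: "finite J" and p: "p \<in> pairings J" and q: "q \<in> pairings J" and A: "half J p q A"
  shows "card {x \<in> words J. \<forall>k\<in>A. x (p k) = flip (x k) \<and> x (q k) = (flip (x k) :: 'c::finite \<times> bool)}
    = CARD('c \<times> bool) ^ join_blocks J p q"
proof -
  note P = pairingsD[OF p] and Q = pairingsD[OF q]
  note hb = half_basic[OF J p q A]
  define w where "w = q \<circ> p"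
  have wJ: "w permutes J" unfolding w_def by (rule permutes_compose[OF P(1) Q(1)])
  then have perm: "permutation w" by (rule permutes_imp_permutation[OF J])
  let ?X = "{x \<in> words J. \<forall>k\<in>A. x (p k) = flip (x k) \<and> x (q k) = (flip (x k) :: 'c \<times> bool)}"
  let ?O = "orbit w ` A"
  define F :: "('a set \<Rightarrow> 'c \<times> bool) \<Rightarrow> 'a \<Rightarrow> 'c \<times> bool" where
    "F f k = (if k \<in> A then f (orbit w k) else if k \<in> J then flip (f (orbit w (p k))) else undefined)" for f k
  have "bij_betw F (words ?O) ?X"
  proof (rule bij_betwI')
    fix f f' :: "'a set \<Rightarrow> 'c \<times> bool" assume f: "f \<in> words ?O" "f' \<in> words ?O"
    have "f u = f' u" if "F f = F f'" for u
    proof (cases "u \<in> ?O")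
      case True
      then obtain k where "k \<in> A" "u = orbit w k" by auto
      then show ?thesis using fun_cong[OF that, of k] by (simp add: F_def)
    next
      case False
      then show ?thesis using f by (simp add: PiE_def extensional_def)
    qed
    then show "F f = F f' \<longleftrightarrow> f = f'" by auto
  next
    fix f :: "'a set \<Rightarrow> 'c \<times> bool" assume f: "f \<in> words ?O"
    have "F f \<in> words J" using hb(1) by (auto simp: F_def PiE_def extensional_def)
    moreover have "F f (p k) = flip (F f k) \<and> F f (q k) = flip (F f k)" if k: "k \<in> A" for k
    proof -
      have kJ: "k \<in> J" "p k \<in> J" "q k \<in> J" using k hb(1) P(5) Q(5) by auto
      have "p k \<notin> A" "q k \<notin> A" using hb(7,8)[OF kJ(1)] k by auto
      moreover have "orbit w (p (q k)) = orbit w k"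
        using permutation_orbit_step[OF perm, of "p (q k)"] by (simp add: w_def P(2) Q(2))
      ultimately show ?thesis using k kJ by (simp add: F_def P(2))
    qed
    ultimately show "F f \<in> ?X" by blast
  next
    fix x assume "x \<in> ?X"
    then have x: "x \<in> words J" "\<And>k. k \<in> A \<Longrightarrow> x (p k) = flip (x k)" "\<And>k. k \<in> A \<Longrightarrow> x (q k) = flip (x k)" by auto
    have xw: "x (w k) = x k" if k: "k \<in> A" for k
    proof -
      have kJ: "k \<in> J" using k hb(1) by auto
      have "w k \<in> A" using hb(6)[OF kJ] k by (simp add: w_def)
      then have "x (q (w k)) = flip (x (w k))" by (rule x(3))
      then show ?thesis using x(2)[OF k] by (simp add: w_def Q(2))
    qed
    have const: "x y = x k" if k: "k \<in> A" and y: "y \<in> orbit w k" for k y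
      using y
    proof induct
      case base
      show ?case by (rule xw[OF k])
    next
      case (step y)
      have "y \<in> A" using step(1) hb(3)[OF k] by (auto simp: w_def)
      then show ?case using step xw by simp
    qed
    define f where "f = (\<lambda>u\<in>?O. x (SOME k. k \<in> u))"
    have fo: "f (orbit w k) = x k" if k: "k \<in> A" for k
    proof -
      have "(SOME y. y \<in> orbit w k) \<in> orbit w k"
        by (rule someI) (rule permutation_self_in_orbit[OF perm])
      then show ?thesis using k const[OF k] by (simp add: f_def)
    qed
    have "F f k = x k" for k
    proof -
      consider "k \<in> A" | "k \<in> J - A" | "k \<notin> J" "k \<notin> A" using hb(1) by auto
      then show ?thesis
      proof cases
        case 2
        then have pk: "p k \<in> A" using hb(7)[of k] by auto
        then show ?thesis using 2 x(2)[OF pk] by (simp add: F_def fo P(2))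
      next
        case 3
        then show ?thesis using x(1) by (simp add: F_def PiE_def extensional_def)
      qed (simp add: F_def fo)
    qed
    then have "x = F f" by auto
    moreover have "f \<in> words ?O" by (auto simp: f_def)
    ultimately show "\<exists>f\<in>words ?O. x = F f" by blast
  qed
  then have "card ?X = card (words ?O :: ('a set \<Rightarrow> 'c \<times> bool) set)" by (simp add: bij_betw_same_card)
  also have "\<dots> = CARD('c \<times> bool) ^ card ?O" using hb(2) by (simp add: card_PiE)
  finally show ?thesis
    by (simp add: join_blocks_half[OF J p q A] num_orbits_def w_def)
qed

text \<open>With the colour class \<open>A\<close> as common set of first elements, the values of the two pair tensors agree on
every word where neither is zero, so only the signs of the frames remain, and the number of these
words is \<open>(2N)\<^sup>#\<close>. This is where the factor \<open>-2N\<close> of the symplectic Gram matrix comes from.\<close>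

lemma pairing_tensor_gram:
  assumes p: "p \<in> pairings (pm n)" and q: "q \<in> pairings (pm n)"
  shows "(\<Sum>x\<in>words (pm n). pairing_tensor n p x * pairing_tensor n q (x :: int \<Rightarrow> 'c::finite \<times> bool))
    = Gr CARD('c) (pm n) p q"
proof -
  obtain A where A: "half (pm n) p q A" using half_exists[OF finite_pm p q] by blast
  note hb = half_basic[OF finite_pm p q A]
  obtain b where b: "bij_betw b {1..int n} A" using transversal_enum[OF p hb(1,4)] by blast
  obtain g where g: "frame n p g" "\<And>k. k \<in> {1..int n} \<Longrightarrow> g k = b k"
    using frame_exists[OF p hb(1,4) b] by blast
  obtain g' where g': "frame n q g'" "\<And>k. k \<in> {1..int n} \<Longrightarrow> g' k = b k"
    using frame_exists[OF q hb(1,5) b] by blast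
  have img: "g ` {1..int n} = A" "g' ` {1..int n} = A"
    using b g(2) g'(2) by (auto simp: bij_betw_def)
  let ?m = "join_blocks (pm n) p q"
  have sg: "sign g' = (- 1) ^ (n + ?m) * sign g"
    by (rule sign_restricted_frames[OF p q A g(1) img(1) g'(1)]) (simp add: g g')
  let ?X = "{x \<in> words (pm n). \<forall>k\<in>A. x (p k) = flip (x k) \<and> x (q k) = (flip (x k) :: 'c \<times> bool)}"
  have "pairing_tensor n p x * pairing_tensor n q x
      = (- 1) ^ (n + ?m) * (if \<forall>k\<in>A. x (p k) = flip (x k) \<and> x (q k) = flip (x k) then 1 else 0)"
    for x :: "int \<Rightarrow> 'c \<times> bool"
  proof -
    have "pairing_tensor n p x * pairing_tensor n q x
       = of_int (sign g' * sign g) * (pair_tensor p A x * pair_tensor q A x)"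
      by (simp add: pairing_tensor_transversal[OF g(1) img(1)] pairing_tensor_transversal[OF g'(1) img(2)])
    also have "sign g' * sign g = (- 1) ^ (n + ?m)" by (simp add: sg mult.assoc)
    also have "pair_tensor p A x * pair_tensor q A x
      = (\<Prod>k\<in>A. if x (p k) = flip (x k) \<and> x (q k) = flip (x k) then 1 else 0)"
      unfolding pair_tensor_def prod.distrib[symmetric] by (rule prod.cong) (auto simp: omega_def)
    also have "\<dots> = (if \<forall>k\<in>A. x (p k) = flip (x k) \<and> x (q k) = flip (x k) then 1 else 0)"
      using hb(2) by (auto intro: prod.neutral prod_zero)
    finally show ?thesis by simp
  qed
  then have "(\<Sum>x\<in>words (pm n). pairing_tensor n p x * pairing_tensor n q (x :: int \<Rightarrow> 'c \<times> bool))
    = (- 1) ^ (n + ?m) * (\<Sum>x\<in>words (pm n). if \<forall>k\<in>A. x (p k) = flip (x k) \<and> x (q k) = flip (x k :: 'c \<times> bool) then 1 else 0)"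
    by (simp add: sum_distrib_left)
  also have "(\<Sum>x\<in>words (pm n). if \<forall>k\<in>A. x (p k) = flip (x k) \<and> x (q k) = flip (x k :: 'c \<times> bool) then 1 else 0) = real (card ?X)"
    by (subst sum.inter_filter[symmetric]) (auto simp: finite_PiE)
  also have "\<dots> = (2 * real CARD('c)) ^ ?m"
    unfolding card_alternating_words[OF finite_pm p q A] by (simp add: mult.commute)
  also have "(- 1) ^ (n + ?m) * (2 * real CARD('c)) ^ ?m = Gr CARD('c) (pm n) p q"
  proof -
    have "(- 2 * real CARD('c)) ^ ?m = ((- 1) * (2 * real CARD('c))) ^ ?m" by simp
    also have "\<dots> = (- 1) ^ ?m * (2 * real CARD('c)) ^ ?m" by (rule power_mult_distrib)
    finally show ?thesis by (simp only: Gr_def card_pm power_add mult.assoc) simp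
  qed
  finally show ?thesis .
qed

section \<open>Expansion of invariant tensors by the Weingarten function\<close>

lemma lie_invariant_add_scaled:
  assumes "lie_invariant J T" "lie_invariant J S"
  shows "lie_invariant J (\<lambda>x. T x + r * S x)"
  unfolding lie_invariant_def
proof (intro allI)
  fix x u v
  define D where "D T j = (if x j = u then T (x(j := v)) else 0)
      - (if x j = flip v then spin u * spin v * T (x(j := flip u)) else 0)" for T :: "('a \<Rightarrow> 'b \<times> bool) \<Rightarrow> real" and j
  have D0: "(\<Sum>j\<in>J. D T j) = 0" "(\<Sum>j\<in>J. D S j) = 0"
    using assms unfolding lie_invariant_def D_def by blast+
  have "D (\<lambda>x. T x + r * S x) j = D T j + r * D S j" for j
    by (auto simp: D_def algebra_simps)
  then have "(\<Sum>j\<in>J. D (\<lambda>x. T x + r * S x) j) = (\<Sum>j\<in>J. D T j) + r * (\<Sum>j\<in>J. D S j)"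
    by (simp add: sum.distrib sum_distrib_left)
  then have "(\<Sum>j\<in>J. D (\<lambda>x. T x + r * S x) j) = 0" by (simp add: D0)
  then show "(\<Sum>j\<in>J. (if x j = u then T (x(j := v)) + r * S (x(j := v)) else 0)
      - (if x j = flip v then spin u * spin v * (T (x(j := flip u)) + r * S (x(j := flip u))) else 0)) = 0"
    by (simp only: D_def)
qed

lemma lie_invariant_diff_sum:
  assumes "finite I" "lie_invariant J T" "\<And>i. i \<in> I \<Longrightarrow> lie_invariant J (F i)"
  shows "lie_invariant J (\<lambda>x. T x - (\<Sum>i\<in>I. F i x * c i))"
  using assms(1,3)
proof (induction I rule: finite_induct)
  case (insert i I)
  have "lie_invariant J (\<lambda>x. (T x - (\<Sum>i\<in>I. F i x * c i)) + (- c i) * F i x)"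
    by (rule lie_invariant_add_scaled) (use insert in auto)
  moreover have "(\<lambda>x. (T x - (\<Sum>i\<in>I. F i x * c i)) + (- c i) * F i x) = (\<lambda>x. T x - (\<Sum>i\<in>insert i I. F i x * c i))"
    using insert.hyps by (simp add: fun_eq_iff)
  ultimately show ?case by simp
qed (simp add: assms(2))

lemma finite_pairings: "finite J \<Longrightarrow> finite (pairings J)"
  by (rule finite_subset[OF _ finite_permutations[of J]]) (auto simp: pairings_def)

lemma finite_words: "finite J \<Longrightarrow> finite (words J :: ('a \<Rightarrow> 'i::finite) set)"
  by (rule finite_PiE) auto

lemma pairing_has_transversal:
  assumes p: "p \<in> pairings (pm n)"
  obtains g K where "frame n p g" "g ` {1..int n} = K" "matching_of (pm n) p K"
proof -
  obtain A where A: "half (pm n) p p A" using half_exists[OF finite_pm p p] by blast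
  note hb = half_basic[OF finite_pm p p A]
  obtain b where b: "bij_betw b {1..int n} A" using transversal_enum[OF p hb(1,4)] by blast
  obtain g where g: "frame n p g" "\<And>k. k \<in> {1..int n} \<Longrightarrow> g k = b k"
    using frame_exists[OF p hb(1,4) b] by blast
  show ?thesis
  proof (rule that[OF g(1)])
    show "g ` {1..int n} = A" using b g(2) by (auto simp: bij_betw_def)
    show "matching_of (pm n) p A" using pairingsD[OF p] hb(1,4) by (simp add: matching_of_def)
  qed
qed

lemma pair_tensor_eq_pairing_tensor:
  assumes "matching_of (pm n) p K"
  obtains r :: real where "p \<in> pairings (pm n)"
    "\<And>x :: int \<Rightarrow> 'c \<times> bool. pair_tensor p K x = r * pairing_tensor n p x"
proof -
  have p0: "p permutes pm n" "p \<circ> p = id" "K \<subseteq> pm n" "p ` K = pm n - K"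
    using assms by (auto simp: matching_of_def)
  have "p x \<noteq> x" if "x \<in> pm n" for x
    using involution_swaps_iff[OF p0(4) _ that] p0(2) by (metis comp_apply id_apply)
  then have p: "p \<in> pairings (pm n)" using p0 by (simp add: pairings_def)
  obtain b where b: "bij_betw b {1..int n} K" using transversal_enum[OF p p0(3,4)] by blast
  obtain g where g: "frame n p g" "\<And>k. k \<in> {1..int n} \<Longrightarrow> g k = b k"
    using frame_exists[OF p p0(3,4) b] by blast
  have gK: "g ` {1..int n} = K" using b g(2) by (auto simp: bij_betw_def)
  have "pair_tensor p K x = of_int (sign g) * pairing_tensor n p x" for x :: "int \<Rightarrow> 'c \<times> bool"
    by (simp add: pairing_tensor_transversal[OF g(1) gK] mult.assoc[symmetric] flip: of_int_mult)
  then show ?thesis using p that by blast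
qed

lemma lie_invariant_pairing_tensor:
  assumes p: "p \<in> pairings (pm n)"
  shows "lie_invariant (pm n) (pairing_tensor n p :: (int \<Rightarrow> 'c::finite \<times> bool) \<Rightarrow> real)"
proof -
  obtain g K where g: "frame n p g" "g ` {1..int n} = K" "matching_of (pm n) p K"
    using pairing_has_transversal[OF p] by blast
  have "lie_invariant (pm n) (\<lambda>x :: int \<Rightarrow> 'c \<times> bool. 0 + of_int (sign g) * pair_tensor p K x)"
    by (rule lie_invariant_add_scaled[OF _ lie_invariant_pair_tensor[OF finite_pm g(3)]])
      (unfold lie_invariant_def, intro allI sum.neutral ballI, auto)
  moreover have "(\<lambda>x :: int \<Rightarrow> 'c \<times> bool. 0 + of_int (sign g) * pair_tensor p K x) = pairing_tensor n p"
    by (simp add: fun_eq_iff pairing_tensor_transversal[OF g(1,2)])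
  ultimately show ?thesis by simp
qed

lemma depends_on_pairing_tensor:
  assumes p: "p \<in> pairings (pm n)"
  shows "depends_on (pm n) (pairing_tensor n p :: (int \<Rightarrow> 'c::finite \<times> bool) \<Rightarrow> real)"
proof -
  obtain g K where g: "frame n p g" "g ` {1..int n} = K" "matching_of (pm n) p K"
    using pairing_has_transversal[OF p] by blast
  have "pair_tensor p K x = pair_tensor p K y" if "\<forall>j\<in>pm n. x j = y j" for x y :: "int \<Rightarrow> 'c \<times> bool"
    unfolding pair_tensor_def
  proof (rule prod.cong[OF refl])
    fix k assume "k \<in> K"
    then have "k \<in> pm n" using g(3) by (auto simp: matching_of_def)
    moreover from this have "p k \<in> pm n" using pairingsD(5)[OF p] by simp
    ultimately show "omega (x k) (x (p k)) = omega (y k) (y (p k))" using that by simp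
  qed
  then show ?thesis unfolding depends_on_def pairing_tensor_transversal[OF g(1,2)] by metis
qed

text \<open>The right-hand side is the orthogonal projection of \<open>T\<close> onto the span of the pairing tensors, since
\<open>Wg\<close> is the pseudoinverse of their Gram matrix. Its difference to \<open>T\<close> is invariant and orthogonal to
all pairing tensors. The coefficients \<open>t\<close> of \<open>T\<close> lie in the range of the Gram matrix because a vector
\<open>y\<close> in the kernel is a linear relation between the pairing tensors.\<close>

lemma invariant_tensor_expansion:
  fixes T :: "(int \<Rightarrow> 'c::finite \<times> bool) \<Rightarrow> real"
  assumes inv: "lie_invariant (pm n) T" and dep: "depends_on (pm n) T"
  shows "T x = (\<Sum>p\<in>pairings (pm n). pairing_tensor n p x *
    (\<Sum>q\<in>pairings (pm n). Wg CARD('c) (pm n) p q * (\<Sum>y\<in>words (pm n). pairing_tensor n q y * T y)))"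
proof -
  let ?P = "pairings (pm n)" and ?G = "Gr CARD('c) (pm n)"
  let ?pt = "pairing_tensor n :: _ \<Rightarrow> (int \<Rightarrow> 'c \<times> bool) \<Rightarrow> real"
  have fP: "finite ?P" by (rule finite_pairings[OF finite_pm])
  have G: "?G a b = (\<Sum>y\<in>words (pm n). ?pt a y * ?pt b y)" if "a \<in> ?P" "b \<in> ?P" for a b
    using pairing_tensor_gram[where ?'c='c, OF that] by simp
  have sym: "?G a b = ?G b a" if "a \<in> ?P" "b \<in> ?P" for a b
    using that by (simp add: G mult.commute)
  define W where "W = Wg CARD('c) (pm n)"
  have W: "is_pseudoinverse ?P ?G W" unfolding W_def Wg_def by (rule is_pseudoinverse_The[OF fP sym])
  define t where "t q = (\<Sum>y\<in>words (pm n). ?pt q y * T y)" for q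
  define s where "s p = (\<Sum>q\<in>?P. W p q * t q)" for p
  have proj: "(\<Sum>c\<in>?P. ?G a c * s c) = t a" if a: "a \<in> ?P" for a
    unfolding s_def
  proof (rule pseudoinverse_projects[OF fP sym W _ a])
    fix y assume y: "\<And>a. a \<in> ?P \<Longrightarrow> (\<Sum>c\<in>?P. ?G a c * y c) = 0"
    define v where "v x = (\<Sum>c\<in>?P. y c * ?pt c x)" for x
    have "(\<Sum>x\<in>words (pm n). v x * v x) = (\<Sum>x\<in>words (pm n). \<Sum>a\<in>?P. \<Sum>c\<in>?P. y a * (?pt a x * ?pt c x * y c))"
      by (simp add: v_def sum_product mult_ac)
    also have "\<dots> = (\<Sum>a\<in>?P. \<Sum>c\<in>?P. \<Sum>x\<in>words (pm n). y a * (?pt a x * ?pt c x * y c))"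
      by (subst sum.swap) (intro sum.cong refl sum.swap)
    also have "\<dots> = (\<Sum>a\<in>?P. y a * (\<Sum>c\<in>?P. ?G a c * y c))"
      by (intro sum.cong refl) (simp add: G sum_distrib_left sum_distrib_right)
    also have "\<dots> = 0" by (simp add: y)
    finally have "\<forall>x\<in>words (pm n). v x * v x = 0"
      by (subst (asm) sum_nonneg_eq_0_iff) (auto simp: finite_words)
    then have v0: "v x = 0" if "x \<in> words (pm n)" for x using that by simp
    have "(\<Sum>a\<in>?P. y a * t a) = (\<Sum>x\<in>words (pm n). v x * T x)"
      unfolding t_def v_def sum_distrib_left sum_distrib_right by (subst sum.swap) (simp add: mult_ac)
    then show "(\<Sum>a\<in>?P. y a * t a) = 0" using v0 by simp
  qed
  define D where "D x = T x - (\<Sum>p\<in>?P. ?pt p x * s p)" for x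
  have "D x = 0"
  proof (rule invariant_orthogonal_imp_zero[OF finite_pm])
    show "lie_invariant (pm n) D" unfolding D_def
      by (rule lie_invariant_diff_sum[OF fP inv]) (rule lie_invariant_pairing_tensor)
    show "depends_on (pm n) D" unfolding depends_on_def D_def
    proof (intro allI impI)
      fix x y :: "int \<Rightarrow> 'c \<times> bool" assume xy: "\<forall>j\<in>pm n. x j = y j"
      have "T x = T y" using dep xy by (simp add: depends_on_def)
      moreover have "?pt p x = ?pt p y" if "p \<in> ?P" for p
        using depends_on_pairing_tensor[where ?'c='c, OF that] xy by (simp add: depends_on_def)
      ultimately show "T x - (\<Sum>p\<in>?P. ?pt p x * s p) = T y - (\<Sum>p\<in>?P. ?pt p y * s p)" by simp
    qed
    fix p K assume pK: "matching_of (pm n) p K"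
    obtain r :: real where p: "p \<in> ?P" and r: "\<And>x :: int \<Rightarrow> 'c \<times> bool. pair_tensor p K x = r * ?pt p x"
      using pair_tensor_eq_pairing_tensor[OF pK] by metis
    have "(\<Sum>x\<in>words (pm n). ?pt p x * D x)
      = t p - (\<Sum>x\<in>words (pm n). \<Sum>c\<in>?P. ?pt p x * ?pt c x * s c)"
      by (simp add: D_def right_diff_distrib sum_subtractf t_def sum_distrib_left mult.assoc)
    also have "(\<Sum>x\<in>words (pm n). \<Sum>c\<in>?P. ?pt p x * ?pt c x * s c) = (\<Sum>c\<in>?P. ?G p c * s c)"
      by (subst sum.swap) (intro sum.cong refl, simp add: G p sum_distrib_right)
    also have "\<dots> = t p" by (rule proj[OF p])
    finally show "(\<Sum>x\<in>words (pm n). pair_tensor p K x * D x) = 0"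
      unfolding r mult.assoc sum_distrib_left[symmetric] by simp
  qed
  then show ?thesis unfolding D_def s_def t_def W_def by simp
qed

lemma complex_invariant_expansion:
  fixes T :: "(int \<Rightarrow> 'c::finite \<times> bool) \<Rightarrow> complex"
  assumes "lie_invariant (pm n) (\<lambda>x. Re (T x))" "lie_invariant (pm n) (\<lambda>x. Im (T x))" and dep: "depends_on (pm n) T"
  shows "T x = (\<Sum>p\<in>pairings (pm n). of_real (pairing_tensor n p x) *
    (\<Sum>q\<in>pairings (pm n). of_real (Wg CARD('c) (pm n) p q) * (\<Sum>y\<in>words (pm n). of_real (pairing_tensor n q y) * T y)))"
proof (rule complex_eqI)
  have dep': "depends_on (pm n) (\<lambda>x. Re (T x))" "depends_on (pm n) (\<lambda>x. Im (T x))"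
    using dep unfolding depends_on_def by metis+
  show "Re (T x) = Re (\<Sum>p\<in>pairings (pm n). of_real (pairing_tensor n p x) *
    (\<Sum>q\<in>pairings (pm n). of_real (Wg CARD('c) (pm n) p q) * (\<Sum>y\<in>words (pm n). of_real (pairing_tensor n q y) * T y)))"
    by (subst invariant_tensor_expansion[OF assms(1) dep'(1)]) (simp add: Re_sum)
  show "Im (T x) = Im (\<Sum>p\<in>pairings (pm n). of_real (pairing_tensor n p x) *
    (\<Sum>q\<in>pairings (pm n). of_real (Wg CARD('c) (pm n) p q) * (\<Sum>y\<in>words (pm n). of_real (pairing_tensor n q y) * T y)))"
    by (subst invariant_tensor_expansion[OF assms(2) dep'(2)]) (simp add: Im_sum)
qed

section \<open>Premaps as pairings\<close>

lemma PM_D: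
  assumes "\<alpha> \<in> PM n"
  shows "\<alpha> permutes pm n" "delta n (\<alpha> (delta n k)) = inv \<alpha> k" "k \<in> pm n \<Longrightarrow> - k \<notin> orbit \<alpha> k"
    "\<alpha> k \<in> pm n \<longleftrightarrow> k \<in> pm n" "permutation \<alpha>"
proof -
  show a: "\<alpha> permutes pm n" "k \<in> pm n \<Longrightarrow> - k \<notin> orbit \<alpha> k" using assms by (auto simp: PM_def)
  have "(delta n \<circ> \<alpha> \<circ> delta n) k = inv \<alpha> k" using assms by (simp only: PM_def mem_Collect_eq)
  then show "delta n (\<alpha> (delta n k)) = inv \<alpha> k" by simp
  show "\<alpha> k \<in> pm n \<longleftrightarrow> k \<in> pm n" by (rule permutes_in_image[OF a(1)])
  show "permutation \<alpha>" by (rule permutation_pm[OF a(1)])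
qed

lemma delta_comp_delta [simp]: "delta n \<circ> (delta n \<circ> p) = p" by (simp add: fun_eq_iff)

lemma PM_pairing:
  assumes "\<alpha> \<in> PM n" shows "delta n \<circ> \<alpha> \<in> pairings (pm n)"
proof -
  note A = PM_D[OF assms]
  have "(delta n \<circ> \<alpha>) permutes pm n"
    by (rule permutes_compose[OF A(1)]) (rule pairingsD(1)[OF delta_pairing])
  moreover have "(delta n \<circ> \<alpha>) \<circ> (delta n \<circ> \<alpha>) = id"
    by (rule ext) (simp add: A(2) permutes_inverses(2)[OF A(1)])
  moreover have "(delta n \<circ> \<alpha>) k \<noteq> k" if k: "k \<in> pm n" for k
  proof
    assume "(delta n \<circ> \<alpha>) k = k"
    then have "\<alpha> k = - k" using A(4)[of k] k by (simp add: delta_pm)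
    then show False using A(3)[OF k] orbit.base[of \<alpha> k] by simp
  qed
  ultimately show ?thesis by (simp add: pairings_def)
qed

lemma pairing_PM:
  assumes p: "p \<in> pairings (pm n)" shows "delta n \<circ> p \<in> PM n"
proof -
  note P = pairingsD[OF p] and D = pairingsD[OF delta_pairing]
  have perm: "(delta n \<circ> p) permutes pm n" by (rule permutes_compose[OF P(1) D(1)])
  have inv: "inv (delta n \<circ> p) = p \<circ> delta n"
    by (rule inv_unique_comp) (simp_all add: fun_eq_iff P(2))
  have "- k \<notin> orbit (delta n \<circ> p) k" if k: "k \<in> pm n" for k
    using partner_notin_orbit[OF delta_pairing p k] orbit_inv_eq[OF permutation_pm[OF perm], of k]
    by (simp add: inv delta_pm k)
  moreover have "delta n \<circ> (delta n \<circ> p) \<circ> delta n = inv (delta n \<circ> p)" by (simp add: inv)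
  ultimately show ?thesis using perm by (simp add: PM_def)
qed

lemma bij_PM_pairings: "bij_betw (\<lambda>\<alpha>. delta n \<circ> \<alpha>) (PM n) (pairings (pm n))"
  by (rule bij_betw_byWitness[where f'="\<lambda>p. delta n \<circ> p"]) (auto simp: PM_pairing pairing_PM)

lemma inv_PM:
  assumes "\<alpha> \<in> PM n" shows "inv \<alpha> \<in> PM n" "inv \<alpha> = (delta n \<circ> \<alpha>) \<circ> delta n" "inv (inv \<alpha>) = \<alpha>"
    "delta n \<circ> inv \<alpha> = \<alpha> \<circ> delta n"
proof -
  note A = PM_D[OF assms] and P = pairingsD[OF PM_pairing[OF assms]] and D = pairingsD[OF delta_pairing]
  show i: "inv \<alpha> = (delta n \<circ> \<alpha>) \<circ> delta n" by (rule ext) (simp add: A(2))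
  show ii: "inv (inv \<alpha>) = \<alpha>" by (rule permutes_inv_inv[OF A(1)])
  show "delta n \<circ> inv \<alpha> = \<alpha> \<circ> delta n" unfolding i by (simp add: fun_eq_iff)
  have "inv \<alpha> permutes pm n" by (rule permutes_inv[OF A(1)])
  moreover have "delta n \<circ> inv \<alpha> \<circ> delta n = inv (inv \<alpha>)" unfolding ii by (rule ext) (simp add: A(2)[symmetric])
  moreover have "- k \<notin> orbit (inv \<alpha>) k" if "k \<in> pm n" for k
    using A(3)[OF that] by (simp add: orbit_inv_eq[OF A(5)])
  ultimately show "inv \<alpha> \<in> PM n" by (simp add: PM_def)
qed

lemma bij_inv_PM: "bij_betw inv (PM n) (PM n)"
  by (rule bij_betw_byWitness[where f'=inv]) (auto simp: inv_PM(1,3))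

text \<open>No cycle of a premap contains two elements of the same absolute value, so each cycle has a unique
element of least absolute value; the cycle of \<open>- k\<close> consists of the negatives of the cycle of \<open>k\<close>.\<close>

lemma FD_facts:
  assumes "\<alpha> \<in> PM n"
  shows FD_sub: "FD n \<alpha> \<subseteq> pm n" and FD_image: "\<alpha> k \<in> FD n \<alpha> \<longleftrightarrow> k \<in> FD n \<alpha>"
    and FD_neg: "k \<in> pm n \<Longrightarrow> - k \<in> FD n \<alpha> \<longleftrightarrow> k \<notin> FD n \<alpha>"
proof -
  note A = PM_D[OF assms]
  show "FD n \<alpha> \<subseteq> pm n" by (auto simp: FD_def)
  show "\<alpha> k \<in> FD n \<alpha> \<longleftrightarrow> k \<in> FD n \<alpha>"
    by (simp add: FD_def permutation_orbit_step[OF A(5)] A(4))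
  show "- k \<in> FD n \<alpha> \<longleftrightarrow> k \<notin> FD n \<alpha>" if k: "k \<in> pm n"
  proof -
    let ?O = "orbit \<alpha> k"
    have sub: "?O \<subseteq> pm n" by (rule permutes_orbit_subset[OF A(1) k])
    have "finite ?O" by (rule finite_subset[OF sub finite_pm])
    then have "finite (abs ` ?O)" "abs ` ?O \<noteq> {}" using orbit_nonempty[of \<alpha> k] by auto
    then have "Min (abs ` ?O) \<in> abs ` ?O" "\<forall>j\<in>?O. Min (abs ` ?O) \<le> \<bar>j\<bar>" by (auto intro: Min_in)
    then obtain m where m: "m \<in> ?O" "\<And>j. j \<in> ?O \<Longrightarrow> \<bar>m\<bar> \<le> \<bar>j\<bar>" by auto
    have neg_m: "- m \<notin> ?O"
      using A(3)[of m] m(1) sub orbit_eq_of_mem[OF A(5) m(1)] by auto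
    have orb: "orbit \<alpha> (- k) = uminus ` ?O"
    proof -
      have "orbit ((delta n \<circ> \<alpha>) \<circ> delta n) (delta n k) = delta n ` orbit ((delta n \<circ> \<alpha>) \<circ> delta n) k"
        by (rule orbit_partner[OF finite_pm delta_pairing PM_pairing[OF assms]])
      then have "orbit \<alpha> (delta n k) = delta n ` ?O"
        by (simp only: inv_PM(2)[OF assms, symmetric] orbit_inv_eq[OF A(5)])
      also have "\<dots> = uminus ` ?O" using sub by (intro image_cong) (auto simp: delta_pm)
      finally show ?thesis by (simp add: delta_pm k)
    qed
    have fd: "- k \<in> FD n \<alpha> \<longleftrightarrow> - k \<in> pm n \<and> (\<exists>m'\<in>uminus ` ?O. m' > 0 \<and> (\<forall>j\<in>uminus ` ?O. \<bar>m'\<bar> \<le> \<bar>j\<bar>))"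
      by (simp only: FD_def mem_Collect_eq orb)
    have "k \<in> FD n \<alpha> \<longleftrightarrow> m > 0"
    proof
      assume "k \<in> FD n \<alpha>"
      then obtain m' where m': "m' \<in> ?O" "m' > 0" "\<And>j. j \<in> ?O \<Longrightarrow> \<bar>m'\<bar> \<le> \<bar>j\<bar>" by (auto simp: FD_def)
      have "\<bar>m'\<bar> = \<bar>m\<bar>" using m(2)[OF m'(1)] m'(3)[OF m(1)] by simp
      then have "m = m' \<or> m' = - m" by linarith
      then show "m > 0" using m' neg_m by auto
    qed (use m k in \<open>auto simp: FD_def\<close>)
    moreover have "- k \<in> FD n \<alpha> \<longleftrightarrow> m < 0"
    proof
      assume "- k \<in> FD n \<alpha>"
      then obtain m' where m': "m' \<in> uminus ` ?O" "m' > 0" "\<And>j. j \<in> uminus ` ?O \<Longrightarrow> \<bar>m'\<bar> \<le> \<bar>j\<bar>"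
        unfolding fd by blast
      then obtain l where l: "l \<in> ?O" "m' = - l" by auto
      have "\<bar>m'\<bar> \<le> \<bar>- m\<bar>" by (rule m'(3)) (rule imageI[OF m(1)])
      then have "\<bar>l\<bar> = \<bar>m\<bar>" using m(2)[OF l(1)] l(2) by simp
      then have "m = l \<or> l = - m" by linarith
      then show "m < 0" using l m' neg_m by auto
    next
      assume "m < 0"
      moreover have "- m \<in> uminus ` ?O" using m(1) by (rule imageI)
      moreover have "\<forall>j\<in>uminus ` ?O. \<bar>- m\<bar> \<le> \<bar>j\<bar>" using m(2) by auto
      ultimately show "- k \<in> FD n \<alpha>" unfolding fd using k by (intro conjI bexI[of _ "- m"]) simp_all
    qed
    moreover have "m \<noteq> 0" using m(1) sub by (auto simp: pm_def)
    ultimately show ?thesis by linarith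
  qed
qed

lemma FD_delta:
  assumes "\<alpha> \<in> PM n" shows "delta n ` FD n \<alpha> = pm n - FD n \<alpha>"
proof (intro equalityI subsetI)
  fix y assume "y \<in> delta n ` FD n \<alpha>"
  then obtain k where "k \<in> FD n \<alpha>" "y = delta n k" by auto
  moreover from this have "k \<in> pm n" using FD_sub[OF assms] by auto
  ultimately show "y \<in> pm n - FD n \<alpha>" using FD_neg[OF assms, of k] by (simp add: delta_pm)
next
  fix y assume "y \<in> pm n - FD n \<alpha>"
  then have "- y \<in> FD n \<alpha>" "y = delta n (- y)" using FD_neg[OF assms, of y] by (simp_all add: delta_pm)
  then show "y \<in> delta n ` FD n \<alpha>" by (rule rev_image_eqI)
qed

lemma FD_permutes:
  assumes "\<alpha> \<in> PM n" shows "\<alpha> ` FD n \<alpha> = FD n \<alpha>"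
proof (rule endo_inj_surj)
  show "finite (FD n \<alpha>)" by (rule finite_subset[OF FD_sub[OF assms] finite_pm])
  show "\<alpha> ` FD n \<alpha> \<subseteq> FD n \<alpha>" using FD_image[OF assms] by auto
  show "inj_on \<alpha> (FD n \<alpha>)" by (rule permutes_inj_on[OF PM_D(1)[OF assms]])
qed

lemma half_FD:
  assumes "\<alpha> \<in> PM n"
  shows "half (pm n) (delta n \<circ> \<alpha>) (delta n) (FD n \<alpha>)" "half (pm n) (delta n) (delta n \<circ> \<alpha>) (FD n \<alpha>)"
proof -
  note A = PM_D[OF assms]
  have "(delta n \<circ> \<alpha>) ` FD n \<alpha> = pm n - FD n \<alpha>"
    by (simp only: image_comp[symmetric] FD_permutes[OF assms] FD_delta[OF assms])
  then show "half (pm n) (delta n \<circ> \<alpha>) (delta n) (FD n \<alpha>)"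
    using FD_sub[OF assms] FD_permutes[OF assms] by (simp add: half_def)
  have "inv \<alpha> ` FD n \<alpha> = inv \<alpha> ` \<alpha> ` FD n \<alpha>" by (simp only: FD_permutes[OF assms])
  also have "\<dots> = FD n \<alpha>" by (simp add: image_image permutes_inverses(2)[OF A(1)])
  finally show "half (pm n) (delta n) (delta n \<circ> \<alpha>) (FD n \<alpha>)"
    using FD_sub[OF assms] by (simp add: half_def inv_PM(2)[OF assms, symmetric] FD_delta[OF assms])
qed

lemma num_orbits_FD:
  assumes "\<alpha> \<in> PM n"
  shows "num_orbits (FD n \<alpha>) \<alpha> = num_orbits (pm n) \<alpha> div 2"
    "join_blocks (pm n) (delta n) (delta n \<circ> \<alpha>) = num_orbits (pm n) \<alpha> div 2"
    "even (num_orbits (pm n) \<alpha>)"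
proof -
  note A = PM_D[OF assms]
  have "num_orbits (pm n) \<alpha> = 2 * num_orbits (FD n \<alpha>) \<alpha>"
    using num_orbits_half(1)[OF finite_pm PM_pairing[OF assms] delta_pairing half_FD(1)[OF assms]] by simp
  then show 1: "num_orbits (FD n \<alpha>) \<alpha> = num_orbits (pm n) \<alpha> div 2" "even (num_orbits (pm n) \<alpha>)" by simp_all
  have "join_blocks (pm n) (delta n) (delta n \<circ> \<alpha>) = num_orbits (FD n \<alpha>) (inv \<alpha>)"
    unfolding inv_PM(2)[OF assms]
    by (rule join_blocks_half[OF finite_pm delta_pairing PM_pairing[OF assms] half_FD(2)[OF assms]])
  also have "\<dots> = num_orbits (FD n \<alpha>) \<alpha>" unfolding num_orbits_def orbit_inv_eq[OF A(5), abs_def]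
    by (intro arg_cong[where f=card] image_cong refl orbit_inv_eq[OF A(5)])
  finally show "join_blocks (pm n) (delta n) (delta n \<circ> \<alpha>) = num_orbits (pm n) \<alpha> div 2" by (simp add: 1)
qed

text \<open>With \<open>p = \<delta>\<alpha>\<close> and \<open>q = \<delta>\<pi>\<^sup>-\<^sup>1\<close> one has \<open>p q = \<alpha>\<^sup>-\<^sup>1\<pi>\<^sup>-\<^sup>1\<close>, the inverse of \<open>q p\<close>.\<close>

lemma join_blocks_PM:
  assumes "\<alpha> \<in> PM n" "\<pi> \<in> PM n"
  shows "join_blocks (pm n) (delta n \<circ> \<alpha>) (delta n \<circ> inv \<pi>) = num_orbits (pm n) (inv \<alpha> \<circ> inv \<pi>) div 2"
proof -
  note A = PM_D[OF assms(1)] and B = PM_D[OF assms(2)]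
  let ?p = "delta n \<circ> \<alpha>" and ?q = "delta n \<circ> inv \<pi>"
  have p: "?p \<in> pairings (pm n)" by (rule PM_pairing[OF assms(1)])
  have q: "?q \<in> pairings (pm n)" by (rule PM_pairing[OF inv_PM(1)[OF assms(2)]])
  obtain A where A': "half (pm n) ?p ?q A" using half_exists[OF finite_pm p q] by blast
  have "inv (?q \<circ> ?p) = ?p \<circ> ?q"
    by (rule inv_unique_comp) (simp_all only: fun_eq_iff comp_apply[of ?q] comp_apply[of ?p] pairingsD(2)[OF p, unfolded comp_apply] pairingsD(2)[OF q, unfolded comp_apply] id_apply comp_apply, simp_all)
  also have "?p \<circ> ?q = inv \<alpha> \<circ> inv \<pi>"
    unfolding inv_PM(2)[OF assms(1)] by (simp add: comp_assoc)
  finally have i: "inv (?q \<circ> ?p) = inv \<alpha> \<circ> inv \<pi>" .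
  have perm: "permutation (?q \<circ> ?p)"
    by (rule permutation_pm) (rule permutes_compose[OF pairingsD(1)[OF p] pairingsD(1)[OF q]])
  have "num_orbits (pm n) (inv \<alpha> \<circ> inv \<pi>) = num_orbits (pm n) (?q \<circ> ?p)"
    unfolding i[symmetric] num_orbits_def
    by (intro arg_cong[where f=card] image_cong refl orbit_inv_eq[OF perm])
  then show ?thesis
    using num_orbits_half(1)[OF finite_pm p q A'] join_blocks_half[OF finite_pm p q A'] by simp
qed

text \<open>The set \<open>FD(\<alpha>)\<close> is a colour class for \<open>\<delta>\<close> and \<open>\<delta>\<alpha>\<close>. A frame for \<open>\<delta>\<close> that takes \<open>[n]\<close> to \<open>FD(\<alpha>)\<close> just
changes the signs of the numbers whose negatives lie in \<open>FD(\<alpha>)\<close>, and \<open>sign_restricted_frames\<close> compares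
it with a frame for \<open>\<delta>\<alpha>\<close>.\<close>

lemma pairing_tensor_FD:
  assumes "\<alpha> \<in> PM n"
  shows "pairing_tensor n (delta n \<circ> \<alpha>) x = (- 1) ^ (n + num_orbits (pm n) \<alpha> div 2 + card {k\<in>{1..int n}. - k \<in> FD n \<alpha>})
    * pair_tensor (delta n \<circ> \<alpha>) (FD n \<alpha>) x"
proof -
  note A = PM_D[OF assms] and p = PM_pairing[OF assms]
  let ?S = "{k\<in>{1..int n}. - k \<in> FD n \<alpha>}"
  note hb = half_basic[OF finite_pm delta_pairing p half_FD(2)[OF assms]]
  define b where "b k = (if k \<in> FD n \<alpha> then k else - k)" for k
  have b: "bij_betw b {1..int n} (FD n \<alpha>)"
  proof (rule bij_betw_byWitness[where f'=abs])
    show "\<forall>a\<in>{1..int n}. \<bar>b a\<bar> = a" by (auto simp: b_def)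
    show "b ` {1..int n} \<subseteq> FD n \<alpha>" using FD_neg[OF assms] by (auto simp: b_def pm_def)
    show "\<forall>a\<in>FD n \<alpha>. b \<bar>a\<bar> = a"
    proof
      fix a assume a: "a \<in> FD n \<alpha>"
      then have "a \<in> pm n" using FD_sub[OF assms] by auto
      then show "b \<bar>a\<bar> = a" using a FD_neg[OF assms, of a] by (cases "a > 0") (auto simp: b_def)
    qed
    show "abs ` FD n \<alpha> \<subseteq> {1..int n}" using FD_sub[OF assms] by (auto simp: pm_def)
  qed
  obtain g where g: "frame n (delta n) g" "\<And>k. k \<in> {1..int n} \<Longrightarrow> g k = b k"
    using frame_exists[OF delta_pairing hb(1,4) b] by blast
  obtain g' where g': "frame n (delta n \<circ> \<alpha>) g'" "\<And>k. k \<in> {1..int n} \<Longrightarrow> g' k = b k"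
    using frame_exists[OF p hb(1,5) b] by blast
  have img: "g ` {1..int n} = FD n \<alpha>" "g' ` {1..int n} = FD n \<alpha>"
    using b g(2) g'(2) by (auto simp: bij_betw_def)
  have sg': "sign g' = (- 1) ^ (n + num_orbits (pm n) \<alpha> div 2) * sign g"
    unfolding num_orbits_FD(2)[OF assms, symmetric]
    by (rule sign_restricted_frames[OF delta_pairing p half_FD(2)[OF assms] g(1) img(1) g'(1)]) (simp add: g g')
  have fS: "finite ?S" by (rule finite_subset[of _ "{1..int n}"]) auto
  have S1: "?S \<subseteq> {1..}" by auto
  have gpm: "g permutes pm n" using g(1) by (simp add: frame_def)
  have gpos: "g k = (if k \<in> ?S then - k else k)" if "k \<in> {1..int n}" for k
  proof -
    have "k \<in> pm n" using that by (auto simp: pm_def)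
    then show ?thesis using g(2)[OF that] that FD_neg[OF assms, of k] by (simp add: b_def)
  qed
  have "g k = (if \<bar>k\<bar> \<in> ?S then - k else k)" for k
  proof -
    have "k \<in> {1..int n} \<or> (- k \<in> {1..int n} \<and> - k \<in> pm n) \<or> k \<notin> pm n" by (auto simp: pm_def)
    then consider "k \<in> {1..int n}" | "- k \<in> {1..int n}" "- k \<in> pm n" | "k \<notin> pm n" by blast
    then show ?thesis
    proof cases
      case 1
      then show ?thesis using gpos[OF 1] by simp
    next
      case 2
      have "g (- k) \<in> pm n" using permutes_in_image[OF gpm, of "- k"] 2 by simp
      then have "g k = - g (- k)" using frameD[OF g(1) 2(2)] by (simp add: delta_pm)
      moreover have "\<bar>k\<bar> = - k" using 2(1) by simp
      ultimately show ?thesis using gpos[OF 2(1)] by simp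
    next
      case 3
      then have "g k = k" using gpm by (simp add: permutes_def)
      moreover have "\<bar>k\<bar> \<notin> ?S" using 3 by (auto simp: pm_def)
      ultimately show ?thesis by (simp only: if_False)
    qed
  qed
  then have "g = (\<lambda>k. if \<bar>k\<bar> \<in> ?S then - k else k)" by (rule ext)
  then have "sign g = (- 1) ^ card ?S" using sign_flips[OF fS S1] by (simp only:)
  then show ?thesis using pairing_tensor_transversal[OF g'(1) img(2), of x] by (simp add: sg' power_add)
qed

lemma eq_flip_iff: "v = flip u \<longleftrightarrow> fst v = fst u \<and> spin v = - spin u"
  by (auto simp: flip_def spin_def prod_eq_iff)

lemma prod_pos_spin:
  assumes "\<alpha> \<in> PM n"
  shows "(\<Prod>k\<in>{1..int n}. e (- k)) * (\<Prod>k\<in>FD n \<alpha>. e (- k) :: real)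
    = (\<Prod>k\<in>{k\<in>{1..int n}. - k \<in> FD n \<alpha>}. e k * e (- k)) * (\<Prod>k\<in>{k\<in>{1..int n}. k \<in> FD n \<alpha>}. e (- k) * e (- k))"
proof -
  let ?N = "{k\<in>{1..int n}. - k \<in> FD n \<alpha>}" and ?Q = "{k\<in>{1..int n}. k \<in> FD n \<alpha>}"
  have fin: "finite ?N" "finite ?Q" by (rule finite_subset[of _ "{1..int n}"]; auto)+
  have mem: "- k \<in> FD n \<alpha> \<longleftrightarrow> k \<notin> FD n \<alpha>" if "k \<in> {1..int n}" for k
    by (rule FD_neg[OF assms]) (use that in \<open>auto simp: pm_def\<close>)
  have pos: "{1..int n} = ?N \<union> ?Q" "?N \<inter> ?Q = {}" using mem by blast+
  have FD: "FD n \<alpha> = ?Q \<union> uminus ` ?N"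
  proof (intro equalityI subsetI)
    fix k assume k: "k \<in> FD n \<alpha>"
    then have "k \<in> pm n" using FD_sub[OF assms] by blast
    show "k \<in> ?Q \<union> uminus ` ?N"
    proof (cases "k > 0")
      case True
      then show ?thesis using k \<open>k \<in> pm n\<close> by (simp add: pm_def)
    next
      case False
      then have "- k \<in> ?N" using k \<open>k \<in> pm n\<close> by (auto simp: pm_def)
      then have "- (- k) \<in> uminus ` ?N" by (rule imageI)
      then show ?thesis by simp
    qed
  qed auto
  have disj: "?Q \<inter> uminus ` ?N = {}" by auto
  have "(\<Prod>k\<in>FD n \<alpha>. e (- k)) = (\<Prod>k\<in>?Q. e (- k)) * (\<Prod>k\<in>uminus ` ?N. e (- k))"
    unfolding FD[THEN arg_cong[where f="prod (\<lambda>k. e (- k))"]] by (rule prod.union_disjoint) (use fin disj in auto)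
  also have "(\<Prod>k\<in>uminus ` ?N. e (- k)) = (\<Prod>k\<in>?N. e k)"
    by (subst prod.reindex) (auto simp: inj_on_def)
  finally have 1: "(\<Prod>k\<in>FD n \<alpha>. e (- k)) = (\<Prod>k\<in>?Q. e (- k)) * (\<Prod>k\<in>?N. e k)" .
  have 2: "(\<Prod>k\<in>{1..int n}. e (- k)) = (\<Prod>k\<in>?N. e (- k)) * (\<Prod>k\<in>?Q. e (- k))"
    by (subst pos(1), rule prod.union_disjoint[OF fin pos(2)])
  show ?thesis unfolding 1 2 prod.distrib by (simp add: mult_ac)
qed

lemma delta_PM_neg: "\<alpha> \<in> PM n \<Longrightarrow> k \<in> pm n \<Longrightarrow> delta n (\<alpha> k) = - \<alpha> k"
  by (simp add: delta_pm PM_D(4))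

text \<open>This identifies the index conditions and the product of signs that belong to \<open>\<alpha>\<close> in the expansion of
the moments. On words for which \<open>\<delta>\<alpha>\<close> pairs each letter with its flip, passing from each \<open>k \<in> FD(\<alpha>)\<close> to
its partner \<open>- \<alpha>(k)\<close> changes the product of the spins over \<open>FD(\<alpha>)\<close> by \<open>(-1)\<^sup>n\<close> and turns it into the product
over the negatives of \<open>FD(\<alpha>)\<close>. All its factors are squared by the product over \<open>-[n]\<close>, except those from
the numbers \<open>k\<close> with \<open>- k \<in> FD(\<alpha>)\<close>.\<close>

lemma pairing_tensor_indicator:
  fixes x :: "int \<Rightarrow> 'c \<times> bool"
  assumes \<alpha>: "\<alpha> \<in> PM n"
  shows "(\<Prod>k\<in>{1..int n}. spin (x (- k))) * pairing_tensor n (delta n \<circ> \<alpha>) x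
    = (- 1) ^ (num_orbits (pm n) \<alpha> div 2) *
      (if \<forall>k\<in>pm n. x (delta n (\<alpha> k)) = flip (x k)
       then \<Prod>k\<in>{k\<in>{1..int n}. - k \<in> FD n \<alpha>}. - (spin (x k) * spin (x (- k))) else 0)"
proof (cases "\<forall>k\<in>pm n. x (delta n (\<alpha> k)) = flip (x k)")
  case True
  let ?N = "{k\<in>{1..int n}. - k \<in> FD n \<alpha>}" and ?h = "num_orbits (pm n) \<alpha> div 2"
  let ?e = "\<lambda>k. spin (x k)"
  have FDpm: "k \<in> pm n" if "k \<in> FD n \<alpha>" for k using FD_sub[OF \<alpha>] that by blast
  have cardFD: "card (FD n \<alpha>) = n"
    by (rule transversal_card[OF delta_pairing FD_sub[OF \<alpha>] FD_delta[OF \<alpha>]])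
  have pt: "pair_tensor (delta n \<circ> \<alpha>) (FD n \<alpha>) x = (\<Prod>k\<in>FD n \<alpha>. ?e k)"
    unfolding pair_tensor_def by (rule prod.cong[OF refl]) (use True FDpm in \<open>simp add: omega_def\<close>)
  have "(\<Prod>k\<in>FD n \<alpha>. ?e (- k)) = (\<Prod>k\<in>FD n \<alpha>. ?e (- \<alpha> k))"
  proof (rule prod.reindex_bij_betw[symmetric])
    show "bij_betw \<alpha> (FD n \<alpha>) (FD n \<alpha>)"
      using FD_permutes[OF \<alpha>] permutes_inj_on[OF PM_D(1)[OF \<alpha>]] by (simp add: bij_betw_def)
  qed
  also have "\<dots> = (\<Prod>k\<in>FD n \<alpha>. - 1 * ?e k)"
  proof (rule prod.cong[OF refl])
    fix k assume "k \<in> FD n \<alpha>"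
    then have "k \<in> pm n" by (rule FDpm)
    then have "x (delta n (\<alpha> k)) = flip (x k)" using True by blast
    then have "x (- \<alpha> k) = flip (x k)" by (simp only: delta_PM_neg[OF \<alpha> \<open>k \<in> pm n\<close>])
    then show "?e (- \<alpha> k) = - 1 * ?e k" by simp
  qed
  also have "\<dots> = (- 1) ^ n * (\<Prod>k\<in>FD n \<alpha>. ?e k)" unfolding prod.distrib by (simp add: cardFD)
  finally have swap: "(\<Prod>k\<in>FD n \<alpha>. ?e k) = (- 1) ^ n * (\<Prod>k\<in>FD n \<alpha>. ?e (- k))"
    by (simp add: mult.assoc[symmetric] power_add[symmetric])
  have "(\<Prod>k\<in>{1..int n}. ?e (- k)) * pairing_tensor n (delta n \<circ> \<alpha>) x
    = (- 1) ^ (n + ?h + card ?N) * ((\<Prod>k\<in>{1..int n}. ?e (- k)) * (\<Prod>k\<in>FD n \<alpha>. ?e k))"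
    by (simp add: pairing_tensor_FD[OF \<alpha>] pt)
  also have "\<dots> = (- 1) ^ (n + ?h + card ?N) * (- 1) ^ n * ((\<Prod>k\<in>{1..int n}. ?e (- k)) * (\<Prod>k\<in>FD n \<alpha>. ?e (- k)))"
    unfolding swap by simp
  also have "(\<Prod>k\<in>{1..int n}. ?e (- k)) * (\<Prod>k\<in>FD n \<alpha>. ?e (- k)) = (\<Prod>k\<in>?N. ?e k * ?e (- k))"
    using prod_pos_spin[OF \<alpha>, of ?e] by simp
  also have "(\<Prod>k\<in>?N. ?e k * ?e (- k)) = (- 1) ^ card ?N * (\<Prod>k\<in>?N. - (?e k * ?e (- k)))"
  proof -
    have "(\<Prod>k\<in>?N. - (?e k * ?e (- k))) = (\<Prod>k\<in>?N. - 1 * (?e k * ?e (- k)))" by simp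
    also have "\<dots> = (- 1) ^ card ?N * (\<Prod>k\<in>?N. ?e k * ?e (- k))" unfolding prod.distrib by simp
    finally show ?thesis by (simp add: mult.assoc[symmetric] power_add[symmetric])
  qed
  also have "(- 1) ^ (n + ?h + card ?N) * (- 1) ^ n * ((- 1) ^ card ?N * (\<Prod>k\<in>?N. - (?e k * ?e (- k))))
    = (- 1) ^ ?h * (\<Prod>k\<in>?N. - (?e k * ?e (- k)))"
  proof -
    have sq: "(- 1) ^ m * (- 1) ^ m = (1 :: real)" for m by (simp add: power_add[symmetric])
    have "(- 1) ^ (n + ?h + card ?N) * (- 1) ^ n * (- 1) ^ card ?N
       = (- 1) ^ ?h * ((- 1) ^ n * (- 1) ^ n) * ((- 1) ^ card ?N * (- 1) ^ card ?N :: real)"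
      by (simp only: power_add mult_ac)
    then show ?thesis by (simp only: sq mult_1_right mult.assoc[symmetric])
  qed
  finally show ?thesis unfolding if_P[OF True] .
next
  case False
  then obtain k where k: "k \<in> pm n" "x (delta n (\<alpha> k)) \<noteq> flip (x k)" by blast
  let ?p = "delta n \<circ> \<alpha>"
  note P = pairingsD[OF PM_pairing[OF \<alpha>]]
  note hb = half_basic[OF finite_pm PM_pairing[OF \<alpha>] delta_pairing half_FD(1)[OF \<alpha>]]
  obtain j where j: "j \<in> FD n \<alpha>" "x (?p j) \<noteq> flip (x j)"
  proof (cases "k \<in> FD n \<alpha>")
    case True
    then show ?thesis using that k by simp
  next
    case False
    then have "?p k \<in> FD n \<alpha>" using hb(7)[OF k(1)] by simp
    moreover have "x (?p (?p k)) \<noteq> flip (x (?p k))"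
      unfolding P(2) using k(2) by (metis comp_apply flip_flip)
    ultimately show ?thesis by (rule that)
  qed
  then have "omega (x j) (x (?p j)) = 0" by (simp add: omega_def)
  then have "pair_tensor ?p (FD n \<alpha>) x = 0"
    unfolding pair_tensor_def using j(1) hb(2) by (intro prod_zero) auto
  then show ?thesis unfolding pairing_tensor_FD[OF \<alpha>] using False by (simp only: if_False mult_zero_right simp_thms)
qed

section \<open>Twisted matrix entries and traces\<close>

text \<open>The entries of the complex \<open>2N \<times> 2N\<close> matrix that represents a quaternionic matrix.\<close>

definition mentry :: "quat ^ 'N ^ 'N \<Rightarrow> 'N \<times> bool \<Rightarrow> 'N \<times> bool \<Rightarrow> complex" where
  "mentry A u v = quat_entry (A $ fst u $ fst v) (if snd u then 1 else - 1) (if snd v then 1 else - 1)"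

text \<open>Under \<open>A \<mapsto> U\<^sup>* A U\<close> the row index of the complex matrix transforms by the conjugate of \<open>U\<close> and the column
index by \<open>U\<close>. On \<open>Sp(N)\<close> these two representations are isomorphic by means of the symplectic form,
and the twist of the column index makes both indices transform by the conjugate of \<open>U\<close>.\<close>

definition tentry :: "quat ^ 'N ^ 'N \<Rightarrow> 'N \<times> bool \<Rightarrow> 'N \<times> bool \<Rightarrow> complex" where
  "tentry A u v = of_real (spin v) * mentry A u (flip v)"

lemma mentry_tentry: "mentry A u v = - of_real (spin v) * tentry A u (flip v)"
  by (simp add: tentry_def spin_def flip_def)

lemma cnj_mentry: "cnj (mentry A u v) = of_real (spin u * spin v) * mentry A (flip u) (flip v)"
  by (cases "snd u"; cases "snd v") (simp_all add: mentry_def quat_entry_def spin_def flip_def complex_eq_iff)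

lemma mentry_adj: "mentry (adj A) u v = cnj (mentry A v u)"
  by (cases "snd u"; cases "snd v") (simp_all add: mentry_def adj_def quat_cnj_def quat_entry_def complex_eq_iff)

text \<open>A pair tensor is supported on words that are determined by their letters at the first elements.\<close>

lemma sum_alternating_words:
  fixes f :: "('a \<Rightarrow> 'c::finite \<times> bool) \<Rightarrow> complex"
  assumes J: "finite J" and A: "A \<subseteq> J" and pA: "p ` A = J - A" and p: "\<And>k. p (p k) = k"
  shows "(\<Sum>x\<in>words J. of_real (pair_tensor p A x) * f x)
    = (\<Sum>z\<in>words A. of_real (\<Prod>k\<in>A. spin (z k)) * f (\<lambda>k. if k \<in> A then z k else if k \<in> J then flip (z (p k)) else undefined))"
proof -
  define E :: "('a \<Rightarrow> 'c \<times> bool) \<Rightarrow> 'a \<Rightarrow> 'c \<times> bool" where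
    "E z k = (if k \<in> A then z k else if k \<in> J then flip (z (p k)) else undefined)" for z k
  have fA: "finite A" using A J by (rule finite_subset)
  let ?X = "{x \<in> words J. \<forall>k\<in>A. x (p k) = flip (x k)} :: ('a \<Rightarrow> 'c \<times> bool) set"
  have pk: "p k \<in> J" "p k \<notin> A" if "k \<in> A" for k
  proof -
    have "p k \<in> J - A" unfolding pA[symmetric] using that by (rule imageI)
    then show "p k \<in> J" "p k \<notin> A" by simp_all
  qed
  have pk': "p k \<in> A" if "k \<in> J" "k \<notin> A" for k
  proof -
    have "k \<in> p ` A" using pA that by simp
    then show ?thesis by (auto simp: p)
  qed
  have bij: "bij_betw E (words A) ?X"
  proof (rule bij_betw_byWitness[where f'="\<lambda>x. restrict x A"])
    show "\<forall>z\<in>words A. restrict (E z) A = z"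
      by (auto simp: E_def PiE_def extensional_def fun_eq_iff)
    show "\<forall>x\<in>?X. E (restrict x A) = x"
    proof
      fix x assume "x \<in> ?X"
      then have x: "x \<in> words J" "\<And>k. k \<in> A \<Longrightarrow> x (p k) = flip (x k)" by auto
      show "E (restrict x A) = x"
      proof
        fix k
        consider "k \<in> A" | "k \<in> J" "k \<notin> A" | "k \<notin> J" "k \<notin> A" using A by blast
        then show "E (restrict x A) k = x k"
        proof cases
          case 2
          have "x (p (p k)) = flip (x (p k))" by (rule x(2)[OF pk'[OF 2]])
          then show ?thesis using 2 pk'[OF 2] by (simp add: E_def p)
        next
          case 3
          then show ?thesis using x(1) by (simp add: E_def PiE_def extensional_def)
        qed (simp add: E_def)
      qed
    qed
    show "E ` words A \<subseteq> ?X"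
    proof (rule image_subsetI)
      fix z :: "'a \<Rightarrow> 'c \<times> bool" assume "z \<in> words A"
      have "E z \<in> words J" using A by (auto simp: E_def PiE_def extensional_def)
      moreover have "E z (p k) = flip (E z k)" if "k \<in> A" for k
        using that pk[OF that] by (simp add: E_def p)
      ultimately show "E z \<in> ?X" by blast
    qed
    show "(\<lambda>x. restrict x A) ` ?X \<subseteq> words A" by auto
  qed
  have "(\<Sum>x\<in>words J. of_real (pair_tensor p A x) * f x) = (\<Sum>x\<in>?X. of_real (pair_tensor p A x) * f x)"
  proof (rule sum.mono_neutral_right[OF finite_words[OF J]])
    show "\<forall>x\<in>words J - ?X. of_real (pair_tensor p A x) * f x = 0"
    proof
      fix x assume "x \<in> words J - ?X"
      then obtain k where "k \<in> A" "x (p k) \<noteq> flip (x k)" by auto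
      then have "pair_tensor p A x = 0"
        unfolding pair_tensor_def by (intro prod_zero[OF fA]) (auto simp: omega_def)
      then show "of_real (pair_tensor p A x) * f x = 0" by simp
    qed
  qed auto
  also have "\<dots> = (\<Sum>x\<in>?X. of_real (\<Prod>k\<in>A. spin (x k)) * f x)"
  proof (rule sum.cong[OF refl])
    fix x assume "x \<in> ?X"
    then have "pair_tensor p A x = (\<Prod>k\<in>A. spin (x k))"
      unfolding pair_tensor_def by (intro prod.cong) (auto simp: omega_def)
    then show "of_real (pair_tensor p A x) * f x = of_real (\<Prod>k\<in>A. spin (x k)) * f x" by simp
  qed
  also have "\<dots> = (\<Sum>z\<in>words A. of_real (\<Prod>k\<in>A. spin (E z k)) * f (E z))"
    by (rule sum.reindex_bij_betw[OF bij, symmetric])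
  also have "\<dots> = (\<Sum>z\<in>words A. of_real (\<Prod>k\<in>A. spin (z k)) * f (E z))"
    by (intro sum.cong refl arg_cong2[where f="(*)"] arg_cong[where f=of_real] prod.cong) (simp add: E_def)
  finally show ?thesis by (simp add: E_def[abs_def])
qed

lemma sum_split_words:
  fixes F :: "('a \<Rightarrow> 'N::finite) \<Rightarrow> ('a \<Rightarrow> int) \<Rightarrow> complex"
  assumes "finite A"
  shows "(\<Sum>i\<in>A \<rightarrow>\<^sub>E UNIV. \<Sum>h\<in>A \<rightarrow>\<^sub>E {1, - 1}. F i h)
    = (\<Sum>z\<in>words A. F (\<lambda>k\<in>A. fst (z k)) (\<lambda>k\<in>A. if snd (z k) then 1 else - 1))"
proof -
  let ?S = "(A \<rightarrow>\<^sub>E (UNIV :: 'N set)) \<times> (A \<rightarrow>\<^sub>E {1, - 1 :: int})"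
  have "(\<Sum>i\<in>A \<rightarrow>\<^sub>E UNIV. \<Sum>h\<in>A \<rightarrow>\<^sub>E {1, - 1}. F i h) = (\<Sum>(i, h)\<in>?S. F i h)"
    by (rule sum.cartesian_product)
  also have "\<dots> = (\<Sum>z\<in>words A. case (\<lambda>k\<in>A. fst (z k), \<lambda>k\<in>A. if snd (z k) then 1 else - 1) of (i, h) \<Rightarrow> F i h)"
  proof (rule sum.reindex_bij_betw[symmetric])
    show "bij_betw (\<lambda>z. (\<lambda>k\<in>A. fst (z k), \<lambda>k\<in>A. if snd (z k) then 1 else - 1)) (words A) ?S"
    proof (rule bij_betw_byWitness[where f'="\<lambda>(i, h). \<lambda>k\<in>A. (i k, h k = 1)"])
      show "\<forall>z\<in>words A. (case (\<lambda>k\<in>A. fst (z k), \<lambda>k\<in>A. if snd (z k) then 1 else - 1 :: int) of (i, h) \<Rightarrow> \<lambda>k\<in>A. (i k, h k = 1)) = z"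
        by (auto simp: PiE_def extensional_def fun_eq_iff prod_eq_iff)
      show "\<forall>s\<in>?S. (\<lambda>k\<in>A. fst ((case s of (i, h) \<Rightarrow> \<lambda>k\<in>A. (i k, h k = 1)) k),
          \<lambda>k\<in>A. if snd ((case s of (i, h) \<Rightarrow> \<lambda>k\<in>A. (i k, h k = 1)) k) then 1 else - 1) = s"
      proof (clarify, intro conjI ext)
        fix i :: "'a \<Rightarrow> 'N" and h :: "'a \<Rightarrow> int" and k
        assume i: "i \<in> A \<rightarrow>\<^sub>E UNIV" and h: "h \<in> A \<rightarrow>\<^sub>E {1, - 1}"
        show "(\<lambda>k\<in>A. fst ((\<lambda>k\<in>A. (i k, h k = 1)) k)) k = i k"
          using i by (cases "k \<in> A") (auto simp: PiE_def extensional_def)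
        show "(\<lambda>k\<in>A. if snd ((\<lambda>k\<in>A. (i k, h k = 1)) k) then 1 else - 1) k = h k"
          using h by (cases "k \<in> A") (auto simp: PiE_def Pi_def extensional_def)
      qed
    qed auto
  qed
  finally show ?thesis by simp
qed

text \<open>The trace along \<open>\<pi>\<close> identifies the column index of the \<open>k\<close>-th factor with the row index of the factor
\<open>\<pi>(k)\<close>, that is, it contracts the places \<open>- k\<close> and \<open>\<pi>(k)\<close>. These are paired by \<open>\<delta>\<pi>\<^sup>-\<^sup>1\<close>. A factor with
\<open>k < 0\<close> is an adjoint, whose entries are entries of the original matrix with rows and columns
exchanged and flipped.\<close>

lemma trace_contraction:
  fixes A :: "nat \<Rightarrow> quat ^ 'N::finite ^ 'N"
  assumes \<pi>: "\<pi> \<in> PM n"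
  shows "(\<Sum>x\<in>words (pm n). of_real (pairing_tensor n (delta n \<circ> inv \<pi>) x) * (\<Prod>k\<in>{1..int n}. tentry (A (nat k)) (x k) (x (- k))))
    = (- 2 * of_nat CARD('N)) ^ (num_orbits (pm n) \<pi> div 2) * Re_tr n \<pi> A"
proof -
  note B = PM_D[OF \<pi>] and ip = inv_PM[OF \<pi>]
  let ?q = "delta n \<circ> inv \<pi>" and ?F = "FD n \<pi>" and ?h = "num_orbits (pm n) \<pi> div 2"
  have orb: "orbit (inv \<pi>) k = orbit \<pi> k" for k by (rule orbit_inv_eq[OF B(5)])
  have FDi: "FD n (inv \<pi>) = ?F" by (simp add: FD_def orb)
  have hi: "num_orbits (pm n) (inv \<pi>) = num_orbits (pm n) \<pi>" by (simp add: num_orbits_def orb)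
  have q: "?q \<in> pairings (pm n)" by (rule PM_pairing[OF ip(1)])
  note hb = half_basic[OF finite_pm q delta_pairing half_FD(1)[OF ip(1), unfolded FDi]]
  let ?N = "{k\<in>{1..int n}. - k \<in> ?F}"
  have Fpm: "k \<in> pm n" if "k \<in> ?F" for k using hb(1) that by blast
  define f where "f x = (\<Prod>k\<in>{1..int n}. tentry (A (nat k)) (x k) (x (- k)))" for x
  define E :: "(int \<Rightarrow> 'N \<times> bool) \<Rightarrow> int \<Rightarrow> 'N \<times> bool" where
    "E z k = (if k \<in> ?F then z k else if k \<in> pm n then flip (z (?q k)) else undefined)" for z k
  have "(\<Sum>x\<in>words (pm n). of_real (pairing_tensor n ?q x) * f x)
    = (- 1) ^ (n + ?h + card ?N) * (\<Sum>x\<in>words (pm n). of_real (pair_tensor ?q ?F x) * f x)"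
    by (simp add: pairing_tensor_FD[OF ip(1)] FDi hi sum_distrib_left mult.assoc)
  also have "(\<Sum>x\<in>words (pm n). of_real (pair_tensor ?q ?F x) * f x)
    = (\<Sum>z\<in>words ?F. of_real (\<Prod>k\<in>?F. spin (z k)) * f (E z))"
    unfolding E_def[abs_def] by (rule sum_alternating_words[OF finite_pm hb(1,4) pairingsD(2)[OF q]])
  also have "\<dots> = (\<Sum>z\<in>words ?F. (- 1) ^ (n + card ?N) * (\<Prod>k\<in>?F. mentry (signed A k) (z k) (z (\<pi> k))))"
  proof (rule sum.cong[OF refl])
    fix z :: "int \<Rightarrow> 'N \<times> bool"
    have Ez: "E z (- k) = flip (z (\<pi> k))" "E z k = z k" if k: "k \<in> ?F" for k
    proof -
      have "k \<in> pm n" by (rule Fpm[OF k])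
      then have "?q (- k) = \<pi> k" "- k \<notin> ?F"
        using fun_cong[OF ip(4), of "- k"] FD_neg[OF \<pi>, of k] k by (simp_all add: delta_pm)
      then show "E z (- k) = flip (z (\<pi> k))" "E z k = z k" using k \<open>k \<in> pm n\<close> by (simp_all only: E_def if_True if_False uminus_pm)
    qed
    \<comment> \<open>removing the twist leaves the spin of \<open>z (\<pi> k)\<close>, with a minus sign unless the factor is an adjoint\<close>
    define sg :: "int \<Rightarrow> real" where "sg k = (if k > 0 then - 1 else 1)" for k
    have fac: "mentry (signed A k) (z k) (z (\<pi> k))
       = of_real (sg k * spin (z (\<pi> k))) * tentry (A (nat \<bar>k\<bar>)) (E z \<bar>k\<bar>) (E z (- \<bar>k\<bar>))" if k: "k \<in> ?F" for k
    proof (cases "k > 0")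
      case True
      then show ?thesis using Ez[OF k] mentry_tentry[of "A (nat k)" "z k" "z (\<pi> k)"]
        by (simp add: signed_def sg_def)
    next
      case False
      then have "\<bar>k\<bar> = - k" by simp
      moreover have "mentry (adj (A (nat (- k)))) (z k) (z (\<pi> k))
        = of_real (spin (z (\<pi> k))) * tentry (A (nat (- k))) (flip (z (\<pi> k))) (z k)"
        by (simp add: mentry_adj cnj_mentry tentry_def)
      ultimately show ?thesis using False Ez[OF k] by (simp add: signed_def sg_def)
    qed
    have bij\<pi>: "bij_betw \<pi> ?F ?F"
      using FD_permutes[OF \<pi>] permutes_inj_on[OF B(1)] by (simp add: bij_betw_def)
    have absF: "bij_betw abs ?F {1..int n}"
    proof (rule bij_betw_byWitness[where f'="\<lambda>k. if k \<in> ?F then k else - k"])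
      show "\<forall>k\<in>?F. (if \<bar>k\<bar> \<in> ?F then \<bar>k\<bar> else - \<bar>k\<bar>) = k"
        using FD_neg[OF \<pi>] Fpm by (auto simp: abs_if)
      show "(\<lambda>k. if k \<in> ?F then k else - k) ` {1..int n} \<subseteq> ?F"
        using FD_neg[OF \<pi>] by (auto simp: pm_def)
      show "abs ` ?F \<subseteq> {1..int n}"
      proof (rule image_subsetI)
        fix k assume "k \<in> ?F"
        then have "k \<in> pm n" by (rule Fpm)
        then show "\<bar>k\<bar> \<in> {1..int n}" by (auto simp: pm_def)
      qed
    qed auto
    have sgF: "(\<Prod>k\<in>?F. sg k) = (- 1) ^ (n + card ?N)"
    proof -
      have "(\<Prod>k\<in>?F. sg k) = (\<Prod>k\<in>{1..int n}. if - k \<in> ?F then 1 else - 1)"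
        using FD_neg[OF \<pi>] Fpm
        by (subst prod.reindex_bij_betw[OF absF, symmetric]) (intro prod.cong refl, auto simp: sg_def abs_if pm_def)
      also have "\<dots> = (\<Prod>k\<in>{1..int n}. - 1 * (if - k \<in> ?F then - 1 else 1))" by (intro prod.cong) auto
      also have "\<dots> = (- 1) ^ n * (\<Prod>k\<in>{1..int n}. if - k \<in> ?F then - 1 else 1)" unfolding prod.distrib by simp
      also have "(\<Prod>k\<in>{1..int n}. if - k \<in> ?F then - 1 else 1 :: real) = (\<Prod>k\<in>?N. - 1)"
        by (rule prod.inter_filter[symmetric]) simp
      finally show ?thesis by (simp add: power_add)
    qed
    have "(\<Prod>k\<in>?F. mentry (signed A k) (z k) (z (\<pi> k)))
      = (\<Prod>k\<in>?F. of_real (sg k) * of_real (spin (z (\<pi> k))) * tentry (A (nat \<bar>k\<bar>)) (E z \<bar>k\<bar>) (E z (- \<bar>k\<bar>)))"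
      by (intro prod.cong refl) (simp add: fac)
    also have "\<dots> = of_real (\<Prod>k\<in>?F. sg k) * of_real (\<Prod>k\<in>?F. spin (z (\<pi> k))) * (\<Prod>k\<in>?F. tentry (A (nat \<bar>k\<bar>)) (E z \<bar>k\<bar>) (E z (- \<bar>k\<bar>)))"
      by (simp add: prod.distrib)
    also have "(\<Prod>k\<in>?F. spin (z (\<pi> k))) = (\<Prod>k\<in>?F. spin (z k))"
      by (rule prod.reindex_bij_betw[OF bij\<pi>])
    also have "(\<Prod>k\<in>?F. tentry (A (nat \<bar>k\<bar>)) (E z \<bar>k\<bar>) (E z (- \<bar>k\<bar>))) = f (E z)"
      unfolding f_def by (rule prod.reindex_bij_betw[OF absF])
    finally have "(\<Prod>k\<in>?F. mentry (signed A k) (z k) (z (\<pi> k)))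
      = (- 1) ^ (n + card ?N) * (of_real (\<Prod>k\<in>?F. spin (z k)) * f (E z))" by (simp add: sgF)
    then show "of_real (\<Prod>k\<in>?F. spin (z k)) * f (E z) = (- 1) ^ (n + card ?N) * (\<Prod>k\<in>?F. mentry (signed A k) (z k) (z (\<pi> k)))"
      by (simp add: mult.assoc[symmetric] power_add[symmetric])
  qed
  also have "\<dots> = (- 1) ^ (n + card ?N) * (\<Sum>z\<in>words ?F. \<Prod>k\<in>?F. mentry (signed A k) (z k) (z (\<pi> k)))"
    by (simp add: sum_distrib_left)
  also have "(\<Sum>z\<in>words ?F. \<Prod>k\<in>?F. mentry (signed A k) (z k) (z (\<pi> k)))
    = (\<Sum>i\<in>?F \<rightarrow>\<^sub>E UNIV. \<Sum>h\<in>?F \<rightarrow>\<^sub>E {1, - 1}. \<Prod>k\<in>?F. quat_entry (signed A k $ i k $ i (\<pi> k)) (h k) (h (\<pi> k)))"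
    unfolding sum_split_words[OF hb(2)]
    by (intro sum.cong prod.cong refl) (simp add: FD_image[OF \<pi>] mentry_def)
  also have "\<dots> = (2 * of_nat CARD('N)) ^ ?h * Re_tr n \<pi> A"
  proof -
    have "(of_nat CARD('N) :: complex) \<noteq> 0" by simp
    then have "(2 * of_nat CARD('N)) ^ ?h * (2 powi (- int ?h) * of_nat CARD('N) powi (- int ?h)) = (1 :: complex)"
      by (simp add: power_int_minus power_mult_distrib field_simps)
    then show ?thesis
      unfolding Re_tr_def num_orbits_FD(1)[OF \<pi>] by (simp only: mult.assoc[symmetric] mult_1_left)
  qed
  also have "(- 1) ^ (n + ?h + card ?N) * ((- 1) ^ (n + card ?N) * ((2 * of_nat CARD('N)) ^ ?h * Re_tr n \<pi> A))
    = (- 2 * of_nat CARD('N)) ^ ?h * Re_tr n \<pi> A"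
  proof -
    have sq: "(- 1) ^ m * (- 1) ^ m = (1 :: complex)" for m by (simp add: power_add[symmetric])
    have "(- 1 :: complex) ^ (n + ?h + card ?N) * (- 1) ^ (n + card ?N)
       = (- 1) ^ ?h * ((- 1) ^ n * (- 1) ^ n) * ((- 1) ^ card ?N * (- 1) ^ card ?N)"
      by (simp only: power_add mult_ac)
    then have 1: "(- 1 :: complex) ^ (n + ?h + card ?N) * (- 1) ^ (n + card ?N) = (- 1) ^ ?h"
      by (simp only: sq mult_1_right)
    have "(- 2 * of_nat CARD('N) :: complex) ^ ?h = ((- 1) * (2 * of_nat CARD('N))) ^ ?h" by simp
    also have "\<dots> = (- 1) ^ ?h * (2 * of_nat CARD('N)) ^ ?h" by (rule power_mult_distrib)
    finally show ?thesis by (simp only: mult.assoc[symmetric] 1)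
  qed
  finally show ?thesis unfolding f_def .
qed

section \<open>The action of the symplectic group on twisted entries\<close>

lemma quat_entry_add: "quat_entry (p + q) s t = quat_entry p s t + quat_entry q s t"
  by (simp add: quat_entry_def plus_quat_def complex_eq_iff)
lemma quat_entry_0: "quat_entry 0 s t = 0"
  by (simp add: quat_entry_def zero_quat_def complex_eq_iff)
lemma quat_entry_scaleR: "quat_entry (r *\<^sub>R q) s t = of_real r * quat_entry q s t"
  by (simp add: quat_entry_def scaleR_quat_def complex_eq_iff)
lemma quat_entry_sum: "quat_entry (\<Sum>i\<in>I. q i) s t = (\<Sum>i\<in>I. quat_entry (q i) s t)"
  by (induction I rule: infinite_finite_induct) (simp_all add: quat_entry_add quat_entry_0)
lemma quat_entry_mult:
  "quat_entry (p * q) s t = quat_entry p s 1 * quat_entry q 1 t + quat_entry p s (- 1) * quat_entry q (- 1) t"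
  by (simp add: quat_entry_def times_quat_def complex_eq_iff algebra_simps)

lemma sum_letters: "(\<Sum>w\<in>UNIV. f w) = (\<Sum>i\<in>UNIV. f (i, True) + f (i, False))" for f :: "'N::finite \<times> bool \<Rightarrow> 'b::comm_monoid_add"
proof -
  have "(\<Sum>w\<in>UNIV. f w) = (\<Sum>w\<in>UNIV \<times> UNIV. f w)" by simp
  also have "\<dots> = (\<Sum>i\<in>UNIV. \<Sum>b\<in>UNIV. f (i, b))" by (simp only: sum.cartesian_product case_prod_eta)
  finally show ?thesis by (simp add: UNIV_bool add.commute)
qed

lemma mentry_mult: "mentry (A ** B) u v = (\<Sum>w\<in>UNIV. mentry A u w * mentry B w v)"
  by (simp add: sum_letters mentry_def matrix_matrix_mult_def quat_entry_sum quat_entry_mult)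

lemma mentry_add: "mentry (A + B) u v = mentry A u v + mentry B u v"
  by (simp add: mentry_def quat_entry_add)
lemma mentry_scaleR: "mentry (r *\<^sub>R A) u v = of_real r * mentry A u v"
  by (simp add: mentry_def quat_entry_scaleR)
lemma mentry_one: "mentry (mat 1) u v = (if u = v then 1 else 0)"
  by (auto simp: mentry_def mat_def quat_entry_def one_quat_def zero_quat_def complex_eq_iff prod_eq_iff)

lemma sum_flip: "(\<Sum>w\<in>UNIV. f (flip w)) = (\<Sum>w\<in>UNIV. f w)" for f :: "'N::finite \<times> bool \<Rightarrow> 'b::comm_monoid_add"
  by (rule sum.reindex_bij_witness[of _ flip flip]) auto

lemma tentry_conj:
  "tentry (adj U ** A ** U) u v = (\<Sum>c\<in>UNIV. \<Sum>d\<in>UNIV. cnj (mentry U c u) * cnj (mentry U d v) * tentry A c d)"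
proof -
  have "tentry (adj U ** A ** U) u v = of_real (spin v) * (\<Sum>w\<in>UNIV. (\<Sum>c\<in>UNIV. cnj (mentry U c u) * mentry A c w) * mentry U w (flip v))"
    by (simp add: tentry_def mentry_mult mentry_adj)
  also have "\<dots> = of_real (spin v) * (\<Sum>d\<in>UNIV. (\<Sum>c\<in>UNIV. cnj (mentry U c u) * mentry A c (flip d)) * mentry U (flip d) (flip v))"
    by (subst sum_flip[symmetric]) simp
  also have "\<dots> = (\<Sum>d\<in>UNIV. \<Sum>c\<in>UNIV. cnj (mentry U c u) * cnj (mentry U d v) * tentry A c d)"
    unfolding sum_distrib_left
  proof (rule sum.cong[OF refl])
    fix d
    have "mentry U (flip d) (flip v) = of_real (spin d * spin v) * cnj (mentry U d v)"
      using cnj_mentry[of U d v] by (simp add: spin_def)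
    then show "of_real (spin v) * ((\<Sum>c\<in>UNIV. cnj (mentry U c u) * mentry A c (flip d)) * mentry U (flip d) (flip v))
      = (\<Sum>c\<in>UNIV. cnj (mentry U c u) * cnj (mentry U d v) * tentry A c d)"
      by (simp add: sum_distrib_right sum_distrib_left tentry_def) (simp add: spin_def mult_ac)
  qed
  also have "\<dots> = (\<Sum>c\<in>UNIV. \<Sum>d\<in>UNIV. cnj (mentry U c u) * cnj (mentry U d v) * tentry A c d)"
    by (rule sum.swap)
  finally show ?thesis .
qed

lemma pm_Suc: "pm (Suc n) = insert (int (Suc n)) (insert (- int (Suc n)) (pm n))"
  by (auto simp: pm_def)

text \<open>Distributivity, with the two summation indices of the \<open>k\<close>-th factor stored at the places \<open>k\<close> and \<open>- k\<close>.\<close>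

lemma prod_sum_words:
  fixes F :: "int \<Rightarrow> 'i::finite \<Rightarrow> 'i \<Rightarrow> complex"
  shows "(\<Prod>k\<in>{1..int n}. \<Sum>c\<in>UNIV. \<Sum>d\<in>UNIV. F k c d) = (\<Sum>y\<in>words (pm n). \<Prod>k\<in>{1..int n}. F k (y k) (y (- k)))"
proof (induction n)
  case 0
  have "pm 0 = {}" by (auto simp: pm_def)
  then show ?case by simp
next
  case (Suc n)
  let ?a = "int (Suc n)"
  have ins: "{1..?a} = insert ?a {1..int n}" by auto
  have na: "?a \<notin> {1..int n}" "- ?a \<notin> pm n" "?a \<notin> insert (- ?a) (pm n)" by (auto simp: pm_def)
  have "(\<Sum>y\<in>words (pm (Suc n)). \<Prod>k\<in>{1..?a}. F k (y k) (y (- k)))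
    = (\<Sum>y\<in>words (pm n). \<Sum>d\<in>UNIV. \<Sum>c\<in>UNIV. \<Prod>k\<in>{1..?a}. F k ((y(- ?a := d, ?a := c)) k) ((y(- ?a := d, ?a := c)) (- k)))"
    unfolding pm_Suc by (simp only: sum_words_insert[OF _ na(3)] sum_words_insert[OF finite_pm na(2)] finite_insert finite_pm)
  also have "\<dots> = (\<Sum>y\<in>words (pm n). \<Sum>d\<in>UNIV. \<Sum>c\<in>UNIV. F ?a c d * (\<Prod>k\<in>{1..int n}. F k (y k) (y (- k))))"
  proof (intro sum.cong refl)
    fix y :: "int \<Rightarrow> 'i" and c d
    have "(\<Prod>k\<in>{1..int n}. F k ((y(- ?a := d, ?a := c)) k) ((y(- ?a := d, ?a := c)) (- k)))
      = (\<Prod>k\<in>{1..int n}. F k (y k) (y (- k)))"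
      by (rule prod.cong) auto
    then show "(\<Prod>k\<in>{1..?a}. F k ((y(- ?a := d, ?a := c)) k) ((y(- ?a := d, ?a := c)) (- k)))
      = F ?a c d * (\<Prod>k\<in>{1..int n}. F k (y k) (y (- k)))"
      unfolding ins using na(1) by simp
  qed
  also have "\<dots> = (\<Sum>d\<in>UNIV. \<Sum>c\<in>UNIV. F ?a c d) * (\<Sum>y\<in>words (pm n). \<Prod>k\<in>{1..int n}. F k (y k) (y (- k)))"
    by (simp add: sum_distrib_left sum_distrib_right)
  also have "(\<Sum>d\<in>UNIV. \<Sum>c\<in>UNIV. F ?a c d) = (\<Sum>c\<in>UNIV. \<Sum>d\<in>UNIV. F ?a c d)" by (rule sum.swap)
  finally show ?case unfolding ins Suc.IH[symmetric] using na(1) by simp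
qed

section \<open>From group invariance to Lie algebra invariance\<close>

lemma quat_cnj_mult: "quat_cnj (p * q) = quat_cnj q * quat_cnj p"
  by (simp add: quat_cnj_def times_quat_def quat_eq_iff)
lemma quat_cnj_add: "quat_cnj (p + q) = quat_cnj p + quat_cnj q"
  by (simp add: quat_cnj_def plus_quat_def)
lemma quat_cnj_0 [simp]: "quat_cnj 0 = 0" by (simp add: quat_cnj_def zero_quat_def)
lemma quat_cnj_1 [simp]: "quat_cnj 1 = 1" by (simp add: quat_cnj_def one_quat_def)
lemma quat_cnj_cnj [simp]: "quat_cnj (quat_cnj p) = p" by (simp add: quat_cnj_def)
lemma quat_cnj_sum: "quat_cnj (\<Sum>i\<in>I. q i) = (\<Sum>i\<in>I. quat_cnj (q i))"
  by (induction I rule: infinite_finite_induct) (simp_all add: quat_cnj_add)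
lemma quat_cnj_scaleR: "quat_cnj (r *\<^sub>R p) = r *\<^sub>R quat_cnj p" by (simp add: quat_cnj_def scaleR_quat_def)
lemma quat_mult_scaleR: "(r *\<^sub>R p) * q = r *\<^sub>R (p * q)" "p * (r *\<^sub>R q) = r *\<^sub>R (p * q)" for p q :: quat
  by (simp_all add: times_quat_def scaleR_quat_def algebra_simps)

lemma adj_mult: "adj (A ** B) = adj B ** adj A"
  by (simp add: adj_def matrix_matrix_mult_def vec_eq_iff quat_cnj_sum quat_cnj_mult)
lemma adj_add: "adj (A + B) = adj A + adj B" by (simp add: adj_def vec_eq_iff quat_cnj_add)
lemma adj_scaleR: "adj (r *\<^sub>R A) = r *\<^sub>R adj A" by (simp add: adj_def vec_eq_iff quat_cnj_scaleR)
lemma adj_one: "adj (mat 1) = mat 1" by (auto simp: adj_def vec_eq_iff mat_def)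
lemma matrix_scaleR_left: "(r *\<^sub>R A) ** B = r *\<^sub>R (A ** B)" for A B :: "quat ^ 'N ^ 'N"
  by (simp add: matrix_matrix_mult_def vec_eq_iff quat_mult_scaleR scaleR_sum_right)
lemma matrix_scaleR_right: "A ** (r *\<^sub>R B) = r *\<^sub>R (A ** B)" for A B :: "quat ^ 'N ^ 'N"
  by (simp add: matrix_matrix_mult_def vec_eq_iff quat_mult_scaleR scaleR_sum_right)
lemma matrix_add_left: "(A + B) ** C = A ** C + B ** C" for A B C :: "quat ^ 'N ^ 'N"
  by (simp add: matrix_matrix_mult_def vec_eq_iff distrib_right sum.distrib)
lemma matrix_uminus_left: "(- A) ** B = - (A ** B)" for A B :: "quat ^ 'N ^ 'N"
  by (simp add: matrix_matrix_mult_def vec_eq_iff sum_negf)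
lemma matrix_uminus_right: "A ** (- B) = - (A ** B)" for A B :: "quat ^ 'N ^ 'N"
  by (simp add: matrix_matrix_mult_def vec_eq_iff sum_negf)

text \<open>The one-parameter group \<open>exp (t S)\<close> for a matrix with \<open>S\<^sup>3 = - S\<close>. The Lie algebra of \<open>Sp(N)\<close> is spanned
by such matrices, so no general matrix exponential is involved.\<close>

definition rotation :: "quat ^ 'N ^ 'N \<Rightarrow> real \<Rightarrow> quat ^ 'N ^ 'N" where
  "rotation S t = mat 1 + sin t *\<^sub>R S + (1 - cos t) *\<^sub>R (S ** S)"

lemma rotation_Sp:
  assumes skew: "adj S = - S" and cube: "S ** S ** S = - S"
  shows "rotation S t \<in> Sp"
proof -
  define Q where "Q = S ** S"
  have QS: "Q ** S = - S" using cube by (simp add: Q_def)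
  have SQ: "S ** Q = - S" using cube by (simp add: Q_def matrix_mul_assoc)
  have SS: "S ** S = Q" by (simp add: Q_def)
  have QQ: "Q ** Q = - Q"
    using QS by (simp add: Q_def[of] matrix_mul_assoc) (simp add: Q_def matrix_uminus_left)
  have adjQ: "adj Q = Q" by (simp add: Q_def adj_mult skew matrix_uminus_left matrix_uminus_right)
  define c where "c = 1 - cos t"
  have coef: "c + c - sin t * sin t - c * c = 0"
    using sin_cos_squared_add[of t] by (simp add: c_def power2_eq_square algebra_simps)
  have adjR: "adj (rotation S t) = mat 1 - sin t *\<^sub>R S + c *\<^sub>R Q"
    by (simp add: rotation_def adj_add adj_scaleR adj_one skew adjQ Q_def[symmetric] c_def)
  have "(mat 1 - sin t *\<^sub>R S + c *\<^sub>R Q) ** (mat 1 + sin t *\<^sub>R S + c *\<^sub>R Q)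
     = mat 1 + (c + c - sin t * sin t - c * c) *\<^sub>R Q"
  proof -
    have two: "(c * 2) *\<^sub>R Q = c *\<^sub>R Q + c *\<^sub>R Q" by (simp only: mult_2_right scaleR_left_distrib)
    have "(mat 1 + (- sin t) *\<^sub>R S + c *\<^sub>R Q) ** (mat 1 + sin t *\<^sub>R S + c *\<^sub>R Q)
     = mat 1 + (c + c - sin t * sin t - c * c) *\<^sub>R Q"
      by (simp only: matrix_add_ldistrib matrix_add_left matrix_scaleR_left matrix_scaleR_right
          matrix_mul_lid matrix_mul_rid SS SQ QS QQ) (simp add: algebra_simps two)
    then show ?thesis by simp
  qed
  then have "adj (rotation S t) ** rotation S t = mat 1"
    unfolding adjR coef by (simp add: rotation_def Q_def c_def)
  then show ?thesis by (simp add: Sp_def)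
qed

text \<open>The invariance of \<open>T\<close> under \<open>exp (t S)\<close> is differentiated at \<open>t = 0\<close>. The entries of the curve are
extended to complex arguments, so that the rules for derivatives of functions on a field apply.\<close>

lemma invariant_under_rotations:
  fixes T :: "(int \<Rightarrow> 'N::finite \<times> bool) \<Rightarrow> complex"
  assumes dep: "depends_on (pm n) T"
    and inv: "\<And>U x. U \<in> Sp \<Longrightarrow> T x = (\<Sum>y\<in>words (pm n). (\<Prod>j\<in>pm n. cnj (mentry U (y j) (x j))) * T y)"
    and skew: "adj S = - S" and cube: "S ** S ** S = - S"
  shows "(\<Sum>j\<in>pm n. \<Sum>b\<in>UNIV. mentry S (x j) b * T (x(j := b))) = 0"
proof -
  define f where "f y j z = (if y j = x j then 1 else 0) + sin z * cnj (mentry S (y j) (x j))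
    + (1 - cos z) * cnj (mentry (S ** S) (y j) (x j))" for y :: "int \<Rightarrow> 'N \<times> bool" and j and z :: complex
  define F where "F z = (\<Sum>y\<in>words (pm n). (\<Prod>j\<in>pm n. f y j z) * T y)" for z
  have Freal: "F (of_real t) = T x" for t :: real
  proof -
    have "f y j (of_real t) = cnj (mentry (rotation S t) (y j) (x j))" for y j
      by (simp add: f_def rotation_def mentry_add mentry_scaleR mentry_one sin_of_real cos_of_real)
    then show ?thesis using inv[OF rotation_Sp[OF skew cube], of x t] by (simp add: F_def)
  qed
  define D where "D = (\<Sum>y\<in>words (pm n). (\<Sum>j\<in>pm n. cnj (mentry S (y j) (x j)) * (\<Prod>i\<in>pm n - {j}. f y i 0)) * T y)"
  have df: "(f y j has_field_derivative cnj (mentry S (y j) (x j))) (at 0)" for y j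
    unfolding f_def by (rule derivative_eq_intros refl | simp)+
  have "(F has_field_derivative D) (at 0)"
    unfolding F_def D_def by (intro DERIV_sum DERIV_cmult_right has_field_derivative_prod df)
  then have "((\<lambda>t. F (of_real t)) has_vector_derivative D) (at (0 :: real))"
    using has_vector_derivative_real_field[of F D 0] by simp
  moreover have "((\<lambda>t. F (of_real t)) has_vector_derivative 0) (at (0 :: real))"
    unfolding Freal by (rule has_vector_derivative_const)
  ultimately have "D = 0" by (rule vector_derivative_unique_at)
  have "D = (\<Sum>j\<in>pm n. \<Sum>y\<in>words (pm n). cnj (mentry S (y j) (x j)) * (\<Prod>i\<in>pm n - {j}. f y i 0) * T y)"
    unfolding D_def sum_distrib_right by (rule sum.swap)
  also have "\<dots> = (\<Sum>j\<in>pm n. \<Sum>b\<in>UNIV. cnj (mentry S b (x j)) * T (x(j := b)))"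
  proof (rule sum.cong[OF refl])
    fix j assume j: "j \<in> pm n"
    let ?J = "pm n - {j}"
    let ?x = "restrict x ?J"
    have Jeq: "pm n = insert j ?J" using j by auto
    have fJ: "finite ?J" "j \<notin> ?J" by auto
    have "(\<Sum>y\<in>words (pm n). cnj (mentry S (y j) (x j)) * (\<Prod>i\<in>?J. f y i 0) * T y)
      = (\<Sum>y\<in>words ?J. \<Sum>b\<in>UNIV. cnj (mentry S ((y(j := b)) j) (x j)) * (\<Prod>i\<in>?J. f (y(j := b)) i 0) * T (y(j := b)))"
      by (subst Jeq, rule sum_words_insert[OF fJ])
    also have "\<dots> = (\<Sum>y\<in>{?x}. \<Sum>b\<in>UNIV. cnj (mentry S ((y(j := b)) j) (x j)) * (\<Prod>i\<in>?J. f (y(j := b)) i 0) * T (y(j := b)))"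
    proof (rule sum.mono_neutral_right)
      show "\<forall>y\<in>words ?J - {?x}. (\<Sum>b\<in>UNIV. cnj (mentry S ((y(j := b)) j) (x j)) * (\<Prod>i\<in>?J. f (y(j := b)) i 0) * T (y(j := b))) = 0"
      proof
        fix y assume y: "y \<in> words ?J - {?x}"
        obtain i where i: "i \<in> ?J" "y i \<noteq> x i"
        proof (rule ccontr)
          assume "\<not> thesis"
          then have "y i = x i" if "i \<in> ?J" for i using that \<open>\<And>i. i \<in> ?J \<Longrightarrow> y i \<noteq> x i \<Longrightarrow> thesis\<close> by blast
          then have "y = ?x" using y by (auto simp: fun_eq_iff PiE_def extensional_def)
          then show False using y by blast
        qed
        then have fi: "f (y(j := b)) i 0 = 0" for b by (simp add: f_def)
        have prod0: "(\<Prod>i\<in>?J. f (y(j := b)) i 0) = 0" for b by (rule prod_zero[OF fJ(1)], rule bexI[of _ i], rule fi, rule i(1))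
        show "(\<Sum>b\<in>UNIV. cnj (mentry S ((y(j := b)) j) (x j)) * (\<Prod>i\<in>?J. f (y(j := b)) i 0) * T (y(j := b))) = 0"
          by (simp only: prod0 mult_zero_left mult_zero_right sum.neutral_const)
      qed
      show "finite (words ?J :: (int \<Rightarrow> 'N \<times> bool) set)" by (rule finite_words[OF fJ(1)])
    qed auto
    also have "\<dots> = (\<Sum>b\<in>UNIV. cnj (mentry S b (x j)) * T (x(j := b)))"
    proof -
      have "(\<Prod>i\<in>?J. f (?x(j := b)) i 0) = 1" for b by (rule prod.neutral) (auto simp: f_def)
      moreover have "T (?x(j := b)) = T (x(j := b))" for b
        using dep unfolding depends_on_def by (elim allE impE) auto
      ultimately show ?thesis by simp
    qed
    finally show "(\<Sum>y\<in>words (pm n). cnj (mentry S (y j) (x j)) * (\<Prod>i\<in>?J. f y i 0) * T y)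
      = (\<Sum>b\<in>UNIV. cnj (mentry S b (x j)) * T (x(j := b)))" .
  qed
  also have "\<dots> = (\<Sum>j\<in>pm n. \<Sum>b\<in>UNIV. - (mentry S (x j) b * T (x(j := b))))"
  proof (intro sum.cong refl)
    fix j b
    have "cnj (mentry S b (x j)) = mentry (- S) (x j) b" by (simp only: mentry_adj[symmetric] skew)
    also have "\<dots> = - mentry S (x j) b" using mentry_scaleR[of "- 1" S "x j" b] by simp
    finally show "cnj (mentry S b (x j)) * T (x(j := b)) = - (mentry S (x j) b * T (x(j := b)))" by simp
  qed
  also have "\<dots> = - (\<Sum>j\<in>pm n. \<Sum>b\<in>UNIV. mentry S (x j) b * T (x(j := b)))" by (simp add: sum_negf)
  finally show ?thesis using \<open>D = 0\<close> by simp
qed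

definition single :: "quat \<Rightarrow> 'N \<Rightarrow> 'N \<Rightarrow> quat ^ 'N ^ 'N" where
  "single q r s = (\<chi> i j. if i = r \<and> j = s then q else 0)"

lemma sum_delta2: "(\<Sum>i\<in>UNIV. \<Sum>j\<in>UNIV. if i = r \<and> j = s then g i j else 0) = g r s"
  for g :: "'N::finite \<Rightarrow> 'N \<Rightarrow> 'b::comm_monoid_add"
proof -
  have "(\<Sum>j\<in>UNIV. if i = r \<and> j = s then g i j else 0) = (if i = r then g i s else 0)" for i by simp
  then show ?thesis by simp
qed

lemma single_mult: "single p a b ** single q c d = (if b = c then single (p * q) a d else 0)"
proof -
  have "(\<Sum>k\<in>UNIV. (if i = a \<and> k = b then p else 0) * (if k = c \<and> j = d then q else 0))
    = (if b = c \<and> i = a \<and> j = d then p * q else 0)" for i j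
  proof -
    have "(\<Sum>k\<in>UNIV. (if i = a \<and> k = b then p else 0) * (if k = c \<and> j = d then q else 0))
      = (\<Sum>k\<in>UNIV. if k = b then (if b = c \<and> i = a \<and> j = d then p * q else 0) else 0)"
      by (rule sum.cong) auto
    then show ?thesis by simp
  qed
  then show ?thesis by (simp add: single_def matrix_matrix_mult_def vec_eq_iff)
qed

lemma adj_single: "adj (single q r s) = single (quat_cnj q) s r"
  by (auto simp: adj_def single_def vec_eq_iff)
lemma single_minus: "single (- q) r s = - single q r s" by (simp add: single_def vec_eq_iff)

lemma mentry_single: "mentry (single q r s) a b = (if fst a = r \<and> fst b = s
    then quat_entry q (if snd a then 1 else - 1) (if snd b then 1 else - 1) else 0)"
  by (simp add: mentry_def single_def quat_entry_0)

lemma mentry_diff: "mentry (A - B) u v = mentry A u v - mentry B u v"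
  using mentry_add[of A "(- 1) *\<^sub>R B" u v] mentry_scaleR[of "- 1" B u v] by simp

lemma matrix_diff_left: "(A - B) ** C = A ** C - B ** C" for A B C :: "quat ^ 'N ^ 'N"
  by (simp add: matrix_matrix_mult_def vec_eq_iff left_diff_distrib sum_subtractf)
lemma matrix_diff_right: "C ** (A - B) = C ** A - C ** B" for A B C :: "quat ^ 'N ^ 'N"
  by (simp add: matrix_matrix_mult_def vec_eq_iff right_diff_distrib sum_subtractf)
lemma adj_diff: "adj (A - B) = adj A - adj B"
  by (simp add: adj_def vec_eq_iff quat_cnj_def minus_quat_def)

lemma off_diagonal_generator:
  assumes "r \<noteq> s" "q * quat_cnj q = 1" "quat_cnj q * q = 1"
  defines "S \<equiv> single q r s - single (quat_cnj q) s r"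
  shows "adj S = - S" "S ** S ** S = - S"
proof -
  show "adj S = - S" by (simp add: S_def adj_diff adj_single)
  show "S ** S ** S = - S"
    unfolding S_def using assms(1-3)
    by (simp add: matrix_diff_left matrix_diff_right matrix_uminus_left single_mult mult.assoc)
qed

lemma diagonal_generator:
  assumes "quat_cnj q = - q" "q * q = - 1"
  shows "adj (single q r r) = - single q r r" "single q r r ** single q r r ** single q r r = - single q r r"
  by (simp_all add: adj_single single_mult assms single_minus matrix_uminus_left)

lemma sum_mentry_single:
  fixes w :: "'N::finite \<times> bool \<Rightarrow> 'N \<times> bool \<Rightarrow> complex"
  shows "(\<Sum>a\<in>UNIV. \<Sum>b\<in>UNIV. mentry (single q r s) a b * w a b) =
     quat_entry q 1 1 * w (r, True) (s, True) + quat_entry q 1 (- 1) * w (r, True) (s, False)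
   + quat_entry q (- 1) 1 * w (r, False) (s, True) + quat_entry q (- 1) (- 1) * w (r, False) (s, False)"
proof -
  let ?g = "\<lambda>i j. quat_entry q 1 1 * w (i, True) (j, True) + quat_entry q 1 (- 1) * w (i, True) (j, False)
   + quat_entry q (- 1) 1 * w (i, False) (j, True) + quat_entry q (- 1) (- 1) * w (i, False) (j, False)"
  have "(\<Sum>a\<in>UNIV. \<Sum>b\<in>UNIV. mentry (single q r s) a b * w a b)
     = (\<Sum>i\<in>UNIV. \<Sum>j\<in>UNIV. if i = r \<and> j = s then ?g i j else 0)"
    unfolding sum_letters sum.distrib[symmetric] by (intro sum.cong refl) (simp add: mentry_single)
  also have "\<dots> = ?g r s" by (rule sum_delta2)
  finally show ?thesis .
qed

text \<open>The generators \<open>q E\<^sub>r\<^sub>s - q\<^sup>* E\<^sub>s\<^sub>r\<close> with \<open>q = 1, i, j, k\<close>, and \<open>q E\<^sub>r\<^sub>r\<close> with \<open>q = i, j, k\<close>, give real relations.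
As the \<open>2 \<times> 2\<close> matrices of \<open>1, i, j, k\<close> span all complex \<open>2 \<times> 2\<close> matrices, complex combinations of
these relations yield the relation for each single pair of letters.\<close>

lemma group_invariant_imp_lie_invariant:
  fixes T :: "(int \<Rightarrow> 'N::finite \<times> bool) \<Rightarrow> complex"
  assumes dep: "depends_on (pm n) T"
    and inv: "\<And>U x. U \<in> Sp \<Longrightarrow> T x = (\<Sum>y\<in>words (pm n). (\<Prod>j\<in>pm n. cnj (mentry U (y j) (x j))) * T y)"
  shows "lie_invariant (pm n) (\<lambda>x. Re (T x))" "lie_invariant (pm n) (\<lambda>x. Im (T x))"
proof -
  define w where "w x a b = (\<Sum>j\<in>pm n. if x j = a then T (x(j := b)) else 0)" for x a b
  have gen: "(\<Sum>a\<in>UNIV. \<Sum>b\<in>UNIV. mentry S a b * w x a b) = 0" if "adj S = - S" "S ** S ** S = - S" for S x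
  proof -
    have "(\<Sum>a\<in>UNIV. \<Sum>b\<in>UNIV. mentry S a b * w x a b)
      = (\<Sum>a\<in>UNIV. \<Sum>b\<in>UNIV. \<Sum>j\<in>pm n. if x j = a then mentry S (x j) b * T (x(j := b)) else 0)"
      unfolding w_def sum_distrib_left by (intro sum.cong refl) simp
    also have "\<dots> = (\<Sum>a\<in>UNIV. \<Sum>j\<in>pm n. \<Sum>b\<in>UNIV. if x j = a then mentry S (x j) b * T (x(j := b)) else 0)"
      by (intro sum.cong refl sum.swap)
    also have "\<dots> = (\<Sum>j\<in>pm n. \<Sum>a\<in>UNIV. \<Sum>b\<in>UNIV. if x j = a then mentry S (x j) b * T (x(j := b)) else 0)"
      by (rule sum.swap)
    also have "\<dots> = (\<Sum>j\<in>pm n. \<Sum>b\<in>UNIV. \<Sum>a\<in>UNIV. if x j = a then mentry S (x j) b * T (x(j := b)) else 0)"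
      by (intro sum.cong refl sum.swap)
    also have "\<dots> = (\<Sum>j\<in>pm n. \<Sum>b\<in>UNIV. mentry S (x j) b * T (x(j := b)))" by simp
    also have "\<dots> = 0" by (rule invariant_under_rotations[OF dep inv that])
    finally show ?thesis .
  qed
  let ?i = "Quat 0 1 0 0" and ?j = "Quat 0 0 1 0" and ?k = "Quat 0 0 0 1"
  have main: "w x u v - of_real (spin u * spin v) * w x (flip v) (flip u) = 0" for x u v
  proof -
    obtain r e where u: "u = (r, e)" by (cases u)
    obtain s f where v: "v = (s, f)" by (cases v)
    show ?thesis
    proof (cases "r = s")
      case False
      have off: "(\<Sum>a\<in>UNIV. \<Sum>b\<in>UNIV. mentry (single q r s) a b * w x a b)
          - (\<Sum>a\<in>UNIV. \<Sum>b\<in>UNIV. mentry (single (quat_cnj q) s r) a b * w x a b) = 0"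
        if "q * quat_cnj q = 1" "quat_cnj q * q = 1" for q
        using gen[OF off_diagonal_generator[OF False that], of x]
        by (simp add: mentry_diff left_diff_distrib sum_subtractf)
      have "w x (r, True) (s, True) + w x (r, False) (s, False) - (w x (s, True) (r, True) + w x (s, False) (r, False)) = 0"
        using off[of 1] unfolding sum_mentry_single by (simp add: quat_entry_def quat_cnj_def times_quat_def one_quat_def complex_eq_iff)
      moreover have "\<i> * (w x (r, True) (s, True) - w x (r, False) (s, False) + (w x (s, True) (r, True) - w x (s, False) (r, False))) = 0"
        using off[of ?i] unfolding sum_mentry_single
        by (simp add: quat_entry_def quat_cnj_def times_quat_def one_quat_def complex_eq_iff)
      moreover have "w x (r, True) (s, False) - w x (r, False) (s, True) + (w x (s, True) (r, False) - w x (s, False) (r, True)) = 0"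
        using off[of ?j] unfolding sum_mentry_single
        by (simp add: quat_entry_def quat_cnj_def times_quat_def one_quat_def complex_eq_iff)
      moreover have "\<i> * (w x (r, True) (s, False) + w x (r, False) (s, True) + (w x (s, True) (r, False) + w x (s, False) (r, True))) = 0"
        using off[of ?k] unfolding sum_mentry_single
        by (simp add: quat_entry_def quat_cnj_def times_quat_def one_quat_def complex_eq_iff)
      ultimately show ?thesis unfolding u v
        by (cases e; cases f) (simp_all add: spin_def flip_def complex_eq_iff)
    next
      case True
      have diag: "(\<Sum>a\<in>UNIV. \<Sum>b\<in>UNIV. mentry (single q r r) a b * w x a b) = 0"
        if "quat_cnj q = - q" "q * q = - 1" for q
        by (rule gen[OF diagonal_generator[OF that]])
      have "\<i> * (w x (r, True) (r, True) - w x (r, False) (r, False)) = 0"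
        using diag[of ?i] unfolding sum_mentry_single
        by (simp add: quat_entry_def quat_cnj_def times_quat_def one_quat_def uminus_quat_def complex_eq_iff)
      moreover have "w x (r, True) (r, False) - w x (r, False) (r, True) = 0"
        using diag[of ?j] unfolding sum_mentry_single
        by (simp add: quat_entry_def quat_cnj_def times_quat_def one_quat_def uminus_quat_def complex_eq_iff)
      moreover have "\<i> * (w x (r, True) (r, False) + w x (r, False) (r, True)) = 0"
        using diag[of ?k] unfolding sum_mentry_single
        by (simp add: quat_entry_def quat_cnj_def times_quat_def one_quat_def uminus_quat_def complex_eq_iff)
      ultimately show ?thesis unfolding u v True[symmetric]
        by (cases e; cases f) (simp_all add: spin_def flip_def complex_eq_iff)
    qed
  qed
  have sum0: "(\<Sum>j\<in>pm n. (if x j = u then T (x(j := v)) else 0)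
      - (if x j = flip v then of_real (spin u * spin v) * T (x(j := flip u)) else 0)) = 0" for x u v
  proof -
    have "(\<Sum>j\<in>pm n. if x j = flip v then of_real (spin u * spin v) * T (x(j := flip u)) else 0)
      = of_real (spin u * spin v) * w x (flip v) (flip u)"
      unfolding w_def sum_distrib_left by (intro sum.cong refl) simp
    then show ?thesis using main[of x u v] by (simp only: sum_subtractf w_def)
  qed
  show "lie_invariant (pm n) (\<lambda>x. Re (T x))" unfolding lie_invariant_def
  proof (intro allI)
    fix x u v
    have "(\<Sum>j\<in>pm n. (if x j = u then Re (T (x(j := v))) else 0)
      - (if x j = flip v then spin u * spin v * Re (T (x(j := flip u))) else 0))
      = Re (\<Sum>j\<in>pm n. (if x j = u then T (x(j := v)) else 0)
      - (if x j = flip v then of_real (spin u * spin v) * T (x(j := flip u)) else 0))"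
      unfolding Re_sum by (intro sum.cong refl) simp
    then show "(\<Sum>j\<in>pm n. (if x j = u then Re (T (x(j := v))) else 0)
      - (if x j = flip v then spin u * spin v * Re (T (x(j := flip u))) else 0)) = 0"
      unfolding sum0 by simp
  qed
  show "lie_invariant (pm n) (\<lambda>x. Im (T x))" unfolding lie_invariant_def
  proof (intro allI)
    fix x u v
    have "(\<Sum>j\<in>pm n. (if x j = u then Im (T (x(j := v))) else 0)
      - (if x j = flip v then spin u * spin v * Im (T (x(j := flip u))) else 0))
      = Im (\<Sum>j\<in>pm n. (if x j = u then T (x(j := v)) else 0)
      - (if x j = flip v then of_real (spin u * spin v) * T (x(j := flip u)) else 0))"
      unfolding Im_sum by (intro sum.cong refl) simp
    then show "(\<Sum>j\<in>pm n. (if x j = u then Im (T (x(j := v))) else 0)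
      - (if x j = flip v then spin u * spin v * Im (T (x(j := flip u))) else 0)) = 0"
      unfolding sum0 by simp
  qed
qed

section \<open>The moments of symplectically invariant matrices\<close>

lemma prod_int_nat: "(\<Prod>k\<in>{1..int n}. f k) = (\<Prod>k\<in>{1..n}. f (int k))"
proof (rule prod.reindex_bij_betw[symmetric])
  show "bij_betw int {1..n} {1..int n}"
    by (rule bij_betw_byWitness[where f'=nat]) auto
qed

lemma measurable_tentry: "(\<lambda>A. tentry A u v) \<in> borel_measurable borel"
proof -
  have "linear (\<lambda>A. tentry A u v)"
    by (rule linearI) (simp_all add: tentry_def mentry_add mentry_scaleR algebra_simps scaleR_conv_of_real)
  then have "continuous_on UNIV (\<lambda>A. tentry A u v)"
    by (intro linear_continuous_on) (simp add: linear_conv_bounded_linear)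
  then show ?thesis by (rule borel_measurable_continuous_onI)
qed

lemma measurable_conj:
  fixes U :: "quat ^ 'N ^ 'N"
  shows "(\<lambda>A. adj U ** A ** U) \<in> borel_measurable borel"
proof -
  have "linear (\<lambda>A. adj U ** A ** U)"
    by (rule linearI) (simp_all add: matrix_add_left matrix_add_ldistrib matrix_scaleR_left matrix_scaleR_right)
  then have "continuous_on UNIV (\<lambda>A. adj U ** A ** U)"
    by (intro linear_continuous_on) (simp add: linear_conv_bounded_linear)
  then show ?thesis by (rule borel_measurable_continuous_onI)
qed

definition moment_tensor :: "'w measure \<Rightarrow> nat \<Rightarrow> (nat \<Rightarrow> 'w \<Rightarrow> quat ^ 'N ^ 'N) \<Rightarrow> (int \<Rightarrow> 'N \<times> bool) \<Rightarrow> complex" where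
  "moment_tensor M n X x = (\<integral>\<omega>. (\<Prod>k\<in>{1..int n}. tentry (X (nat k) \<omega>) (x k) (x (- k))) \<partial>M)"

lemma depends_on_moment_tensor: "depends_on (pm n) (moment_tensor M n X)"
  unfolding depends_on_def
proof (intro allI impI)
  fix x y :: "int \<Rightarrow> 'a \<times> bool" assume xy: "\<forall>j\<in>pm n. x j = y j"
  have "(\<Prod>k\<in>{1..int n}. tentry (X (nat k) \<omega>) (x k) (x (- k))) = (\<Prod>k\<in>{1..int n}. tentry (X (nat k) \<omega>) (y k) (y (- k)))" for \<omega>
  proof (rule prod.cong[OF refl])
    fix k assume "k \<in> {1..int n}"
    then have "k \<in> pm n" "- k \<in> pm n" by (auto simp: pm_def)
    then show "tentry (X (nat k) \<omega>) (x k) (x (- k)) = tentry (X (nat k) \<omega>) (y k) (y (- k))" using xy by simp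
  qed
  then show "moment_tensor M n X x = moment_tensor M n X y" by (simp add: moment_tensor_def)
qed

lemma moment_tensor_Sp_invariant:
  fixes X :: "nat \<Rightarrow> 'w \<Rightarrow> quat ^ 'N::finite ^ 'N"
  assumes X: "\<And>k. k \<in> {1..n} \<Longrightarrow> X k \<in> borel_measurable M"
    and si: "symplectically_invariant M n X" and U: "U \<in> Sp"
    and int: "\<And>y. integrable M (\<lambda>\<omega>. \<Prod>k\<in>{1..int n}. tentry (X (nat k) \<omega>) (y k) (y (- k)))"
  shows "moment_tensor M n X x = (\<Sum>y\<in>words (pm n). (\<Prod>j\<in>pm n. cnj (mentry U (y j) (x j))) * moment_tensor M n X y)"
proof -
  let ?N = "\<Pi>\<^sub>M k\<in>{1..n}. (borel :: (quat ^ 'N ^ 'N) measure)"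
  define g where "g Y = (\<Prod>k\<in>{1..n}. tentry (Y k) (x (int k)) (x (- int k)))" for Y :: "nat \<Rightarrow> quat ^ 'N ^ 'N"
  have g: "g \<in> borel_measurable ?N"
    unfolding g_def
  proof (rule borel_measurable_prod)
    fix k assume "k \<in> {1..n}"
    then have "(\<lambda>Y. Y k) \<in> measurable ?N borel" by (rule measurable_component_singleton)
    then show "(\<lambda>Y. tentry (Y k) (x (int k)) (x (- int k))) \<in> borel_measurable ?N"
      by (rule measurable_compose[OF _ measurable_tentry])
  qed
  have m1: "(\<lambda>\<omega>. \<lambda>k\<in>{1..n}. X k \<omega>) \<in> measurable M ?N"
    by (rule measurable_restrict) (rule X)
  have m2: "(\<lambda>\<omega>. \<lambda>k\<in>{1..n}. adj U ** X k \<omega> ** U) \<in> measurable M ?N"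
    by (rule measurable_restrict) (rule measurable_compose[OF X measurable_conj])
  have gr: "g (\<lambda>k\<in>{1..n}. Y k) = (\<Prod>k\<in>{1..int n}. tentry (Y (nat k)) (x k) (x (- k)))" for Y
    unfolding prod_int_nat g_def by (rule prod.cong) auto
  have "moment_tensor M n X x = (\<integral>\<omega>. g (\<lambda>k\<in>{1..n}. X k \<omega>) \<partial>M)"
    by (simp only: moment_tensor_def gr)
  also have "\<dots> = integral\<^sup>L (distr M ?N (\<lambda>\<omega>. \<lambda>k\<in>{1..n}. X k \<omega>)) g"
    by (rule integral_distr[OF m1 g, symmetric])
  also have "distr M ?N (\<lambda>\<omega>. \<lambda>k\<in>{1..n}. X k \<omega>) = distr M ?N (\<lambda>\<omega>. \<lambda>k\<in>{1..n}. adj U ** X k \<omega> ** U)"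
    using si U by (simp add: symplectically_invariant_def)
  also have "integral\<^sup>L (distr M ?N (\<lambda>\<omega>. \<lambda>k\<in>{1..n}. adj U ** X k \<omega> ** U)) g
    = (\<integral>\<omega>. g (\<lambda>k\<in>{1..n}. adj U ** X k \<omega> ** U) \<partial>M)"
    by (rule integral_distr[OF m2 g])
  also have "\<dots> = (\<integral>\<omega>. (\<Sum>y\<in>words (pm n). (\<Prod>j\<in>pm n. cnj (mentry U (y j) (x j))) *
      (\<Prod>k\<in>{1..int n}. tentry (X (nat k) \<omega>) (y k) (y (- k)))) \<partial>M)"
  proof (intro Bochner_Integration.integral_cong refl)
    fix \<omega>
    have "(\<Prod>j\<in>pm n. cnj (mentry U (y j) (x j))) = (\<Prod>k\<in>{1..int n}. cnj (mentry U (y k) (x k)) * cnj (mentry U (y (- k)) (x (- k))))" for y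
    proof -
      have "(\<Prod>j\<in>pm n. cnj (mentry U (y j) (x j)))
        = (\<Prod>j\<in>{1..int n}. cnj (mentry U (y j) (x j))) * (\<Prod>j\<in>uminus ` {1..int n}. cnj (mentry U (y j) (x j)))"
        unfolding pm_split(1) by (rule prod.union_disjoint) (simp_all add: pm_split(2))
      also have "(\<Prod>j\<in>uminus ` {1..int n}. cnj (mentry U (y j) (x j))) = (\<Prod>k\<in>{1..int n}. cnj (mentry U (y (- k)) (x (- k))))"
        by (subst prod.reindex) (simp_all add: comp_def)
      finally show ?thesis by (simp only: prod.distrib)
    qed
    note split = this
    have "g (\<lambda>k\<in>{1..n}. adj U ** X k \<omega> ** U) = (\<Prod>k\<in>{1..int n}. \<Sum>c\<in>UNIV. \<Sum>d\<in>UNIV.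
        cnj (mentry U c (x k)) * cnj (mentry U d (x (- k))) * tentry (X (nat k) \<omega>) c d)"
      by (simp only: gr tentry_conj)
    also have "\<dots> = (\<Sum>y\<in>words (pm n). \<Prod>k\<in>{1..int n}.
        cnj (mentry U (y k) (x k)) * cnj (mentry U (y (- k)) (x (- k))) * tentry (X (nat k) \<omega>) (y k) (y (- k)))"
      by (rule prod_sum_words)
    finally show "g (\<lambda>k\<in>{1..n}. adj U ** X k \<omega> ** U) = (\<Sum>y\<in>words (pm n). (\<Prod>j\<in>pm n. cnj (mentry U (y j) (x j))) *
      (\<Prod>k\<in>{1..int n}. tentry (X (nat k) \<omega>) (y k) (y (- k))))"
      by (simp only: split prod.distrib)
  qed
  also have "\<dots> = (\<Sum>y\<in>words (pm n). (\<Prod>j\<in>pm n. cnj (mentry U (y j) (x j))) * moment_tensor M n X y)"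
    unfolding moment_tensor_def by (simp add: int)
  finally show ?thesis .
qed

lemma tentry_quat_entry:
  "tentry A u v = of_real (spin v) * quat_entry (A $ fst u $ fst v) (if snd u then 1 else - 1) (if snd v then - 1 else 1)"
  by (simp add: tentry_def mentry_def flip_def)

text \<open>Here \<open>c = 2N\<close>, \<open>a = #(\<alpha>)/2\<close>, \<open>p = #(\<pi>)/2\<close>, and \<open>j\<close> is the number of blocks of the join: the powers of
\<open>2N\<close> from the expansion, from the cumulant and from the normalized Weingarten function are reduced to
a sign and the normalization of the trace.\<close>

lemma powi_bookkeeping:
  fixes c :: complex
  assumes c: "c \<noteq> 0"
  shows "c powi (int a - int n) * ((- 1) ^ n * (- c) powi (int a + int p + int j - int n - int (2 * a)) * (- c) powi (2 * int n - int j))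
    = (- 1) ^ a * (- c) ^ p"
proof -
  have mc: "- c \<noteq> 0" using c by simp
  have "(- c) powi (int a + int p + int j - int n - int (2 * a)) * (- c) powi (2 * int n - int j)
     = (- c) powi ((int a + int p + int j - int n - int (2 * a)) + (2 * int n - int j))"
    by (rule power_int_add[symmetric]) (simp add: c)
  also have "(int a + int p + int j - int n - int (2 * a)) + (2 * int n - int j) = int p + (int n - int a)" by simp
  also have "(- c) powi (int p + (int n - int a)) = (- c) ^ p * (- c) powi (int n - int a)" using mc by (simp add: power_int_add)
  finally have 1: "(- c) powi (int a + int p + int j - int n - int (2 * a)) * (- c) powi (2 * int n - int j)
     = (- c) ^ p * (- c) powi (int n - int a)" .
  have 2: "(- c) powi (int n - int a) = (- 1) powi (int n - int a) * c powi (int n - int a)"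
    using power_int_mult_distrib[of "- 1" c "int n - int a"] by simp
  have 3: "c powi (int a - int n) * c powi (int n - int a) = 1"
    using c by (simp add: power_int_add[symmetric])
  have 4: "(- 1) ^ n * (- 1) powi (int n - int a) = ((- 1) ^ a :: complex)"
    by (simp add: power_int_diff power_mult_distrib[symmetric] power_add[symmetric] divide_simps)
  have "c powi (int a - int n) * ((- 1) ^ n * ((- c) ^ p * (- c) powi (int n - int a)))
    = ((- 1) ^ n * (- 1) powi (int n - int a)) * (c powi (int a - int n) * c powi (int n - int a)) * (- c) ^ p"
    by (simp only: 2 mult_ac)
  also have "\<dots> = (- 1) ^ a * (- c) ^ p" by (simp only: 3 4 mult_1_right)
  finally have "c powi (int a - int n) * ((- 1) ^ n * ((- c) ^ p * (- c) powi (int n - int a))) = (- 1) ^ a * (- c) ^ p" .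
  then show ?thesis by (simp only: 1 mult.assoc)
qed

theorem proposition6p16:
  fixes M :: "'w measure" and n :: nat and X :: "nat \<Rightarrow> 'w \<Rightarrow> quat ^ 'N ^ 'N"
    and \<iota> :: "int \<Rightarrow> 'N" and \<eta> :: "int \<Rightarrow> int"
  assumes "prob_space M"
    and "\<And>k. k \<in> {1..n} \<Longrightarrow> X k \<in> borel_measurable M"
    and "symplectically_invariant M n X"
    and "\<And>(i :: int \<Rightarrow> 'N) h. h \<in> pm n \<rightarrow> {1, -1} \<Longrightarrow>
          integrable M (\<lambda>\<omega>. \<Prod>k\<in>{1..n}.
            quat_entry (X k \<omega> $ i (int k) $ i (- int k)) (h (int k)) (h (- int k)))"
    and "\<And>\<pi>. \<pi> \<in> PM n \<Longrightarrow> integrable M (\<lambda>\<omega>. Re_tr n \<pi> (\<lambda>k. X k \<omega>))"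
    and "\<eta> \<in> pm n \<rightarrow> {1, -1}"
  shows "(\<integral>\<omega>. (\<Prod>k\<in>{1..n}.
            quat_entry (X k \<omega> $ \<iota> (int k) $ \<iota> (- int k)) (\<eta> (int k)) (\<eta> (- int k))) \<partial>M)
       = (\<Sum>\<alpha> | \<alpha> \<in> PM n
               \<and> (\<forall>k\<in>pm n. \<iota> k = \<iota> (delta n (\<alpha> k)))
               \<and> (\<forall>k\<in>pm n. sgn k * \<eta> k = sgn (\<alpha> k) * \<eta> (delta n (\<alpha> k))).
            (2 * of_nat CARD('N)) powi (int (num_orbits (pm n) \<alpha> div 2) - int n)
            * (\<Prod>k | k \<in> {1..n} \<and> - int k \<in> FD n \<alpha>. of_int (\<eta> (int k) * \<eta> (- int k)))
            * matrix_cumulant M n X \<alpha>)"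
proof -
  let ?C = "of_nat CARD('N) :: complex"
  let ?T = "moment_tensor M n X"
  let ?h = "\<lambda>\<alpha>. num_orbits (pm n) \<alpha> div 2"
  \<comment> \<open>the word whose spins are \<open>sgn \<cdot> \<eta>\<close>; the column letters, at the negative places, are thereby
    flipped, as in the twisted entries\<close>
  define x :: "int \<Rightarrow> 'N \<times> bool" where "x j = (\<iota> j, sgn j * \<eta> j = 1)" for j
  have \<eta>: "\<eta> j = 1 \<or> \<eta> j = - 1" if "j \<in> pm n" for j using assms(6) that by auto
  have spin_x: "spin (x j) = of_int (sgn j * \<eta> j)" if "j \<in> pm n" for j
  proof -
    have "sgn j = 1 \<or> sgn j = - 1" using that by (auto simp: pm_def sgn_if)
    then show ?thesis using \<eta>[OF that] by (auto simp: spin_def x_def)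
  qed
  have int: "integrable M (\<lambda>\<omega>. \<Prod>k\<in>{1..int n}. tentry (X (nat k) \<omega>) (y k) (y (- k)))" for y
  proof -
    \<comment> \<open>at a negative place the sign index is opposite to the spin of the letter\<close>
    define hh :: "int \<Rightarrow> int" where "hh j = (if (j > 0) = snd (y j) then 1 else - 1)" for j
    have "(\<Prod>k\<in>{1..int n}. tentry (X (nat k) \<omega>) (y k) (y (- k)))
      = (\<Prod>k\<in>{1..n}. of_real (spin (y (- int k)))) * (\<Prod>k\<in>{1..n}.
          quat_entry (X k \<omega> $ fst (y (int k)) $ fst (y (- int k))) (hh (int k)) (hh (- int k)))" for \<omega>
      unfolding prod_int_nat prod.distrib[symmetric]
      by (rule prod.cong) (auto simp: tentry_quat_entry hh_def)
    moreover have "integrable M (\<lambda>\<omega>. \<Prod>k\<in>{1..n}.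
          quat_entry (X k \<omega> $ fst (y (int k)) $ fst (y (- int k))) (hh (int k)) (hh (- int k)))"
      by (rule assms(4)) (auto simp: hh_def)
    ultimately show ?thesis by simp
  qed
  have dep: "depends_on (pm n) ?T" by (rule depends_on_moment_tensor)
  have inv: "?T z = (\<Sum>y\<in>words (pm n). (\<Prod>j\<in>pm n. cnj (mentry U (y j) (z j))) * ?T y)" if "U \<in> Sp" for U z
    by (rule moment_tensor_Sp_invariant[OF assms(2,3) that int])
  note lie = group_invariant_imp_lie_invariant[OF dep inv]
  have trace: "(\<Sum>y\<in>words (pm n). of_real (pairing_tensor n (delta n \<circ> inv \<pi>) y) * ?T y)
    = (- 2 * ?C) ^ ?h \<pi> * (\<integral>\<omega>. Re_tr n \<pi> (\<lambda>k. X k \<omega>) \<partial>M)" if "\<pi> \<in> PM n" for \<pi>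
  proof -
    have "(\<Sum>y\<in>words (pm n). of_real (pairing_tensor n (delta n \<circ> inv \<pi>) y) * ?T y)
      = (\<integral>\<omega>. (\<Sum>y\<in>words (pm n). of_real (pairing_tensor n (delta n \<circ> inv \<pi>) y) *
          (\<Prod>k\<in>{1..int n}. tentry (X (nat k) \<omega>) (y k) (y (- k)))) \<partial>M)"
      unfolding moment_tensor_def by (simp add: int)
    also have "\<dots> = (\<integral>\<omega>. (- 2 * ?C) ^ ?h \<pi> * Re_tr n \<pi> (\<lambda>k. X k \<omega>) \<partial>M)"
    proof (intro Bochner_Integration.integral_cong refl)
      fix \<omega>
      show "(\<Sum>y\<in>words (pm n). of_real (pairing_tensor n (delta n \<circ> inv \<pi>) y) *
          (\<Prod>k\<in>{1..int n}. tentry (X (nat k) \<omega>) (y k) (y (- k)))) = (- 2 * ?C) ^ ?h \<pi> * Re_tr n \<pi> (\<lambda>k. X k \<omega>)"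
        by (rule trace_contraction[OF that, of "\<lambda>k. X k \<omega>"])
    qed
    finally show ?thesis by simp
  qed
  define s where "s = (\<Prod>k\<in>{1..int n}. spin (x (- k)))"
  define cond where "cond \<alpha> \<longleftrightarrow> (\<forall>k\<in>pm n. x (delta n (\<alpha> k)) = flip (x k))" for \<alpha>
  define b where "b \<alpha> = (\<Prod>k | k \<in> {1..n} \<and> - int k \<in> FD n \<alpha>. of_int (\<eta> (int k) * \<eta> (- int k)) :: complex)" for \<alpha>
  have lhs: "(\<integral>\<omega>. (\<Prod>k\<in>{1..n}. quat_entry (X k \<omega> $ \<iota> (int k) $ \<iota> (- int k)) (\<eta> (int k)) (\<eta> (- int k))) \<partial>M)
    = of_real s * ?T x"
  proof -
    have "(\<Prod>k\<in>{1..n}. quat_entry (X k \<omega> $ \<iota> (int k) $ \<iota> (- int k)) (\<eta> (int k)) (\<eta> (- int k)))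
      = of_real s * (\<Prod>k\<in>{1..int n}. tentry (X (nat k) \<omega>) (x k) (x (- k)))" for \<omega>
      unfolding s_def of_real_prod prod_int_nat prod.distrib[symmetric]
    proof (rule prod.cong[OF refl])
      fix k assume "k \<in> {1..n}"
      then have "int k \<in> pm n" "- int k \<in> pm n" "k > 0" by (auto simp: pm_def)
      then show "quat_entry (X k \<omega> $ \<iota> (int k) $ \<iota> (- int k)) (\<eta> (int k)) (\<eta> (- int k))
        = of_real (spin (x (- int k))) * tentry (X (nat (int k)) \<omega>) (x (int k)) (x (- int k))"
        using \<eta>[of "int k"] \<eta>[of "- int k"] by (auto simp: tentry_quat_entry x_def spin_def)
    qed
    then show ?thesis by (simp add: moment_tensor_def)
  qed
  have cond_iff: "cond \<alpha> \<longleftrightarrow> (\<forall>k\<in>pm n. \<iota> k = \<iota> (delta n (\<alpha> k)))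
      \<and> (\<forall>k\<in>pm n. sgn k * \<eta> k = sgn (\<alpha> k) * \<eta> (delta n (\<alpha> k)))" if \<alpha>: "\<alpha> \<in> PM n" for \<alpha>
  proof -
    have "x (delta n (\<alpha> k)) = flip (x k) \<longleftrightarrow> \<iota> k = \<iota> (delta n (\<alpha> k)) \<and> sgn k * \<eta> k = sgn (\<alpha> k) * \<eta> (delta n (\<alpha> k))"
      if k: "k \<in> pm n" for k
    proof -
      have ak: "- \<alpha> k \<in> pm n" using PM_D(4)[OF \<alpha>, of k] k by simp
      have "x (- \<alpha> k) = flip (x k) \<longleftrightarrow> \<iota> (- \<alpha> k) = \<iota> k \<and> spin (x (- \<alpha> k)) = - spin (x k)"
        by (simp add: eq_flip_iff) (simp add: x_def)
      also have "spin (x (- \<alpha> k)) = - spin (x k) \<longleftrightarrow> sgn k * \<eta> k = sgn (\<alpha> k) * \<eta> (- \<alpha> k)"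
        unfolding spin_x[OF ak] spin_x[OF k] by (simp add: sgn_minus flip: of_int_mult) (metis of_int_eq_iff of_int_mult)
      finally show ?thesis unfolding delta_PM_neg[OF \<alpha> k] by metis
    qed
    then show ?thesis unfolding cond_def by blast
  qed
  have ind: "of_real s * of_real (pairing_tensor n (delta n \<circ> \<alpha>) x) = (- 1) ^ ?h \<alpha> * (if cond \<alpha> then b \<alpha> else 0)" if \<alpha>: "\<alpha> \<in> PM n" for \<alpha>
  proof -
    have "b \<alpha> = of_real (\<Prod>k\<in>{k\<in>{1..int n}. - k \<in> FD n \<alpha>}. - (spin (x k) * spin (x (- k))))"
    proof -
      have "(\<Prod>k\<in>{k\<in>{1..int n}. - k \<in> FD n \<alpha>}. - (spin (x k) * spin (x (- k))))
        = (\<Prod>k | k \<in> {1..n} \<and> - int k \<in> FD n \<alpha>. - (spin (x (int k)) * spin (x (- int k))))"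
      proof (rule prod.reindex_bij_betw[symmetric])
        show "bij_betw int {k. k \<in> {1..n} \<and> - int k \<in> FD n \<alpha>} {k\<in>{1..int n}. - k \<in> FD n \<alpha>}"
          by (rule bij_betw_byWitness[where f'=nat]) auto
      qed
      also have "\<dots> = (\<Prod>k | k \<in> {1..n} \<and> - int k \<in> FD n \<alpha>. of_int (\<eta> (int k) * \<eta> (- int k)))"
      proof (rule prod.cong[OF refl])
        fix k assume "k \<in> {k. k \<in> {1..n} \<and> - int k \<in> FD n \<alpha>}"
        then have k: "int k \<in> pm n" "- int k \<in> pm n" "k > 0" by (auto simp: pm_def)
        show "- (spin (x (int k)) * spin (x (- int k))) = of_int (\<eta> (int k) * \<eta> (- int k))"
          using k(3) unfolding spin_x[OF k(1)] spin_x[OF k(2)] by simp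
      qed
      finally show ?thesis by (simp add: b_def)
    qed
    then show ?thesis
      using arg_cong[OF pairing_tensor_indicator[OF \<alpha>, of x], of "of_real :: real \<Rightarrow> complex"]
      unfolding s_def[symmetric] cond_def[symmetric] by (simp split: if_splits)
  qed
  have fPM: "finite (PM n)"
    using bij_betw_finite[OF bij_PM_pairings[of n]] finite_pairings[OF finite_pm] by simp
  let ?E = "\<lambda>\<pi>. \<integral>\<omega>. Re_tr n \<pi> (\<lambda>k. X k \<omega>) \<partial>M"
  let ?W = "\<lambda>\<alpha> \<pi>. of_real (Wg CARD('N) (pm n) (delta n \<circ> \<alpha>) (delta n \<circ> inv \<pi>)) :: complex"
  have cumulant: "(2 * ?C) powi (int (?h \<alpha>) - int n) * matrix_cumulant M n X \<alpha>
    = (- 1) ^ ?h \<alpha> * (\<Sum>\<pi>\<in>PM n. ?W \<alpha> \<pi> * ((- 2 * ?C) ^ ?h \<pi> * ?E \<pi>))" if \<alpha>: "\<alpha> \<in> PM n" for \<alpha>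
    unfolding matrix_cumulant_def sum_distrib_left
  proof (rule sum.cong[OF refl])
    fix \<pi> assume \<pi>: "\<pi> \<in> PM n"
    let ?j = "join_blocks (pm n) (delta n \<circ> \<alpha>) (delta n \<circ> inv \<pi>)"
    have chi: "euler_char n \<alpha> \<pi> - int (num_orbits (pm n) \<alpha>) = int (?h \<alpha>) + int (?h \<pi>) + int ?j - int n - int (2 * ?h \<alpha>)"
      using num_orbits_FD(3)[OF \<alpha>] unfolding euler_char_def join_blocks_PM[OF \<alpha> \<pi>] by simp
    have wg: "complex_of_real (wg CARD('N) (pm n) (delta n \<circ> \<alpha>) (delta n \<circ> inv \<pi>)) = (- (2 * ?C)) powi (2 * int n - int ?j) * ?W \<alpha> \<pi>"
      by (simp add: wg_def card_pm)
    have "(2 * ?C) \<noteq> 0" by simp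
    note book = powi_bookkeeping[OF this, of "?h \<alpha>" n "?h \<pi>" ?j]
    have "(2 * ?C) powi (int (?h \<alpha>) - int n) * ((- 1) ^ n * (- 2 * ?C) powi (euler_char n \<alpha> \<pi> - int (num_orbits (pm n) \<alpha>)) *
        complex_of_real (wg CARD('N) (pm n) (delta n \<circ> \<alpha>) (delta n \<circ> inv \<pi>)) * ?E \<pi>)
      = ((2 * ?C) powi (int (?h \<alpha>) - int n) * ((- 1) ^ n * (- (2 * ?C)) powi (int (?h \<alpha>) + int (?h \<pi>) + int ?j - int n - int (2 * ?h \<alpha>))
         * (- (2 * ?C)) powi (2 * int n - int ?j))) * (?W \<alpha> \<pi> * ?E \<pi>)"
      unfolding chi wg by (simp add: mult_ac)
    also have "\<dots> = (- 1) ^ ?h \<alpha> * (- (2 * ?C)) ^ ?h \<pi> * (?W \<alpha> \<pi> * ?E \<pi>)" by (simp only: book)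
    finally show "(2 * ?C) powi (int (?h \<alpha>) - int n) * ((- 1) ^ n * (- 2 * ?C) powi (euler_char n \<alpha> \<pi> - int (num_orbits (pm n) \<alpha>)) *
        complex_of_real (wg CARD('N) (pm n) (delta n \<circ> \<alpha>) (delta n \<circ> inv \<pi>)) * ?E \<pi>)
      = (- 1) ^ ?h \<alpha> * (?W \<alpha> \<pi> * ((- 2 * ?C) ^ ?h \<pi> * ?E \<pi>))" by (simp add: mult_ac)
  qed
  have "bij_betw (\<lambda>\<pi>. delta n \<circ> inv \<pi>) (PM n) (pairings (pm n))"
    using bij_betw_trans[OF bij_inv_PM bij_PM_pairings] by (simp only: comp_def)
  note inner = sum.reindex_bij_betw[OF this, symmetric]
  have "?T x = (\<Sum>p\<in>pairings (pm n). of_real (pairing_tensor n p x) *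
    (\<Sum>q\<in>pairings (pm n). of_real (Wg CARD('N) (pm n) p q) * (\<Sum>y\<in>words (pm n). of_real (pairing_tensor n q y) * ?T y)))"
    by (rule complex_invariant_expansion[OF lie dep])
  also have "\<dots> = (\<Sum>\<alpha>\<in>PM n. of_real (pairing_tensor n (delta n \<circ> \<alpha>) x) *
    (\<Sum>q\<in>pairings (pm n). of_real (Wg CARD('N) (pm n) (delta n \<circ> \<alpha>) q) * (\<Sum>y\<in>words (pm n). of_real (pairing_tensor n q y) * ?T y)))"
    by (rule sum.reindex_bij_betw[OF bij_PM_pairings, symmetric])
  also have "\<dots> = (\<Sum>\<alpha>\<in>PM n. of_real (pairing_tensor n (delta n \<circ> \<alpha>) x) *
    (\<Sum>\<pi>\<in>PM n. ?W \<alpha> \<pi> * (\<Sum>y\<in>words (pm n). of_real (pairing_tensor n (delta n \<circ> inv \<pi>) y) * ?T y)))"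
    by (simp only: inner)
  also have "\<dots> = (\<Sum>\<alpha>\<in>PM n. of_real (pairing_tensor n (delta n \<circ> \<alpha>) x) *
    (\<Sum>\<pi>\<in>PM n. ?W \<alpha> \<pi> * ((- 2 * ?C) ^ ?h \<pi> * ?E \<pi>)))"
    by (intro sum.cong refl arg_cong2[where f="(*)"] trace)
  finally have "of_real s * ?T x = (\<Sum>\<alpha>\<in>PM n. (of_real s * of_real (pairing_tensor n (delta n \<circ> \<alpha>) x)) *
    (\<Sum>\<pi>\<in>PM n. ?W \<alpha> \<pi> * ((- 2 * ?C) ^ ?h \<pi> * ?E \<pi>)))"
    by (simp only: sum_distrib_left mult.assoc)
  also have "\<dots> = (\<Sum>\<alpha>\<in>PM n. if cond \<alpha> then (2 * ?C) powi (int (?h \<alpha>) - int n) * b \<alpha> * matrix_cumulant M n X \<alpha> else 0)"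
  proof (rule sum.cong[OF refl])
    fix \<alpha> assume \<alpha>: "\<alpha> \<in> PM n"
    let ?Z = "\<Sum>\<pi>\<in>PM n. ?W \<alpha> \<pi> * ((- 2 * ?C) ^ ?h \<pi> * ?E \<pi>)"
    have "(of_real s * of_real (pairing_tensor n (delta n \<circ> \<alpha>) x)) * ?Z = (if cond \<alpha> then b \<alpha> * ((- 1) ^ ?h \<alpha> * ?Z) else 0)"
      unfolding ind[OF \<alpha>] by simp
    then show "(of_real s * of_real (pairing_tensor n (delta n \<circ> \<alpha>) x)) * ?Z
      = (if cond \<alpha> then (2 * ?C) powi (int (?h \<alpha>) - int n) * b \<alpha> * matrix_cumulant M n X \<alpha> else 0)"
      unfolding cumulant[OF \<alpha>, symmetric] by (simp add: mult_ac)
  qed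
  also have "\<dots> = (\<Sum>\<alpha>\<in>{\<alpha>\<in>PM n. cond \<alpha>}. (2 * ?C) powi (int (?h \<alpha>) - int n) * b \<alpha> * matrix_cumulant M n X \<alpha>)"
    by (rule sum.inter_filter[OF fPM, symmetric])
  also have "{\<alpha>\<in>PM n. cond \<alpha>} = {\<alpha>. \<alpha> \<in> PM n \<and> (\<forall>k\<in>pm n. \<iota> k = \<iota> (delta n (\<alpha> k)))
      \<and> (\<forall>k\<in>pm n. sgn k * \<eta> k = sgn (\<alpha> k) * \<eta> (delta n (\<alpha> k)))}"
    using cond_iff by blast
  finally show ?thesis unfolding lhs b_def .
qed

end
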